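(* Let $O\in\mathbb P$, let $u$ be a coordinate on $\mathbb P$ vanishing at $O$, and for $n\in\mathbb Z$ let $L_n={}_O\mathbf L^{X_n}:{}_O\mathbf W\to{}_O\mathbf W$, where $X_n=-u^{n+1}\,d/du$. Then for all $l,m\in\mathbb Z$ $$[L_l,L_m]=(l-m)L_{l+m}+\frac{l^3-l}{12}\,\delta_{l+m,0}.$$
   Context: $\mathbb P$ is a complex projective line and $O\in\mathbb P$; a coordinate is a meromorphic function with exactly one pole, which is simple. A meromorphic 1-form is of the second kind if all its residues vanish. ${}_O\mathbf K$ is the space of meromorphic 1-forms on $\mathbb P$ regular outside $O$ (these are automatically of the second kind), and ${}_O\mathbf W=S^*({}_O\mathbf K)$ is its symmetric algebra, with product $\otimes^s$ and vacuum $\mathbf 1=1\in\mathbb C$. Elements of $S^2$ are regarded as symmetric bidifferentials in two points $u_1,u_2$ (products being symmetrised by averaging). Hats mark omitted factors; $\mathcal L_X$ is the Lie derivative and $i_X$ is contraction. For a meromorphic vector field $X$ on $\mathbb P$, the operator ${}_O\mathbf L^X=\mathcal X^-+\mathcal X^0+\mathcal X^+:{}_O\mathbf W\to{}_O\mathbf W$, linear in $X$, is defined by $$\mathcal X^-(\alpha_1\otimes^s\cdots\otimes^s\alpha_p)=-\sum_{i<j}(\alpha_1\otimes^s\cdots\widehat{\alpha_i}\cdots\widehat{\alpha_j}\cdots\otimes^s\alpha_p)\,\mathrm{Res}_O\bigl((i_X\alpha_i)\alpha_j\bigr),$$ $$\mathcal X^0(\alpha_1\otimes^s\cdots\otimes^s\alpha_p)=\sum_i\alpha_1\otimes^s\cdots\otimes^s{}_O[\mathcal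 L_X\alpha_i]\otimes^s\cdots\otimes^s\alpha_p,$$ $$\mathcal X^+(\alpha_1\otimes^s\cdots\otimes^s\alpha_p)=\mathcal X^+(\mathbf 1)\otimes^s\alpha_1\otimes^s\cdots\otimes^s\alpha_p .$$ Here ${}_O[\cdot]$ is the linear projection on meromorphic forms of the second kind with ${}_O[\eta]=\eta$ if $\eta$ is regular away from $O$ and ${}_O[\eta]=0$ if $\eta$ is regular at $O$. Further, $\mathcal X^+(\mathbf 1)=0$ if $X$ is regular at $O$, and $\mathcal X^+(\mathbf 1)=\omega_X$ if $X=\xi(u)\,d/du$ is regular away from $O$, where $$\omega_X=\left\{\frac{2(\xi(u_1)-\xi(u_2))-(\xi'(u_1)+\xi'(u_2))(u_1-u_2)}{2(u_1-u_2)}\right\}\frac{du_1\otimes^s du_2}{(u_1-u_2)^2}\in S^2({}_O\mathbf K).$$ The form $\omega_X$ vanishes for vector fields regular on all of $\mathbb P$, so the two cases are consistent and extend linearly to all meromorphic $X$.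
   Formalization: The minus sign in front of the residue sum defining 𝒳⁻ is replaced by a plus: with the minus sign the claim fails, since [L_2,L_{-2}]𝟏 = −1/2 instead of 4L_0𝟏 + 1/2 = 1/2. *)

theory Defs
  imports
    "HOL-Complex_Analysis.Complex_Analysis"
    "HOL-Combinatorics.Permutations"
    "HOL-Library.Function_Algebras"
begin

section \<open>Meromorphic functions, 1-forms and vector fields on the projective line\<close>

text \<open>
  The projective line is \<open>\<complex> \<union> {\<infinity>}\<close> with affine coordinate \<open>z\<close>.
  A meromorphic section of weight \<open>k\<close> is written \<open>f(z) dz\<^sup>k\<close> and represented by its
  coefficient \<open>f\<close>: weight 0 for functions, 1 for 1-forms, -1 for vector fields \<open>f(z) d/dz\<close>.
  Unless stated otherwise a coefficient function matters only off a discrete set.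
\<close>

datatype proj_line = Affine complex | Infinity

text \<open>
  Coefficient in a chart centred at the given point: \<open>t = z - a\<close> at \<open>a\<close> and \<open>t = 1/z\<close> at
  \<open>\<infinity>\<close>, where \<open>dz = -t\<^sup>-\<^sup>2 dt\<close>.
\<close>

fun local_coeff :: "int \<Rightarrow> proj_line \<Rightarrow> (complex \<Rightarrow> complex) \<Rightarrow> complex \<Rightarrow> complex" where
  "local_coeff k (Affine a) f = (\<lambda>t. f (a + t))"
| "local_coeff k Infinity f = (\<lambda>t. f (1 / t) * (- 1 / t ^ 2) powi k)"

definition meromorphic_section :: "int \<Rightarrow> (complex \<Rightarrow> complex) \<Rightarrow> bool" where
  "meromorphic_section k f \<longleftrightarrow> (\<forall>p. local_coeff k p f meromorphic_on {0})"

definition regular_at :: "int \<Rightarrow> proj_line \<Rightarrow> (complex \<Rightarrow> complex) \<Rightarrow> bool" where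
  "regular_at k p f \<longleftrightarrow>
     (\<exists>g. g analytic_on {0} \<and> (\<forall>\<^sub>F t in at 0. local_coeff k p f t = g t))"

definition residue_at :: "proj_line \<Rightarrow> (complex \<Rightarrow> complex) \<Rightarrow> complex" where
  "residue_at p f = residue (local_coeff 1 p f) 0"

definition coordinate :: "(complex \<Rightarrow> complex) \<Rightarrow> bool" where
  "coordinate u \<longleftrightarrow> meromorphic_section 0 u \<and>
     (\<exists>p. is_pole (local_coeff 0 p u) 0 \<and> zorder (local_coeff 0 p u) 0 = -1 \<and>
          (\<forall>q. q \<noteq> p \<longrightarrow> regular_at 0 q u))"

definition vanishes_at :: "proj_line \<Rightarrow> (complex \<Rightarrow> complex) \<Rightarrow> bool" where
  "vanishes_at p u \<longleftrightarrow> (local_coeff 0 p u \<longlongrightarrow> 0) (at 0)"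

text \<open>
  Sections regular outside \<open>p\<close>. Being nicely meromorphic on \<open>\<complex>\<close> selects the canonical
  coefficient function (true values at regular points, 0 at poles), so that distinct functions
  are distinct sections.
\<close>

definition regular_outside :: "int \<Rightarrow> proj_line \<Rightarrow> (complex \<Rightarrow> complex) set" where
  "regular_outside k p = {f. meromorphic_section k f \<and> f nicely_meromorphic_on UNIV \<and>
     (\<forall>q. q \<noteq> p \<longrightarrow> regular_at k q f)}"

abbreviation K_space :: "proj_line \<Rightarrow> (complex \<Rightarrow> complex) set" where
  "K_space p \<equiv> regular_outside 1 p"

text \<open>\<open>\<L>\<^sub>X \<alpha>\<close> for \<open>X = \<xi>(z) d/dz\<close> and a 1-form \<open>\<alpha>\<close>, as coefficients.\<close>

definition lie_deriv :: "(complex \<Rightarrow> complex) \<Rightarrow> (complex \<Rightarrow> complex) \<Rightarrow> complex \<Rightarrow> complex" where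
  "lie_deriv \<xi> \<alpha> = (\<lambda>z. \<xi> z * deriv \<alpha> z + deriv \<xi> z * \<alpha> z)"

text \<open>
  Every form of the second kind is uniquely the sum of an element of \<open>K_space p\<close> and a
  form regular at \<open>p\<close>; the projection returns the first summand.
\<close>

definition second_kind_proj :: "proj_line \<Rightarrow> (complex \<Rightarrow> complex) \<Rightarrow> complex \<Rightarrow> complex" where
  "second_kind_proj p \<eta> = (THE \<kappa>. \<kappa> \<in> K_space p \<and> regular_at 1 p (\<eta> - \<kappa>))"


section \<open>The symmetric algebra of a space of 1-forms\<close>

text \<open>
  For a space \<open>V\<close> of functions, \<open>S\<^sup>p(V)\<close> is realised as the symmetric functions of \<open>p\<close>
  variables spanned by symmetrised products of elements of \<open>V\<close> (coefficients of symmetric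
  \<open>p\<close>-differentials). An element of the algebra assigns to a list of \<open>p\<close> points the value of
  its component of degree \<open>p\<close>.
\<close>

type_synonym multidiff = "complex list \<Rightarrow> complex"

definition cscale :: "complex \<Rightarrow> multidiff \<Rightarrow> multidiff" where
  "cscale c F = (\<lambda>zs. c * F zs)"

interpretation multidiff: vector_space cscale
  by unfold_locales (auto simp: cscale_def fun_eq_iff algebra_simps)

definition vacuum :: multidiff where
  "vacuum = (\<lambda>zs. if zs = [] then 1 else 0)"

definition degree_one :: "(complex \<Rightarrow> complex) \<Rightarrow> multidiff" where
  "degree_one \<alpha> = (\<lambda>zs. if length zs = 1 then \<alpha> (hd zs) else 0)"

text \<open>Tensor product followed by averaging over all permutations of the points.\<close>

definition sym_mult :: "multidiff \<Rightarrow> multidiff \<Rightarrow> multidiff" (infixr "\<otimes>\<^sub>s" 70) where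
  "F \<otimes>\<^sub>s G = (\<lambda>zs.
     (\<Sum>\<sigma> | \<sigma> permutes {..<length zs}. \<Sum>k\<le>length zs.
        F (take k (permute_list \<sigma> zs)) * G (drop k (permute_list \<sigma> zs))) / fact (length zs))"

definition sym_prod :: "(complex \<Rightarrow> complex) list \<Rightarrow> multidiff" where
  "sym_prod \<alpha>s = foldr (\<lambda>\<alpha> F. degree_one \<alpha> \<otimes>\<^sub>s F) \<alpha>s vacuum"

definition sym_alg :: "(complex \<Rightarrow> complex) set \<Rightarrow> multidiff set" where
  "sym_alg V = multidiff.span (sym_prod ` lists V)"

definition sym_power :: "nat \<Rightarrow> (complex \<Rightarrow> complex) set \<Rightarrow> multidiff set" where
  "sym_power p V = multidiff.span (sym_prod ` {\<alpha>s \<in> lists V. length \<alpha>s = p})"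

definition linear_on_sym_alg :: "(complex \<Rightarrow> complex) set \<Rightarrow> (multidiff \<Rightarrow> multidiff) \<Rightarrow> bool" where
  "linear_on_sym_alg V T \<longleftrightarrow>
     (\<forall>F\<in>sym_alg V. \<forall>G\<in>sym_alg V. T (F + G) = T F + T G) \<and>
     (\<forall>c. \<forall>F\<in>sym_alg V. T (cscale c F) = cscale c (T F))"

text \<open>
  The linear map on \<open>sym_alg V\<close> with prescribed values on decomposable elements; its values
  outside \<open>sym_alg V\<close> are irrelevant.
\<close>

definition linear_ext ::
    "(complex \<Rightarrow> complex) set \<Rightarrow> ((complex \<Rightarrow> complex) list \<Rightarrow> multidiff) \<Rightarrow> multidiff \<Rightarrow> multidiff" where
  "linear_ext V \<phi> = (SOME T. linear_on_sym_alg V T \<and> (\<forall>\<alpha>s\<in>lists V. T (sym_prod \<alpha>s) = \<phi> \<alpha>s))"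

abbreviation W_space :: "proj_line \<Rightarrow> multidiff set" where
  "W_space p \<equiv> sym_alg (K_space p)"


section \<open>The operator of a meromorphic vector field\<close>

text \<open>
  The source has a minus sign in front of the residue sum, which is dropped here. Its sign
  relative to \<open>omega\<close> matters: for \<open>p = 0\<close>, \<open>u = z\<close>, the field \<open>-z\<^sup>-\<^sup>1 d/dz\<close> creates
  \<open>-1/2 \<alpha> \<otimes>\<^sub>s \<alpha>\<close> with \<open>\<alpha> = z\<^sup>-\<^sup>2 dz\<close>, and \<open>-z\<^sup>3 d/dz\<close> contracts \<open>\<alpha> \<otimes>\<^sub>s \<alpha>\<close> to -1, which
  gives the central term \<open>(l\<^sup>3 - l)/12 = 1/2\<close> at \<open>l = 2\<close>. With the minus sign this becomes
  -1/2, and the relations fail on degree one for any central term. Changing the sign of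
  \<open>omega\<close> instead gives conjugate operators (by multiplication with \<open>\<i>\<^sup>p\<close> in degree \<open>p\<close>).
\<close>

definition X_minus :: "proj_line \<Rightarrow> (complex \<Rightarrow> complex) \<Rightarrow> multidiff \<Rightarrow> multidiff" where
  "X_minus p \<xi> = linear_ext (K_space p) (\<lambda>\<alpha>s.
     \<Sum>j<length \<alpha>s. \<Sum>i<j.
       cscale (residue_at p (\<lambda>z. (\<xi> z * (\<alpha>s ! i) z) * (\<alpha>s ! j) z)) (sym_prod (nths \<alpha>s (- {i, j}))))"

definition X_zero :: "proj_line \<Rightarrow> (complex \<Rightarrow> complex) \<Rightarrow> multidiff \<Rightarrow> multidiff" where
  "X_zero p \<xi> = linear_ext (K_space p) (\<lambda>\<alpha>s.
     \<Sum>i<length \<alpha>s. sym_prod (\<alpha>s[i := second_kind_proj p (lie_deriv \<xi> (\<alpha>s ! i))]))"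

text \<open>
  For a field regular outside \<open>p\<close>: the bidifferential given by the displayed formula off the
  diagonal and outside \<open>p\<close>. It is invariant under Moebius changes of coordinate, so it may
  be written in the coordinate \<open>z\<close>.
\<close>

definition omega :: "proj_line \<Rightarrow> (complex \<Rightarrow> complex) \<Rightarrow> multidiff" where
  "omega p \<xi> = (THE w. w \<in> sym_power 2 (K_space p) \<and>
     (\<forall>z1 z2. z1 \<noteq> z2 \<longrightarrow> Affine z1 \<noteq> p \<longrightarrow> Affine z2 \<noteq> p \<longrightarrow>
        w [z1, z2] =
          (2 * (\<xi> z1 - \<xi> z2) - (deriv \<xi> z1 + deriv \<xi> z2) * (z1 - z2)) / (2 * (z1 - z2))
            * (1 / (z1 - z2) ^ 2)))"

text \<open>Linear extension of \<open>X \<mapsto> omega\<close> by 0 on the fields regular at \<open>p\<close>.\<close>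

definition X_plus_vacuum :: "proj_line \<Rightarrow> (complex \<Rightarrow> complex) \<Rightarrow> multidiff" where
  "X_plus_vacuum p \<xi> =
     (THE w. \<exists>\<zeta>\<in>regular_outside (-1) p. regular_at (-1) p (\<xi> - \<zeta>) \<and> w = omega p \<zeta>)"

definition X_plus :: "proj_line \<Rightarrow> (complex \<Rightarrow> complex) \<Rightarrow> multidiff \<Rightarrow> multidiff" where
  "X_plus p \<xi> F = X_plus_vacuum p \<xi> \<otimes>\<^sub>s F"

definition L_op :: "proj_line \<Rightarrow> (complex \<Rightarrow> complex) \<Rightarrow> multidiff \<Rightarrow> multidiff" where
  "L_op p \<xi> F = X_minus p \<xi> F + X_zero p \<xi> F + X_plus p \<xi> F"

text \<open>\<open>-u\<^sup>n\<^sup>+\<^sup>1 d/du\<close>, using \<open>d/du = (1/u'(z)) d/dz\<close>.\<close>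

definition mode_field :: "(complex \<Rightarrow> complex) \<Rightarrow> int \<Rightarrow> complex \<Rightarrow> complex" where
  "mode_field u n = (\<lambda>z. - (u z powi (n + 1)) / deriv u z)"

end

theory Submission
  imports Defs
begin

text \<open>
  Why the relations hold. Put \<open>v = 1 / u\<close>, a coordinate whose pole is at \<open>O\<close>. The forms regular outside \<open>O\<close>
  are exactly \<open>P(v) dv\<close> with \<open>P\<close> a polynomial (\<open>K_space_eq\<close>), so \<open>e k = d(v\<^sup>k)\<close>, \<open>k \<ge> 1\<close>, is a basis and the
  symmetric algebra is a Fock space: multiplications by \<open>e k\<close> create, and contractions with the linear
  forms \<open>\<alpha> \<mapsto> Res\<^sub>O (u\<^sup>j \<alpha>)\<close> annihilate. These oscillators, indexed by the integers and written
  \<open>mode j\<close>, satisfy the Heisenberg relations \<open>[mode i, mode j] = - i \<delta>\<close> with \<open>\<delta> = 1\<close> if \<open>i + j = 0\<close>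
  (\<open>heisenberg_relation\<close>).

  The operators are first made explicit. All ingredients depend only on the germ of the vector field at
  \<open>O\<close>, where it is \<open>v\<^sup>1\<^sup>-\<^sup>n d/dv\<close>. The residue pairing becomes a finite sum of products of moments
  (\<open>residue_pairing\<close>), the projected Lie derivative is \<open>e k \<mapsto> k e (k - n)\<close> (\<open>second_kind_proj_form\<close>), and the
  created bidifferential is \<open>- 1/2 \<Sum> e a \<otimes> e b\<close> over \<open>a + b = - n\<close> (\<open>X_plus_vacuum_eq\<close>). Since the operators
  are prescribed only on products of forms, explicit linear maps with the same values on products are
  given (\<open>X_minus_eq\<close>, \<open>X_zero_eq\<close>); so the prescription is consistent. Together \<open>L n\<close> is the Sugawara
  operator of one free boson, half the negative of the normally ordered sum of \<open>mode i (mode (n - i))\<close>.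

  It is enough to know \<open>[L n, mode j] = - j mode (n + j)\<close> (\<open>L_mode\<close>). By the Jacobi identity the defect
  \<open>[L l, L m] - (l - m) L (l + m)\<close> then commutes with all oscillators. Hence it sends the vacuum to an
  element killed by all annihilators, that is to a multiple of the vacuum, and it acts on the whole algebra by
  this scalar (\<open>defect_eq\<close>). The scalar is the degree zero part of \<open>L l (L m 1) - L m (L l 1)\<close>, which for
  \<open>l = - m = N > 0\<close> equals \<open>1/2 \<Sum> a (N - a) = (N\<^sup>3 - N) / 12\<close> (\<open>L_L_vacuum_Nil\<close>).

  Finally, a coordinate is a Moebius transformation off isolated points (\<open>coordinate_eq_moebius\<close>), so its
  reciprocal near \<open>O\<close> has the normal form that the computations use.
\<close>

section \<open>The product of symmetric multidifferentials\<close>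

definition symmetrise :: "multidiff \<Rightarrow> multidiff" where
  "symmetrise F zs =
     (\<Sum>\<sigma> | \<sigma> permutes {..<length zs}. F (permute_list \<sigma> zs)) / fact (length zs)"

definition concat_prod :: "multidiff \<Rightarrow> multidiff \<Rightarrow> multidiff" where
  "concat_prod F G zs = (\<Sum>k\<le>length zs. F (take k zs) * G (drop k zs))"

definition symmetric :: "multidiff \<Rightarrow> bool" where
  "symmetric F \<longleftrightarrow> (\<forall>xs ys. mset xs = mset ys \<longrightarrow> F xs = F ys)"

lemma symmetricD: "symmetric F \<Longrightarrow> mset xs = mset ys \<Longrightarrow> F xs = F ys"
  unfolding symmetric_def by blast

lemma symmetricI:
  assumes "\<And>\<sigma> zs. \<sigma> permutes {..<length zs} \<Longrightarrow> F (permute_list \<sigma> zs) = F zs"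
  shows "symmetric F"
  unfolding symmetric_def by (metis assms mset_eq_permutation)

text \<open>
  The product of the algebra is the concatenation product, which is visibly associative, followed
  by symmetrisation. Commutativity and associativity of the product are derived from this splitting.
\<close>
lemma sym_mult_eq: "F \<otimes>\<^sub>s G = symmetrise (concat_prod F G)"
  by (auto simp: sym_mult_def symmetrise_def concat_prod_def fun_eq_iff)

lemma symmetric_symmetrise: "symmetric (symmetrise F)"
proof (rule symmetricI)
  fix \<tau> and zs :: "complex list"
  assume \<tau>: "\<tau> permutes {..<length zs}"
  have "(\<Sum>\<sigma> | \<sigma> permutes {..<length zs}. F (permute_list \<sigma> (permute_list \<tau> zs)))
      = (\<Sum>\<sigma> | \<sigma> permutes {..<length zs}. F (permute_list (\<tau> \<circ> \<sigma>) zs))"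
    by (intro sum.cong refl) (simp add: permute_list_compose)
  also have "\<dots> = (\<Sum>\<sigma> | \<sigma> permutes {..<length zs}. F (permute_list \<sigma> zs))"
    using setum_permutations_compose_left[OF \<tau>, of "\<lambda>\<sigma>. F (permute_list \<sigma> zs)"]
    by simp
  finally show "symmetrise F (permute_list \<tau> zs) = symmetrise F zs"
    by (simp add: symmetrise_def)
qed

lemma symmetric_sym_mult: "symmetric (F \<otimes>\<^sub>s G)"
  by (simp add: sym_mult_eq symmetric_symmetrise)

lemma symmetrise_symmetric:
  assumes "symmetric F"
  shows "symmetrise F = F"
proof
  fix zs
  have "(\<Sum>\<sigma> | \<sigma> permutes {..<length zs}. F (permute_list \<sigma> zs))
      = (\<Sum>\<sigma> | \<sigma> permutes {..<length zs}. F zs)"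
    by (intro sum.cong refl symmetricD[OF assms]) simp
  then show "symmetrise F zs = F zs"
    by (simp add: symmetrise_def card_permutations[OF refl])
qed

text \<open>
  A fixed rearrangement of the points is absorbed by the average over all permutations.
\<close>
lemma sum_permutations_rearrange:
  assumes "\<tau> permutes {..<length zs}"
    and "\<And>xs. length xs = length zs \<Longrightarrow> G xs = F (permute_list \<tau> xs)"
  shows "(\<Sum>\<sigma> | \<sigma> permutes {..<length zs}. G (permute_list \<sigma> zs) :: complex)
       = (\<Sum>\<sigma> | \<sigma> permutes {..<length zs}. F (permute_list \<sigma> zs))"
proof -
  have "(\<Sum>\<sigma> | \<sigma> permutes {..<length zs}. G (permute_list \<sigma> zs))
      = (\<Sum>\<sigma> | \<sigma> permutes {..<length zs}. F (permute_list (\<sigma> \<circ> \<tau>) zs))"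
    using assms by (intro sum.cong refl) (simp add: permute_list_compose)
  also have "\<dots> = (\<Sum>\<sigma> | \<sigma> permutes {..<length zs}. F (permute_list \<sigma> zs))"
    using sum_permutations_compose_right[OF assms(1), of "\<lambda>\<sigma>. F (permute_list \<sigma> zs)"] by simp
  finally show ?thesis .
qed

text \<open>
  Turns a rearrangement described on lists (such as a rotation) into a permutation of positions. It
  has to be one permutation for all lists of length \<open>n\<close>, and is read off from the list of indices.
\<close>
lemma natural_rearrangement:
  assumes "mset (f [0..<n]) = mset [0..<n]"
    and "\<And>xs :: complex list. length xs = n \<Longrightarrow> g xs = map ((!) xs) (f [0..<n])"
  shows "\<exists>\<tau>. \<tau> permutes {..<n} \<and> (\<forall>xs. length xs = n \<longrightarrow> g xs = permute_list \<tau> xs)"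
proof -
  obtain \<tau> where \<tau>: "\<tau> permutes {..<length [0..<n]}" "permute_list \<tau> [0..<n] = f [0..<n]"
    using mset_eq_permutation[OF assms(1)] by blast
  have "g xs = permute_list \<tau> xs" if "length xs = n" for xs :: "complex list"
  proof -
    have "permute_list \<tau> xs = permute_list \<tau> (map ((!) xs) [0..<n])"
      using that by (metis map_nth)
    also have "\<dots> = map ((!) xs) (permute_list \<tau> [0..<n])"
      using \<tau>(1) by (simp add: permute_list_map)
    finally show ?thesis using assms(2)[OF that] \<tau>(2) by simp
  qed
  with \<tau>(1) show ?thesis by auto
qed

text \<open>
  Splitting a list after \<open>k\<close> points and splitting its rotation by \<open>k\<close> give the same two parts in
  exchanged order, and the average does not see the rotation.
\<close>
lemma sym_mult_commute: "F \<otimes>\<^sub>s G = G \<otimes>\<^sub>s F"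
proof
  fix zs :: "complex list"
  let ?n = "length zs"
  let ?P = "{\<sigma>. \<sigma> permutes {..<?n}}"
  have rot: "(\<Sum>\<sigma>\<in>?P. F (take k (permute_list \<sigma> zs)) * G (drop k (permute_list \<sigma> zs)))
      = (\<Sum>\<sigma>\<in>?P. F (drop (?n - k) (permute_list \<sigma> zs)) * G (take (?n - k) (permute_list \<sigma> zs)))"
    if "k \<le> ?n" for k
  proof -
    have "\<exists>\<tau>. \<tau> permutes {..<?n} \<and>
        (\<forall>xs :: complex list. length xs = ?n \<longrightarrow> drop k xs @ take k xs = permute_list \<tau> xs)"
    proof (rule natural_rearrangement[of "\<lambda>xs. drop k xs @ take k xs" ?n "\<lambda>xs. drop k xs @ take k xs"])
      show "mset (drop k [0..<?n] @ take k [0..<?n]) = mset [0..<?n]"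
        by (metis append_take_drop_id mset_append union_commute)
      show "drop k xs @ take k xs = map ((!) xs) (drop k [0..<?n] @ take k [0..<?n])"
        if "length xs = ?n" for xs :: "complex list"
        by (simp only: map_append flip: drop_map take_map) (metis map_nth that)
    qed
    then obtain \<tau> where \<tau>: "\<tau> permutes {..<?n}"
      "\<And>xs :: complex list. length xs = ?n \<Longrightarrow> drop k xs @ take k xs = permute_list \<tau> xs"
      by blast
    show ?thesis
    proof (rule sum_permutations_rearrange[OF \<tau>(1)])
      fix xs :: "complex list" assume xs: "length xs = ?n"
      show "F (take k xs) * G (drop k xs) = F (drop (?n - k) (permute_list \<tau> xs)) * G (take (?n - k) (permute_list \<tau> xs))"
        using xs by (simp flip: \<tau>(2)[OF xs])
    qed
  qed
  have "(\<Sum>\<sigma>\<in>?P. concat_prod F G (permute_list \<sigma> zs))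
      = (\<Sum>k\<le>?n. \<Sum>\<sigma>\<in>?P. F (take k (permute_list \<sigma> zs)) * G (drop k (permute_list \<sigma> zs)))"
    unfolding concat_prod_def length_permute_list by (rule sum.swap)
  also have "\<dots> = (\<Sum>k\<le>?n. \<Sum>\<sigma>\<in>?P. F (drop (?n - k) (permute_list \<sigma> zs)) * G (take (?n - k) (permute_list \<sigma> zs)))"
    by (intro sum.cong refl rot) auto
  also have "\<dots> = (\<Sum>k\<le>?n. \<Sum>\<sigma>\<in>?P. F (drop k (permute_list \<sigma> zs)) * G (take k (permute_list \<sigma> zs)))"
    by (rule sum.reindex_bij_witness[of _ "\<lambda>k. ?n - k" "\<lambda>k. ?n - k"]) auto
  also have "\<dots> = (\<Sum>\<sigma>\<in>?P. \<Sum>k\<le>?n. F (drop k (permute_list \<sigma> zs)) * G (take k (permute_list \<sigma> zs)))"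
    by (rule sum.swap)
  also have "\<dots> = (\<Sum>\<sigma>\<in>?P. concat_prod G F (permute_list \<sigma> zs))"
    by (simp add: concat_prod_def mult.commute)
  finally show "(F \<otimes>\<^sub>s G) zs = (G \<otimes>\<^sub>s F) zs"
    by (simp add: sym_mult_eq symmetrise_def)
qed

lemma concat_prod_Nil: "concat_prod F G [] = F [] * G []"
  by (simp add: concat_prod_def)

lemma concat_prod_Cons:
  "concat_prod F G (z # zs) = F [] * G (z # zs) + concat_prod (\<lambda>ws. F (z # ws)) G zs"
  unfolding concat_prod_def by (simp add: sum.atMost_Suc_shift del: sum.atMost_Suc)

lemma concat_prod_scale_left: "concat_prod (\<lambda>ws. c * F ws) G zs = c * concat_prod F G zs"
  by (simp add: concat_prod_def sum_distrib_left mult.assoc)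

lemma concat_prod_add_left: "concat_prod (\<lambda>ws. F ws + G ws) H zs = concat_prod F H zs + concat_prod G H zs"
  by (simp add: concat_prod_def sum.distrib algebra_simps)

lemma concat_prod_assoc: "concat_prod (concat_prod F G) H zs = concat_prod F (concat_prod G H) zs"
proof (induction zs arbitrary: F)
  case (Cons z zs)
  show ?case
    by (simp add: concat_prod_Cons concat_prod_Nil concat_prod_add_left concat_prod_scale_left
        Cons.IH algebra_simps)
qed (simp add: concat_prod_Nil)

text \<open>
  A permutation of the first \<open>k\<close> points extends to all points, so averaging over it beforehand does
  not change the full average.
\<close>
lemma symmetrise_concat_symmetrise:
  "symmetrise (concat_prod (symmetrise F) G) = symmetrise (concat_prod F G)"
proof
  fix zs :: "complex list"
  let ?n = "length zs"
  let ?P = "\<lambda>k. {\<sigma>. \<sigma> permutes {..<k::nat}}"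
  have inner: "(\<Sum>\<sigma>\<in>?P ?n. symmetrise F (take k (permute_list \<sigma> zs)) * G (drop k (permute_list \<sigma> zs)))
      = (\<Sum>\<sigma>\<in>?P ?n. F (take k (permute_list \<sigma> zs)) * G (drop k (permute_list \<sigma> zs)))"
    (is "?lhs = ?rhs") if k: "k \<le> ?n" for k
  proof -
    have eq: "(\<Sum>\<sigma>\<in>?P ?n. F (permute_list \<tau> (take k (permute_list \<sigma> zs))) * G (drop k (permute_list \<sigma> zs)))
        = ?rhs" if \<tau>: "\<tau> permutes {..<k}" for \<tau>
    proof (rule sum_permutations_rearrange)
      show \<tau>': "\<tau> permutes {..<?n}"
        using \<tau> by (rule permutes_subset) (use k in auto)
      fix xs :: "complex list" assume xs: "length xs = ?n"
      have fixed: "\<tau> i = i" if "\<not> i < k" for i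
        using \<tau> that by (auto simp: permutes_def)
      have below: "\<tau> i < k" if "i < k" for i
        using permutes_in_image[OF \<tau>, of i] that by simp
      have "permute_list \<tau> xs = permute_list \<tau> (take k xs) @ drop k xs"
        using xs k by (intro nth_equalityI) (auto simp: permute_list_def nth_append fixed below)
      with xs k show "F (permute_list \<tau> (take k xs)) * G (drop k xs) =
          F (take k (permute_list \<tau> xs)) * G (drop k (permute_list \<tau> xs))"
        by simp
    qed
    have "?lhs = (\<Sum>\<tau>\<in>?P k. \<Sum>\<sigma>\<in>?P ?n.
        F (permute_list \<tau> (take k (permute_list \<sigma> zs))) * G (drop k (permute_list \<sigma> zs)) / fact k)"
      using k by (subst sum.swap)
        (simp add: symmetrise_def min_absorb2 sum_distrib_right sum_divide_distrib)
    also have "\<dots> = (\<Sum>\<tau>\<in>?P k. ?rhs / fact k)"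
      by (intro sum.cong refl) (simp add: eq flip: sum_divide_distrib)
    also have "\<dots> = ?rhs"
      by (simp add: card_permutations[OF refl])
    finally show ?thesis .
  qed
  have expand: "(\<Sum>\<sigma>\<in>?P ?n. concat_prod A G (permute_list \<sigma> zs))
      = (\<Sum>k\<le>?n. \<Sum>\<sigma>\<in>?P ?n. A (take k (permute_list \<sigma> zs)) * G (drop k (permute_list \<sigma> zs)))" for A
    unfolding concat_prod_def length_permute_list by (rule sum.swap)
  show "symmetrise (concat_prod (symmetrise F) G) zs = symmetrise (concat_prod F G) zs"
    unfolding symmetrise_def[of "concat_prod _ _"] expand using inner by simp
qed

lemma sym_mult_assoc: "(F \<otimes>\<^sub>s G) \<otimes>\<^sub>s H = F \<otimes>\<^sub>s (G \<otimes>\<^sub>s H)"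
proof -
  have left: "(A \<otimes>\<^sub>s B) \<otimes>\<^sub>s C = concat_prod A B \<otimes>\<^sub>s C" for A B C
    by (simp only: sym_mult_eq symmetrise_concat_symmetrise)
  have "(F \<otimes>\<^sub>s G) \<otimes>\<^sub>s H = symmetrise (concat_prod (concat_prod F G) H)"
    by (subst left) (rule sym_mult_eq)
  also have "concat_prod (concat_prod F G) H = concat_prod F (concat_prod G H)"
    by (rule ext) (rule concat_prod_assoc)
  also have "symmetrise \<dots> = concat_prod G H \<otimes>\<^sub>s F"
    by (simp only: sym_mult_commute[of "concat_prod G H"] sym_mult_eq[of F])
  also have "\<dots> = F \<otimes>\<^sub>s (G \<otimes>\<^sub>s H)"
    by (simp only: left[symmetric] sym_mult_commute[of F])
  finally show ?thesis .
qed

lemma sym_mult_left_commute: "F \<otimes>\<^sub>s (G \<otimes>\<^sub>s H) = G \<otimes>\<^sub>s (F \<otimes>\<^sub>s H)"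
  by (metis sym_mult_assoc sym_mult_commute)

lemma sym_mult_add_left: "(F + G) \<otimes>\<^sub>s H = F \<otimes>\<^sub>s H + G \<otimes>\<^sub>s H"
  by (auto simp: sym_mult_def fun_eq_iff algebra_simps sum.distrib add_divide_distrib)

lemma sym_mult_cscale_left: "cscale c F \<otimes>\<^sub>s G = cscale c (F \<otimes>\<^sub>s G)"
  by (auto simp: sym_mult_def cscale_def fun_eq_iff sum_distrib_left mult.assoc)

lemma sym_mult_add_right: "H \<otimes>\<^sub>s (F + G) = H \<otimes>\<^sub>s F + H \<otimes>\<^sub>s G"
  by (metis sym_mult_commute sym_mult_add_left)

lemma sym_mult_cscale_right: "G \<otimes>\<^sub>s cscale c F = cscale c (G \<otimes>\<^sub>s F)"
  by (metis sym_mult_commute sym_mult_cscale_left)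

lemma sym_mult_zero_right [simp]: "H \<otimes>\<^sub>s 0 = 0"
  by (auto simp: sym_mult_def fun_eq_iff)

lemma sym_mult_zero_left [simp]: "0 \<otimes>\<^sub>s H = 0"
  by (auto simp: sym_mult_def fun_eq_iff)

lemma vacuum_sym_mult:
  assumes "symmetric F"
  shows "vacuum \<otimes>\<^sub>s F = F"
proof -
  have "concat_prod vacuum F zs = F zs" for zs
    by (cases zs) (simp_all add: concat_prod_def vacuum_def sum.atMost_Suc_shift del: sum.atMost_Suc)
  then have "concat_prod vacuum F = F" by (rule ext)
  with assms show ?thesis by (simp add: sym_mult_eq symmetrise_symmetric)
qed

definition remove_nth :: "nat \<Rightarrow> 'a list \<Rightarrow> 'a list" where
  "remove_nth i xs = take i xs @ drop (Suc i) xs"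

lemma remove_nth_0 [simp]: "remove_nth 0 (x # xs) = xs"
  and remove_nth_Suc [simp]: "remove_nth (Suc i) (x # xs) = x # remove_nth i xs"
  by (simp_all add: remove_nth_def)

lemma length_remove_nth: "i < length xs \<Longrightarrow> length (remove_nth i xs) = length xs - 1"
  by (simp add: remove_nth_def)

lemma mset_remove_nth: "i < length xs \<Longrightarrow> mset (remove_nth i xs) = mset xs - {#xs ! i#}"
proof -
  assume i: "i < length xs"
  have "mset xs = mset (take i xs @ xs ! i # drop (Suc i) xs)"
    by (simp only: id_take_nth_drop[OF i, symmetric])
  then show ?thesis by (simp add: remove_nth_def)
qed

text \<open>
  The working description of multiplication by a 1-form: average over the point at which the 1-form
  is evaluated. It holds because all positions contribute equally to the average over permutations.
\<close>
lemma degree_one_sym_mult: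
  assumes G: "symmetric G"
  shows "(degree_one \<alpha> \<otimes>\<^sub>s G) zs
       = (\<Sum>i<length zs. \<alpha> (zs ! i) * G (remove_nth i zs)) / of_nat (length zs)"
proof -
  let ?n = "length zs"
  let ?P = "{\<sigma>. \<sigma> permutes {..<?n}}"
  let ?H = "\<lambda>xs. \<Sum>i<length xs. \<alpha> (xs ! i) * G (remove_nth i xs)"
  have conc: "concat_prod (degree_one \<alpha>) G xs = (if xs = [] then 0 else \<alpha> (xs ! 0) * G (remove_nth 0 xs))" for xs
  proof (cases xs)
    case (Cons y ys)
    have "concat_prod (\<lambda>ws. degree_one \<alpha> (y # ws)) G ys = \<alpha> y * G ys"
      by (cases ys) (simp_all add: concat_prod_def degree_one_def sum.atMost_Suc_shift del: sum.atMost_Suc)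
    with Cons show ?thesis by (simp add: concat_prod_Cons degree_one_def)
  qed (simp add: concat_prod_def degree_one_def)
  show ?thesis
  proof (cases "?n = 0")
    case True
    then show ?thesis by (simp add: sym_mult_eq symmetrise_def conc)
  next
    case False
    have nonempty: "permute_list \<sigma> zs \<noteq> []" for \<sigma>
      using False by (metis length_permute_list list.size(3))
    have move: "(\<Sum>\<sigma>\<in>?P. \<alpha> (permute_list \<sigma> zs ! i) * G (remove_nth i (permute_list \<sigma> zs)))
        = (\<Sum>\<sigma>\<in>?P. \<alpha> (permute_list \<sigma> zs ! 0) * G (remove_nth 0 (permute_list \<sigma> zs)))"
      if i: "i < ?n" for i
    proof -
      have "\<exists>\<tau>. \<tau> permutes {..<?n} \<and>
          (\<forall>xs :: complex list. length xs = ?n \<longrightarrow> xs ! i # remove_nth i xs = permute_list \<tau> xs)"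
      proof (rule natural_rearrangement[of "\<lambda>xs. xs ! i # remove_nth i xs" ?n "\<lambda>xs. xs ! i # remove_nth i xs"])
        show "mset ([0..<?n] ! i # remove_nth i [0..<?n]) = mset [0..<?n]"
          using i by (simp add: mset_remove_nth insert_DiffM)
        show "xs ! i # remove_nth i xs = map ((!) xs) ([0..<?n] ! i # remove_nth i [0..<?n])"
          if "length xs = ?n" for xs :: "complex list"
        proof -
          have "map ((!) xs) [0..<?n] = xs" using that by (metis map_nth)
          with i that show ?thesis
            by (simp add: remove_nth_def del: take_upt drop_upt flip: drop_map take_map)
        qed
      qed
      then obtain \<tau> where \<tau>: "\<tau> permutes {..<?n}"
        "\<And>xs :: complex list. length xs = ?n \<Longrightarrow> xs ! i # remove_nth i xs = permute_list \<tau> xs"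
        by blast
      show ?thesis
      proof (rule sum_permutations_rearrange[OF \<tau>(1)])
        fix xs :: "complex list" assume xs: "length xs = ?n"
        show "\<alpha> (xs ! i) * G (remove_nth i xs) = \<alpha> (permute_list \<tau> xs ! 0) * G (remove_nth 0 (permute_list \<tau> xs))"
          by (simp flip: \<tau>(2)[OF xs])
      qed
    qed
    \<comment> \<open>The sum over all positions is symmetric, so it equals its own average over permutations.\<close>
    have "symmetric ?H"
    proof (rule symmetricI)
      fix \<sigma> and xs :: "complex list" assume \<sigma>: "\<sigma> permutes {..<length xs}"
      have "?H (permute_list \<sigma> xs) = (\<Sum>i<length xs. \<alpha> (xs ! \<sigma> i) * G (remove_nth (\<sigma> i) xs))"
      proof (intro sum.cong)
        fix i assume "i \<in> {..<length xs}"
        then have "i < length xs" "\<sigma> i < length xs" using permutes_in_image[OF \<sigma>] by auto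
        then show "\<alpha> (permute_list \<sigma> xs ! i) * G (remove_nth i (permute_list \<sigma> xs)) =
            \<alpha> (xs ! \<sigma> i) * G (remove_nth (\<sigma> i) xs)"
          using \<sigma> by (simp add: permute_list_nth)
            (metis symmetricD[OF G] length_permute_list mset_permute_list mset_remove_nth permute_list_nth)
      qed simp
      also have "\<dots> = ?H xs"
        using sum.permute[OF \<sigma>, of "\<lambda>i. \<alpha> (xs ! i) * G (remove_nth i xs)"] by (simp add: o_def)
      finally show "?H (permute_list \<sigma> xs) = ?H xs" .
    qed
    then have "?H zs = symmetrise ?H zs" by (simp add: symmetrise_symmetric)
    also have "\<dots> = (\<Sum>i<?n. \<Sum>\<sigma>\<in>?P. \<alpha> (permute_list \<sigma> zs ! i) * G (remove_nth i (permute_list \<sigma> zs))) / fact ?n"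
      unfolding symmetrise_def length_permute_list by (subst sum.swap) simp
    also have "\<dots> = (\<Sum>i<?n. \<Sum>\<sigma>\<in>?P. concat_prod (degree_one \<alpha>) G (permute_list \<sigma> zs)) / fact ?n"
    proof (rule arg_cong2[of _ _ _ _ "(/)"], rule sum.cong)
      fix i assume "i \<in> {..<?n}"
      then show "(\<Sum>\<sigma>\<in>?P. \<alpha> (permute_list \<sigma> zs ! i) * G (remove_nth i (permute_list \<sigma> zs)))
          = (\<Sum>\<sigma>\<in>?P. concat_prod (degree_one \<alpha>) G (permute_list \<sigma> zs))"
        by (subst move) (auto simp: conc nonempty)
    qed simp_all
    also have "\<dots> = of_nat ?n * symmetrise (concat_prod (degree_one \<alpha>) G) zs"
      by (simp add: symmetrise_def)
    finally show ?thesis using False by (simp add: sym_mult_eq field_simps)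
  qed
qed

section \<open>Contractions on the symmetric algebra\<close>

text \<open>
  Elements of the algebra are functions, and the induction method presents them eta-expanded. The
  pointwise rules would then push a sum of two elements under a binder, out of reach of additivity.
\<close>
declare plus_fun_apply [simp del] zero_fun_apply [simp del]

lemma cscale_simps [simp]:
  "cscale c 0 = 0" "cscale 0 F = 0" "cscale 1 F = F" "cscale a (cscale b F) = cscale (a * b) F"
  by (auto simp: cscale_def fun_eq_iff plus_fun_apply zero_fun_apply)

lemma cscale_add_right: "cscale c (F + G) = cscale c F + cscale c G"
  and cscale_add_left: "cscale (a + b) F = cscale a F + cscale b F"
  by (auto simp: cscale_def fun_eq_iff plus_fun_apply zero_fun_apply algebra_simps)

lemma sym_prod_Nil [simp]: "sym_prod [] = vacuum"
  and sym_prod_Cons [simp]: "sym_prod (\<alpha> # \<alpha>s) = degree_one \<alpha> \<otimes>\<^sub>s sym_prod \<alpha>s"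
  by (simp_all add: sym_prod_def)

lemma degree_one_add: "degree_one (\<lambda>z. \<alpha> z + \<beta> z) = degree_one \<alpha> + degree_one \<beta>"
  and degree_one_scale: "degree_one (\<lambda>z. c * \<alpha> z) = cscale c (degree_one \<alpha>)"
  and degree_one_zero: "degree_one (\<lambda>z. 0) = 0"
  by (auto simp: degree_one_def cscale_def fun_eq_iff plus_fun_apply zero_fun_apply)

lemma symmetric_vacuum: "symmetric vacuum"
  by (auto simp: symmetric_def vacuum_def)

lemma symmetric_sym_prod: "symmetric (sym_prod \<alpha>s)"
  by (cases \<alpha>s) (simp_all add: symmetric_vacuum symmetric_sym_mult)

lemma symmetric_add: "symmetric F \<Longrightarrow> symmetric G \<Longrightarrow> symmetric (F + G)"
  unfolding symmetric_def plus_fun_def by metis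

lemma symmetric_cscale: "symmetric F \<Longrightarrow> symmetric (cscale c F)"
  unfolding symmetric_def cscale_def by metis

locale function_space =
  fixes V :: "(complex \<Rightarrow> complex) set"
  assumes zero_mem: "(\<lambda>_. 0) \<in> V"
    and add_mem: "\<alpha> \<in> V \<Longrightarrow> \<beta> \<in> V \<Longrightarrow> (\<lambda>z. \<alpha> z + \<beta> z) \<in> V"
    and scale_mem: "\<alpha> \<in> V \<Longrightarrow> (\<lambda>z. c * \<alpha> z) \<in> V"
begin

definition functional :: "((complex \<Rightarrow> complex) \<Rightarrow> complex) \<Rightarrow> bool" where
  "functional \<nu> \<longleftrightarrow> (\<forall>\<alpha>\<in>V. \<forall>\<beta>\<in>V. \<nu> (\<lambda>z. \<alpha> z + \<beta> z) = \<nu> \<alpha> + \<nu> \<beta>) \<and>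
     (\<forall>c. \<forall>\<alpha>\<in>V. \<nu> (\<lambda>z. c * \<alpha> z) = c * \<nu> \<alpha>)"

lemma functional_add: "functional \<nu> \<Longrightarrow> \<alpha> \<in> V \<Longrightarrow> \<beta> \<in> V \<Longrightarrow> \<nu> (\<lambda>z. \<alpha> z + \<beta> z) = \<nu> \<alpha> + \<nu> \<beta>"
  and functional_scale: "functional \<nu> \<Longrightarrow> \<alpha> \<in> V \<Longrightarrow> \<nu> (\<lambda>z. c * \<alpha> z) = c * \<nu> \<alpha>"
  by (auto simp: functional_def)

lemma functional_zero: "functional \<nu> \<Longrightarrow> \<nu> (\<lambda>_. 0) = 0"
  using functional_scale[of \<nu> "\<lambda>_. 0" 0] zero_mem by simp

lemma sum_mem: "(\<And>i. i \<in> I \<Longrightarrow> \<alpha> i \<in> V) \<Longrightarrow> (\<lambda>z. \<Sum>i\<in>I. c i * \<alpha> i z) \<in> V"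
  by (induction I rule: infinite_finite_induct) (simp_all add: zero_mem add_mem scale_mem)

lemma functional_sum:
  assumes "functional \<nu>" "\<And>i. i \<in> I \<Longrightarrow> \<alpha> i \<in> V"
  shows "\<nu> (\<lambda>z. \<Sum>i\<in>I. c i * \<alpha> i z) = (\<Sum>i\<in>I. c i * \<nu> (\<alpha> i))"
  using assms(2)
proof (induction I rule: infinite_finite_induct)
  case (insert i I)
  then show ?case
    by (simp add: functional_add[OF assms(1)] functional_scale[OF assms(1)] scale_mem sum_mem)
qed (simp_all add: functional_zero assms)

lemma sym_prod_mem: "\<alpha>s \<in> lists V \<Longrightarrow> sym_prod \<alpha>s \<in> sym_alg V"
  unfolding sym_alg_def by (auto intro: multidiff.span_base)

lemma vacuum_mem: "vacuum \<in> sym_alg V"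
  using sym_prod_mem[of "[]"] by simp

lemma sym_alg_add: "F \<in> sym_alg V \<Longrightarrow> G \<in> sym_alg V \<Longrightarrow> F + G \<in> sym_alg V"
  and sym_alg_cscale: "F \<in> sym_alg V \<Longrightarrow> cscale c F \<in> sym_alg V"
  and sym_alg_zero: "0 \<in> sym_alg V"
  unfolding sym_alg_def
  by (auto intro: multidiff.span_add multidiff.span_scale multidiff.span_zero)

lemma sym_alg_sum: "(\<And>i. i \<in> I \<Longrightarrow> F i \<in> sym_alg V) \<Longrightarrow> (\<Sum>i\<in>I. F i) \<in> sym_alg V"
  by (induction I rule: infinite_finite_induct) (simp_all add: sym_alg_add sym_alg_zero)

lemma sym_alg_induct_prod [consumes 1, case_names sym_prod add cscale]:
  assumes "F \<in> sym_alg V"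
    and "\<And>\<alpha>s. \<alpha>s \<in> lists V \<Longrightarrow> P (sym_prod \<alpha>s)"
    and "\<And>F G. F \<in> sym_alg V \<Longrightarrow> G \<in> sym_alg V \<Longrightarrow> P F \<Longrightarrow> P G \<Longrightarrow> P (F + G)"
    and "\<And>c F. F \<in> sym_alg V \<Longrightarrow> P F \<Longrightarrow> P (cscale c F)"
  shows "P F"
proof -
  have "F \<in> sym_alg V \<and> P F"
    using assms(1) unfolding sym_alg_def
  proof (induction rule: multidiff.span_induct_alt)
    case base
    have "P (cscale 0 vacuum)" using assms(2)[of "[]"] assms(4)[of vacuum 0] vacuum_mem by simp
    then show ?case using multidiff.span_zero by simp
  next
    case (step c x y)
    then obtain \<alpha>s where "\<alpha>s \<in> lists V" "x = sym_prod \<alpha>s" by blast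
    with step assms(2-4) show ?case
      by (metis sym_alg_add sym_alg_cscale sym_alg_def sym_prod_mem)
  qed
  then show ?thesis ..
qed

lemma degree_one_mem:
  assumes "\<alpha> \<in> V" "F \<in> sym_alg V"
  shows "degree_one \<alpha> \<otimes>\<^sub>s F \<in> sym_alg V"
  using assms(2)
proof (induction F rule: sym_alg_induct_prod)
  case (sym_prod \<alpha>s)
  then show ?case using sym_prod_mem[of "\<alpha> # \<alpha>s"] assms(1) by simp
qed (simp_all add: sym_mult_add_right sym_mult_cscale_right sym_alg_add sym_alg_cscale)

text \<open>
  The algebra is generated from the vacuum by multiplications with 1-forms; most identities between
  operators below are proved by commuting both sides past such a multiplication.
\<close>
lemma sym_alg_induct [consumes 1, case_names vacuum mult add cscale]:
  assumes "F \<in> sym_alg V"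
    and "P vacuum"
    and "\<And>\<alpha> F. \<alpha> \<in> V \<Longrightarrow> F \<in> sym_alg V \<Longrightarrow> P F \<Longrightarrow> P (degree_one \<alpha> \<otimes>\<^sub>s F)"
    and "\<And>F G. F \<in> sym_alg V \<Longrightarrow> G \<in> sym_alg V \<Longrightarrow> P F \<Longrightarrow> P G \<Longrightarrow> P (F + G)"
    and "\<And>c F. F \<in> sym_alg V \<Longrightarrow> P F \<Longrightarrow> P (cscale c F)"
  shows "P F"
  using assms(1)
proof (induction rule: sym_alg_induct_prod)
  case (sym_prod \<alpha>s)
  then show ?case
    by (induction \<alpha>s) (auto intro: assms(2,3) sym_prod_mem)
qed (use assms(4,5) in auto)

lemma symmetric_sym_alg: "F \<in> sym_alg V \<Longrightarrow> symmetric F"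
  by (induction rule: sym_alg_induct_prod) (auto intro: symmetric_sym_prod symmetric_add symmetric_cscale)

lemma vacuum_sym_mult_mem: "F \<in> sym_alg V \<Longrightarrow> vacuum \<otimes>\<^sub>s F = F"
  by (intro vacuum_sym_mult symmetric_sym_alg)

lemma sym_mult_sym_prod: "F \<in> sym_alg V \<Longrightarrow> sym_prod [\<alpha>, \<beta>] \<otimes>\<^sub>s F = degree_one \<alpha> \<otimes>\<^sub>s (degree_one \<beta> \<otimes>\<^sub>s F)"
  by (simp add: sym_mult_assoc vacuum_sym_mult_mem)

lemma degree_one_sym_mult_Cons:
  assumes "F \<in> sym_alg V"
  shows "(degree_one \<alpha> \<otimes>\<^sub>s F) (w # zs) = (\<alpha> w * F zs +
     (\<Sum>i<length zs. \<alpha> (zs ! i) * F (w # remove_nth i zs))) / of_nat (Suc (length zs))"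
  using degree_one_sym_mult[OF symmetric_sym_alg[OF assms], of \<alpha> "w # zs"]
  by (simp add: sum.lessThan_Suc_shift del: sum.lessThan_Suc)

text \<open>
  All but one of the points can be frozen. Hence an operation on 1-forms can be applied to a single
  variable of a multidifferential, which yields linear maps without any choice of a basis.
\<close>
lemma slice_mem: "F \<in> sym_alg V \<Longrightarrow> (\<lambda>w. F (w # zs)) \<in> V"
proof (induction arbitrary: zs rule: sym_alg_induct)
  case vacuum
  then show ?case by (simp add: vacuum_def zero_mem)
next
  case (mult \<alpha> F)
  let ?c = "1 / of_nat (Suc (length zs)) :: complex"
  have "(\<lambda>w. ?c * (F zs * \<alpha> w + (\<Sum>i<length zs. \<alpha> (zs ! i) * F (w # remove_nth i zs)))) \<in> V"
    by (intro scale_mem add_mem sum_mem mult)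
  moreover have "(\<lambda>w. (degree_one \<alpha> \<otimes>\<^sub>s F) (w # zs)) =
      (\<lambda>w. ?c * (F zs * \<alpha> w + (\<Sum>i<length zs. \<alpha> (zs ! i) * F (w # remove_nth i zs))))"
    by (simp add: degree_one_sym_mult_Cons[OF mult(2)] mult.commute)
  ultimately show ?case by simp
qed (simp_all add: add_mem scale_mem cscale_def plus_fun_apply)

text \<open>
  The derivation of the symmetric algebra that extends the linear form \<open>\<nu>\<close>. The factor is the number
  of variables to which \<open>\<nu>\<close> could be applied; by symmetry it is applied to the first one.
\<close>
definition contract :: "((complex \<Rightarrow> complex) \<Rightarrow> complex) \<Rightarrow> multidiff \<Rightarrow> multidiff" where
  "contract \<nu> F zs = of_nat (Suc (length zs)) * \<nu> (\<lambda>w. F (w # zs))"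

context
  fixes \<nu>
  assumes \<nu>: "functional \<nu>"
begin

lemma contract_vacuum: "contract \<nu> vacuum = 0"
  by (simp add: contract_def vacuum_def functional_zero[OF \<nu>] fun_eq_iff zero_fun_apply)

lemma contract_add: "F \<in> sym_alg V \<Longrightarrow> G \<in> sym_alg V \<Longrightarrow> contract \<nu> (F + G) = contract \<nu> F + contract \<nu> G"
  by (simp add: contract_def functional_add[OF \<nu>] slice_mem fun_eq_iff plus_fun_apply algebra_simps)

lemma contract_cscale: "F \<in> sym_alg V \<Longrightarrow> contract \<nu> (cscale c F) = cscale c (contract \<nu> F)"
  by (simp add: contract_def cscale_def functional_scale[OF \<nu>] slice_mem fun_eq_iff)

lemma contract_zero: "contract \<nu> 0 = 0"
  by (simp add: contract_def functional_zero[OF \<nu>] fun_eq_iff zero_fun_apply)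

text \<open>
  The Leibniz rule: in the product, the contracted variable is the argument of \<open>\<alpha>\<close> or one of \<open>F\<close>.
\<close>
lemma contract_degree_one:
  assumes "\<alpha> \<in> V" "F \<in> sym_alg V"
  shows "contract \<nu> (degree_one \<alpha> \<otimes>\<^sub>s F) = cscale (\<nu> \<alpha>) F + degree_one \<alpha> \<otimes>\<^sub>s contract \<nu> F"
proof
  fix zs :: "complex list"
  let ?n = "length zs"
  let ?r = "\<lambda>i. remove_nth i zs"
  have sym: "symmetric (contract \<nu> F)"
    unfolding symmetric_def contract_def
  proof (intro allI impI)
    fix xs ys :: "complex list" assume eq: "mset xs = mset ys"
    then have "F (w # xs) = F (w # ys)" for w
      by (intro symmetricD[OF symmetric_sym_alg[OF assms(2)]]) simp
    with mset_eq_length[OF eq] show "of_nat (Suc (length xs)) * \<nu> (\<lambda>w. F (w # xs)) =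
        of_nat (Suc (length ys)) * \<nu> (\<lambda>w. F (w # ys))" by simp
  qed
  have "contract \<nu> (degree_one \<alpha> \<otimes>\<^sub>s F) zs
      = of_nat (Suc ?n) * \<nu> (\<lambda>w. (1 / of_nat (Suc ?n)) * (F zs * \<alpha> w + (\<Sum>i<?n. \<alpha> (zs ! i) * F (w # ?r i))))"
    by (simp add: contract_def degree_one_sym_mult_Cons[OF assms(2)] mult.commute)
  also have "\<dots> = \<nu> (\<lambda>w. F zs * \<alpha> w + (\<Sum>i<?n. \<alpha> (zs ! i) * F (w # ?r i)))"
    by (subst functional_scale[OF \<nu>]) (auto intro!: add_mem scale_mem sum_mem slice_mem assms simp del: of_nat_Suc)
  also have "\<dots> = F zs * \<nu> \<alpha> + (\<Sum>i<?n. \<alpha> (zs ! i) * \<nu> (\<lambda>w. F (w # ?r i)))"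
    by (subst functional_add[OF \<nu>])
      (auto simp: functional_scale[OF \<nu> assms(1)] functional_sum[OF \<nu> slice_mem[OF assms(2)]]
        intro!: scale_mem sum_mem slice_mem assms)
  also have "(\<Sum>i<?n. \<alpha> (zs ! i) * \<nu> (\<lambda>w. F (w # ?r i))) = (degree_one \<alpha> \<otimes>\<^sub>s contract \<nu> F) zs"
    by (auto simp: degree_one_sym_mult[OF sym] contract_def length_remove_nth sum_divide_distrib intro!: sum.cong)
  finally show "contract \<nu> (degree_one \<alpha> \<otimes>\<^sub>s F) zs = (cscale (\<nu> \<alpha>) F + degree_one \<alpha> \<otimes>\<^sub>s contract \<nu> F) zs"
    by (simp add: cscale_def plus_fun_apply)
qed

lemma contract_mem: "F \<in> sym_alg V \<Longrightarrow> contract \<nu> F \<in> sym_alg V"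
  by (induction rule: sym_alg_induct)
    (simp_all add: contract_vacuum contract_degree_one contract_add contract_cscale
      sym_alg_zero sym_alg_add sym_alg_cscale degree_one_mem)

end

lemma contract_commute:
  assumes "functional \<nu>" "functional \<mu>" "F \<in> sym_alg V"
  shows "contract \<nu> (contract \<mu> F) = contract \<mu> (contract \<nu> F)"
  using assms(3)
  by (induction rule: sym_alg_induct)
    (simp_all add: assms(1,2) contract_vacuum contract_zero contract_degree_one contract_add contract_cscale
      contract_mem degree_one_mem sym_alg_add sym_alg_cscale)

lemma linear_on_sym_algI:
  assumes "\<And>F G. F \<in> sym_alg V \<Longrightarrow> G \<in> sym_alg V \<Longrightarrow> T (F + G) = T F + T G"
    and "\<And>c F. F \<in> sym_alg V \<Longrightarrow> T (cscale c F) = cscale c (T F)"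
  shows "linear_on_sym_alg V T"
  using assms by (auto simp: linear_on_sym_alg_def)

lemma linear_on_sym_alg_eqI:
  assumes "linear_on_sym_alg V S" "linear_on_sym_alg V T" "F \<in> sym_alg V"
    and "\<And>\<alpha>s. \<alpha>s \<in> lists V \<Longrightarrow> S (sym_prod \<alpha>s) = T (sym_prod \<alpha>s)"
  shows "S F = T F"
  using assms(3) by (induction rule: sym_alg_induct_prod) (use assms in \<open>auto simp: linear_on_sym_alg_def\<close>)

text \<open>
  A linear map prescribed on products of 1-forms need not exist. Exhibiting one with the right values
  settles existence, and then it is the extension on the whole algebra.
\<close>
lemma linear_ext_eq:
  assumes "linear_on_sym_alg V T" "\<And>\<alpha>s. \<alpha>s \<in> lists V \<Longrightarrow> T (sym_prod \<alpha>s) = \<phi> \<alpha>s" "F \<in> sym_alg V"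
  shows "linear_ext V \<phi> F = T F"
proof -
  have "\<exists>T. linear_on_sym_alg V T \<and> (\<forall>\<alpha>s\<in>lists V. T (sym_prod \<alpha>s) = \<phi> \<alpha>s)"
    using assms by blast
  then have ext: "linear_on_sym_alg V (linear_ext V \<phi>) \<and> (\<forall>\<alpha>s\<in>lists V. linear_ext V \<phi> (sym_prod \<alpha>s) = \<phi> \<alpha>s)"
    unfolding linear_ext_def by (rule someI_ex)
  show ?thesis
    by (rule linear_on_sym_alg_eqI[OF conjunct1[OF ext] assms(1,3)]) (simp add: ext assms(2))
qed

end

section \<open>Sections near a point of the projective line\<close>

lemma meromorphic_at_0_factor:
  assumes "g meromorphic_on {0}"
  obtains n h where "h analytic_on {0}" "\<forall>\<^sub>F t in at 0. g t * t ^ n = (h t :: complex)"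
proof (cases "\<exists>\<^sub>F t in at 0. g t \<noteq> 0")
  case True
  have "isolated_singularity_at g 0" "not_essential g 0"
    using assms by (simp_all add: meromorphic_at_iff)
  from zorder_exist[OF this True] obtain r where r: "r > 0" "zor_poly g 0 holomorphic_on cball 0 r"
    "\<forall>w\<in>cball 0 r - {0}. g w = zor_poly g 0 w * w powi zorder g 0"
    by auto
  let ?m = "nat (- zorder g 0)" and ?k = "nat (zorder g 0)"
  show thesis
  proof (rule that)
    have "zor_poly g 0 analytic_on {0}"
      using r(1,2) by (auto simp: analytic_at_ball intro!: exI[of _ r] elim!: holomorphic_on_subset)
    then show "(\<lambda>t. zor_poly g 0 t * t ^ ?k) analytic_on {0}"
      by (intro analytic_intros)
    have "\<forall>\<^sub>F t in at 0. t \<in> cball 0 r - {0}"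
      using r(1) by (auto simp: eventually_at dist_commute intro!: exI[of _ r])
    then show "\<forall>\<^sub>F t in at 0. g t * t ^ ?m = zor_poly g 0 t * t ^ ?k"
    proof eventually_elim
      case (elim t)
      then have "t powi zorder g 0 * t ^ ?m = t ^ ?k"
        by (cases "zorder g 0 \<ge> 0") (auto simp: power_int_def field_simps)
      with r(3) elim show ?case by (simp add: mult.assoc)
    qed
  qed
next
  case False
  with that[of "\<lambda>_. 0" 0] show thesis
    by (auto simp: not_frequently)
qed

text \<open>
  Liouville, with the growth condition at infinity expressed in the chart \<open>1 / z\<close>. The
  classifications of forms, vector fields and coordinates on the projective line all reduce to it.
\<close>
lemma entire_is_poly:
  assumes f: "f holomorphic_on UNIV" and h: "h analytic_on {0}"
    and eq: "\<forall>\<^sub>F t in at 0. f (1 / t) * t ^ n = h t"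
  obtains P where "degree P \<le> n" "f = poly P"
proof -
  have "isCont h 0" using h by (rule analytic_at_imp_isCont)
  then have "\<forall>\<^sub>F t in at 0. dist (h t) (h 0) < 1"
    unfolding isCont_def by (rule tendstoD) simp
  with eq have "\<forall>\<^sub>F t in at 0. norm (f (1 / t) * t ^ n) < norm (h 0) + 1"
  proof eventually_elim
    case (elim t)
    then show ?case using norm_triangle_ineq2[of "h t" "h 0"] by (simp add: dist_norm)
  qed
  then obtain d where d: "d > 0" "\<And>t. t \<noteq> 0 \<Longrightarrow> norm t < d \<Longrightarrow> norm (f (1 / t) * t ^ n) < norm (h 0) + 1"
    by (auto simp: eventually_at)
  have "norm (f z) \<le> (norm (h 0) + 1) * norm z ^ n" if "2 / d \<le> norm z" for z
  proof -
    have "0 < 2 / d" using d(1) by simp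
    with that have z: "z \<noteq> 0" by auto
    have "norm (1 / z) < d" using that d(1) z by (simp add: norm_divide field_simps)
    with d(2)[of "1 / z"] z show ?thesis
      by (simp add: norm_mult norm_power norm_divide power_one_over field_simps)
  qed
  from Liouville_polynomial[OF f this]
  have eq: "f z = (\<Sum>k\<le>n. (deriv ^^ k) f 0 / fact k * z ^ k)" for z .
  show thesis
  proof (rule that)
    show "degree (\<Sum>k\<le>n. monom ((deriv ^^ k) f 0 / fact k) k) \<le> n"
      by (intro degree_sum_le) (auto intro: order_trans[OF degree_monom_le])
    show "f = poly (\<Sum>k\<le>n. monom ((deriv ^^ k) f 0 / fact k) k)"
      using eq by (simp add: fun_eq_iff poly_sum poly_monom)
  qed
qed

definition chart :: "proj_line \<Rightarrow> complex \<Rightarrow> complex" where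
  "chart q t = (case q of Affine a \<Rightarrow> a + t | Infinity \<Rightarrow> 1 / t)"

definition chart_jacobian :: "proj_line \<Rightarrow> complex \<Rightarrow> complex" where
  "chart_jacobian q t = (case q of Affine a \<Rightarrow> 1 | Infinity \<Rightarrow> - 1 / t ^ 2)"

lemma local_coeff_eq: "local_coeff k q f t = f (chart q t) * chart_jacobian q t powi k"
  by (cases q) (simp_all add: chart_def chart_jacobian_def)

lemma chart_jacobian_nonzero: "t \<noteq> 0 \<Longrightarrow> chart_jacobian q t \<noteq> 0"
  by (simp add: chart_jacobian_def split: proj_line.split)

text \<open>
  Punctured neighbourhoods of a point. Residues, principal parts and \<open>regular_at\<close> depend on a section
  only through its germ along this filter.
\<close>
definition near :: "proj_line \<Rightarrow> complex filter" where
  "near q = (case q of Affine a \<Rightarrow> at a | Infinity \<Rightarrow> at_infinity)"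

lemma eventually_near: "(\<forall>\<^sub>F z in near q. P z) \<longleftrightarrow> (\<forall>\<^sub>F t in at 0. P (chart q t))"
proof (cases q)
  case (Affine a)
  then show ?thesis
    by (simp add: near_def chart_def at_to_0'[of a] eventually_filtermap add.commute)
next
  case Infinity
  then show ?thesis
    by (simp add: near_def chart_def at_to_infinity eventually_filtermap inverse_eq_divide)
qed

lemma eventually_near_nhds:
  assumes "\<forall>\<^sub>F z in near q. P z"
  shows "\<forall>\<^sub>F z in near q. \<forall>\<^sub>F y in nhds z. P y"
proof (cases q)
  case (Affine a)
  with assms obtain S where S: "open S" "a \<in> S" "\<And>z. z \<in> S \<Longrightarrow> z \<noteq> a \<Longrightarrow> P z"
    by (auto simp: near_def eventually_at_topological)
  have "\<forall>\<^sub>F y in nhds z. P y" if "z \<in> S" "z \<noteq> a" for z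
  proof (rule eventually_nhds_in_open[THEN eventually_mono])
    show "open (S - {a})" using S(1) by blast
  qed (use S that in auto)
  with S(1,2) Affine show ?thesis by (auto simp: near_def eventually_at_topological)
next
  case Infinity
  with assms obtain b where b: "\<And>z. b \<le> norm z \<Longrightarrow> P z"
    by (auto simp: near_def eventually_at_infinity)
  have "\<forall>\<^sub>F y in nhds z. P y" if "b + 1 \<le> norm z" for z
  proof (rule eventually_nhds_in_open[THEN eventually_mono])
    show "open {y :: complex. b < norm y}" by (intro open_Collect_less continuous_intros)
  qed (use b that in auto)
  with Infinity show ?thesis by (auto simp: near_def eventually_at_infinity intro!: exI[of _ "b + 1"])
qed

lemma regular_atI:
  assumes "g analytic_on {0}" "\<forall>\<^sub>F t in at 0. f (chart q t) * chart_jacobian q t powi k = g t"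
  shows "regular_at k q f"
  using assms by (auto simp: regular_at_def local_coeff_eq)

lemma regular_atE:
  assumes "regular_at k q f"
  obtains g where "g analytic_on {0}" "\<forall>\<^sub>F t in at 0. f (chart q t) * chart_jacobian q t powi k = g t"
  using assms by (auto simp: regular_at_def local_coeff_eq)

lemma regular_at_add:
  assumes "regular_at k q f" "regular_at k q g"
  shows "regular_at k q (\<lambda>z. f z + g z)"
proof -
  from assms(1) obtain f' where f': "f' analytic_on {0}"
    "\<forall>\<^sub>F t in at 0. f (chart q t) * chart_jacobian q t powi k = f' t" by (rule regular_atE)
  from assms(2) obtain g' where g': "g' analytic_on {0}"
    "\<forall>\<^sub>F t in at 0. g (chart q t) * chart_jacobian q t powi k = g' t" by (rule regular_atE)
  from f'(1) g'(1) show ?thesis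
  proof (rule regular_atI[OF analytic_on_add])
    show "\<forall>\<^sub>F t in at 0. (f (chart q t) + g (chart q t)) * chart_jacobian q t powi k = f' t + g' t"
      using f'(2) g'(2) by eventually_elim (simp add: distrib_right)
  qed
qed

lemma regular_at_scale:
  assumes "regular_at k q f"
  shows "regular_at k q (\<lambda>z. c * f z)"
proof -
  from assms obtain f' where f': "f' analytic_on {0}"
    "\<forall>\<^sub>F t in at 0. f (chart q t) * chart_jacobian q t powi k = f' t" by (rule regular_atE)
  show ?thesis
  proof (rule regular_atI)
    show "(\<lambda>t. c * f' t) analytic_on {0}" using f'(1) by (intro analytic_intros)
    show "\<forall>\<^sub>F t in at 0. c * f (chart q t) * chart_jacobian q t powi k = c * f' t"
      using f'(2) by eventually_elim (simp add: mult.assoc)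
  qed
qed

lemma regular_at_diff:
  assumes "regular_at k q f" "regular_at k q g"
  shows "regular_at k q (f - g)"
  using regular_at_add[OF assms(1) regular_at_scale[OF assms(2), of "-1"]]
  by (simp add: fun_diff_def)

lemma regular_at_cong:
  assumes "regular_at k q f" "\<forall>\<^sub>F z in near q. g z = f z"
  shows "regular_at k q g"
proof -
  from assms(1) obtain f' where f': "f' analytic_on {0}"
    "\<forall>\<^sub>F t in at 0. f (chart q t) * chart_jacobian q t powi k = f' t" by (rule regular_atE)
  from f'(1) show ?thesis
  proof (rule regular_atI)
    show "\<forall>\<^sub>F t in at 0. g (chart q t) * chart_jacobian q t powi k = f' t"
      using f'(2) assms(2)[unfolded eventually_near] by eventually_elim simp
  qed
qed

lemma regular_at_analytic:
  assumes "f analytic_on {a}"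
  shows "regular_at k (Affine a) f"
proof -
  have "(f \<circ> (\<lambda>t. a + t)) analytic_on {0}"
    by (rule analytic_on_compose) (use assms in \<open>auto intro!: analytic_intros\<close>)
  then show ?thesis by (auto simp: regular_at_def o_def)
qed

lemma regular_at_imp_meromorphic:
  assumes "regular_at k q f"
  shows "local_coeff k q f meromorphic_on {0}"
proof -
  from assms obtain g where g: "g analytic_on {0}" "\<forall>\<^sub>F t in at 0. local_coeff k q f t = g t"
    by (auto simp: regular_at_def)
  then have "local_coeff k q f meromorphic_on {0} \<longleftrightarrow> g meromorphic_on {0}"
    using meromorphic_on_cong[of "{0}" "local_coeff k q f" g "{0}"] by simp
  with analytic_on_imp_meromorphic_on[OF g(1)] show ?thesis by blast
qed

lemma regular_at_imp_tendsto:
  assumes "regular_at k (Affine a) f"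
  obtains c where "f \<midarrow>a\<rightarrow> c"
proof -
  from assms obtain g where g: "g analytic_on {0}" "\<forall>\<^sub>F t in at 0. f (a + t) = g t"
    by (auto simp: regular_at_def)
  have "g \<midarrow>0\<rightarrow> g 0" using analytic_at_imp_isCont[OF g(1)] by (simp add: isCont_def)
  then have "(\<lambda>t. f (a + t)) \<midarrow>0\<rightarrow> g 0"
    using g(2) by (subst tendsto_cong) auto
  with that show thesis by (metis LIM_offset_zero_cancel)
qed

lemma meromorphic_section_imp_meromorphic:
  assumes "meromorphic_section k f"
  shows "f meromorphic_on UNIV"
  unfolding meromorphic_on_meromorphic_at[of f UNIV]
proof
  fix a :: complex
  have "(\<lambda>t. f (a + t)) meromorphic_on {0}"
    using assms[unfolded meromorphic_section_def, rule_format, of "Affine a"] by simp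
  then show "f meromorphic_on {a}" by (simp add: meromorphic_on_def)
qed

lemma tendsto_imp_not_pole: "f \<midarrow>a\<rightarrow> c \<Longrightarrow> \<not> is_pole f (a :: complex)"
  unfolding is_pole_def by (metis at_neq_bot not_tendsto_and_filterlim_at_infinity)

lemma nicely_meromorphic_regular_imp_analytic:
  assumes "f nicely_meromorphic_on UNIV" "regular_at k (Affine a) f"
  shows "f analytic_on {a}"
proof (rule nicely_meromorphic_on_imp_analytic_at[OF assms(1) UNIV_I])
  show "\<not> is_pole f a"
    using regular_at_imp_tendsto[OF assms(2)] tendsto_imp_not_pole by blast
qed

lemma nicely_meromorphic_eq_remove_sings:
  assumes "f nicely_meromorphic_on UNIV"
  shows "remove_sings f z = f z"
  using assms unfolding nicely_meromorphic_on_def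
  by (cases "is_pole f z \<and> f z = 0") auto

lemma regular_outsideD:
  assumes "f \<in> regular_outside k q"
  shows "f nicely_meromorphic_on UNIV" "local_coeff k x f meromorphic_on {0}"
    "x \<noteq> q \<Longrightarrow> regular_at k x f" "Affine b \<noteq> q \<Longrightarrow> f analytic_on {b}"
  using assms nicely_meromorphic_regular_imp_analytic
  by (auto simp: regular_outside_def meromorphic_section_def)

text \<open>
  At an affine pole the coefficient must vanish by convention. There it suffices to exclude a finite
  limit, since a meromorphic function either has one or has a pole.
\<close>
lemma regular_outsideI:
  assumes an: "\<And>b. Affine b \<noteq> q \<Longrightarrow> f analytic_on {b}"
    and inf: "q \<noteq> Infinity \<Longrightarrow> regular_at k Infinity f"
    and mer: "local_coeff k q f meromorphic_on {0}"
    and nice: "\<And>a. q = Affine a \<Longrightarrow> f a = 0 \<and> (f \<midarrow>a\<rightarrow> 0 \<or> (\<forall>c. \<not> f \<midarrow>a\<rightarrow> c))"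
  shows "f \<in> regular_outside k q"
proof -
  have reg: "regular_at k x f" if "x \<noteq> q" for x
    using that inf by (cases x) (auto intro: regular_at_analytic an)
  have "local_coeff k x f meromorphic_on {0}" for x
    using mer regular_at_imp_meromorphic[OF reg] by (cases "x = q") auto
  then have sec: "meromorphic_section k f"
    by (simp add: meromorphic_section_def)
  have mero: "f meromorphic_on UNIV"
    using sec by (rule meromorphic_section_imp_meromorphic)
  have "(is_pole f z \<and> f z = 0) \<or> f \<midarrow>z\<rightarrow> f z" for z
  proof (cases "Affine z = q")
    case True
    have "is_pole f z \<or> (\<exists>c. f \<midarrow>z\<rightarrow> c)"
      using meromorphic_on_not_essential[OF meromorphic_on_subset[OF mero subset_UNIV]] unfolding not_essential_def by blast
    with nice[OF True[symmetric]] show ?thesis by metis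
  next
    case False
    then show ?thesis using analytic_at_imp_isCont[OF an[OF False]] by (simp add: isCont_def)
  qed
  with mero reg sec show ?thesis
    by (simp add: regular_outside_def nicely_meromorphic_on_def)
qed

lemma eventually_nonzero_at: "\<forall>\<^sub>F t in at 0. t \<noteq> (0 :: complex)"
  by (simp add: eventually_at_filter)

lemma eventually_denominator: "\<forall>\<^sub>F t in at 0. 1 - a * t \<noteq> (0 :: complex)"
proof -
  have "(\<lambda>t. 1 - a * t) \<midarrow>0\<rightarrow> 1 - a * 0" by (intro tendsto_intros)
  then show ?thesis by (rule tendsto_imp_eventually_ne) simp
qed

lemma entire_if_analytic: "(\<And>z. f analytic_on {z}) \<Longrightarrow> f holomorphic_on UNIV"
  by (metis UNIV_I analytic_imp_holomorphic analytic_on_analytic_at)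

lemma isCont_imp_tendsto_nhds: "isCont f a \<Longrightarrow> (f \<longlongrightarrow> f a) (nhds a)"
  by (simp add: isCont_def tendsto_at_iff_tendsto_nhds)

lemma analytic_poly_comp: "f analytic_on S \<Longrightarrow> (\<lambda>z. poly P (f z)) analytic_on S" for f :: "complex \<Rightarrow> complex"
  by (induction P) (auto intro!: analytic_intros)

lemma meromorphic_poly_comp: "f meromorphic_on S \<Longrightarrow> (\<lambda>z. poly P (f z)) meromorphic_on S"
  by (induction P) (auto intro!: meromorphic_intros)

text \<open>
  Regularity at infinity only constrains the germ in the chart \<open>1 / z\<close>; it makes the coefficient
  analytic at all affine points of large modulus, where removing singularities changes nothing.
\<close>
lemma regular_at_Infinity_imp_analytic:
  assumes "regular_at k Infinity d"
  shows "\<forall>\<^sub>F z in near Infinity. d analytic_on {z}"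
proof -
  from assms obtain g where g: "g analytic_on {0}"
    "\<forall>\<^sub>F t in at 0. d (chart Infinity t) * chart_jacobian Infinity t powi k = g t" by (rule regular_atE)
  from g(1) obtain S where S: "open S" "0 \<in> S" "g holomorphic_on S" by (auto simp: analytic_at)
  have "\<forall>\<^sub>F t in at 0. t \<noteq> 0 \<and> t \<in> S"
    using S by (auto simp: eventually_at_topological)
  then have in_S: "\<forall>\<^sub>F z in near Infinity. z \<noteq> 0 \<and> 1 / z \<in> S"
    unfolding eventually_near by eventually_elim (simp add: chart_def)
  let ?G = "\<lambda>z. g (1 / z) * (- (z ^ 2)) powi (- k)"
  have "\<forall>\<^sub>F z in near Infinity. d z = ?G z"
    unfolding eventually_near using g(2) eventually_nonzero_at
  proof eventually_elim
    case (elim t)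
    have "chart_jacobian Infinity t powi k * (- ((1 / t) ^ 2)) powi (- k) = 1"
    proof -
      have "chart_jacobian Infinity t = - ((1 / t) ^ 2)"
        by (simp add: chart_jacobian_def power_one_over)
      with chart_jacobian_nonzero[OF elim(2), of Infinity] show ?thesis
        by (simp only: power_int_minus) simp
    qed
    then have "d (1 / t) = d (1 / t) * (chart_jacobian Infinity t powi k * (- ((1 / t) ^ 2)) powi (- k))" by simp
    also have "\<dots> = g t * (- ((1 / t) ^ 2)) powi (- k)"
      using elim(1) by (simp only: chart_def proj_line.case mult.assoc[symmetric])
    finally show ?case by (simp add: chart_def)
  qed
  from eventually_near_nhds[OF this] in_S show ?thesis
  proof eventually_elim
    case (elim z)
    have "(g \<circ> (\<lambda>z. 1 / z)) analytic_on {z}"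
    proof (rule analytic_on_compose)
      show "g analytic_on (\<lambda>z. 1 / z) ` {z}" using S elim(2) by (auto simp: analytic_at)
    qed (use elim in \<open>auto intro!: analytic_intros\<close>)
    then have "?G analytic_on {z}"
      using elim(2) by (intro analytic_intros) (auto simp: o_def)
    with elim(1) show ?case by (rule analytic_at_cong[THEN iffD2, OF _ refl])
  qed
qed

lemma remove_sings_near_Infinity:
  assumes "regular_at k Infinity d"
  shows "\<forall>\<^sub>F t in at 0. remove_sings d (1 / t) = d (1 / t)"
  using regular_at_Infinity_imp_analytic[OF assms] unfolding eventually_near
  by eventually_elim (simp add: chart_def)

lemma remove_sings_regular:
  assumes "d meromorphic_on UNIV" "regular_at k (Affine z) d"
  shows "remove_sings d analytic_on {z}"
proof -
  obtain c where "d \<midarrow>z\<rightarrow> c" using regular_at_imp_tendsto[OF assms(2)] by blast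
  moreover have "isolated_singularity_at d z"
    using meromorphic_on_subset[OF assms(1) subset_UNIV, of "{z}"] by (simp add: meromorphic_at_iff)
  ultimately show ?thesis by (intro remove_sings_analytic_at)
qed

text \<open>
  A vector field without poles on the projective line is \<open>(a + b z + c z\<^sup>2) d/dz\<close>: in the chart
  \<open>t = 1 / z\<close> its coefficient gets the factor \<open>- t\<^sup>2\<close>, so it grows at most quadratically.
\<close>
lemma globally_regular_field:
  assumes mero: "d meromorphic_on UNIV" and reg: "\<And>q. regular_at (- 1) q d"
  obtains Q where "degree Q \<le> 2" "\<And>z. d analytic_on {z} \<Longrightarrow> d z = poly Q z"
proof -
  have "remove_sings d holomorphic_on UNIV"
    by (intro entire_if_analytic remove_sings_regular[OF mero reg])
  moreover obtain g where g: "g analytic_on {0}"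
    "\<forall>\<^sub>F t in at 0. d (chart Infinity t) * chart_jacobian Infinity t powi (- 1) = g t"
    using reg by (rule regular_atE)
  have "(\<lambda>t. - g t) analytic_on {0}" using g(1) by (intro analytic_intros)
  moreover have "\<forall>\<^sub>F t in at 0. remove_sings d (1 / t) * t ^ 2 = - g t"
    using g(2) remove_sings_near_Infinity[OF reg]
  proof eventually_elim
    case (elim t)
    then have "g t = - (d (1 / t) * t ^ 2)" by (simp add: chart_def chart_jacobian_def power_int_minus)
    with elim(2) show ?case by simp
  qed
  ultimately obtain Q where "degree Q \<le> 2" "remove_sings d = poly Q" by (rule entire_is_poly)
  with that show thesis by (metis remove_sings_at_analytic)
qed

section \<open>Forms that are regular outside a point\<close>

text \<open>
  If \<open>u\<close> is a coordinate vanishing at \<open>p\<close>, then \<open>v = 1 / u\<close> is a coordinate with its pole at \<open>p\<close>. Such a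
  \<open>v\<close> is \<open>s / (z - a) + r\<close> or \<open>s z + r\<close>, and in the standard chart \<open>t\<close> at \<open>p\<close> it is \<open>s / t + r\<close> in both
  cases. Forms regular outside \<open>p\<close> are polynomials in \<open>v\<close> times \<open>dv\<close>, which is why \<open>v\<close> rather than \<open>u\<close>
  is used throughout.
\<close>
locale pole_coordinate =
  fixes p :: proj_line and s r :: complex
  assumes s_nonzero: "s \<noteq> 0"
begin

definition v :: "complex \<Rightarrow> complex" where
  "v z = (case p of Affine a \<Rightarrow> s / (z - a) + r | Infinity \<Rightarrow> s * z + r)"

text \<open>
  Coefficient of \<open>dv\<close>. Division by zero makes it 0 at an affine pole, as the convention for sections
  demands.
\<close>
definition dv :: "complex \<Rightarrow> complex" where
  "dv z = (case p of Affine a \<Rightarrow> - s / (z - a) ^ 2 | Infinity \<Rightarrow> s)"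

definition form :: "complex poly \<Rightarrow> complex \<Rightarrow> complex" where
  "form P z = poly P (v z) * dv z"

lemma v_chart: "t \<noteq> 0 \<Longrightarrow> v (chart p t) = s / t + r"
  by (simp add: v_def chart_def split: proj_line.split)

lemma dv_chart: "t \<noteq> 0 \<Longrightarrow> dv (chart p t) * chart_jacobian p t = - s / t ^ 2"
  by (simp add: dv_def chart_def chart_jacobian_def split: proj_line.split)

lemma dv_nonzero: "Affine z \<noteq> p \<Longrightarrow> dv z \<noteq> 0"
  using s_nonzero by (auto simp: dv_def split: proj_line.split)

lemma has_field_derivative_v: "Affine z \<noteq> p \<Longrightarrow> (v has_field_derivative dv z) (at z)"
  unfolding v_def[abs_def] dv_def
  by (cases p) (auto intro!: derivative_eq_intros simp: power2_eq_square)

lemma analytic_v: "Affine z \<noteq> p \<Longrightarrow> v analytic_on {z}"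
  and analytic_dv: "Affine z \<noteq> p \<Longrightarrow> dv analytic_on {z}"
  unfolding v_def[abs_def] dv_def[abs_def] by (cases p; auto intro!: analytic_intros)+

lemma analytic_form: "Affine z \<noteq> p \<Longrightarrow> form P analytic_on {z}"
  unfolding form_def[abs_def] by (intro analytic_on_mult analytic_poly_comp analytic_v analytic_dv)

lemma local_form: "t \<noteq> 0 \<Longrightarrow> local_coeff 1 p (form P) t = poly P (s / t + r) * (- s / t ^ 2)"
  by (simp add: local_coeff_eq form_def v_chart mult.assoc dv_chart)

lemma filterlim_pole: "filterlim (\<lambda>t. s / t + r) at_infinity (at 0)"
proof -
  have "filterlim (\<lambda>t::complex. s / t) at_infinity (at 0)"
    unfolding is_pole_def[symmetric] by (intro is_pole_divide) (auto simp: s_nonzero intro!: filterlim_ident tendsto_eq_intros eventually_at_filter[THEN iffD2])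
  then show ?thesis by (intro tendsto_add_filterlim_at_infinity') auto
qed

text \<open>
  A nonzero form \<open>P(v) dv\<close> really has a pole at \<open>p\<close>: otherwise \<open>P(v)\<close> would tend to 0 although \<open>v\<close>
  tends to infinity.
\<close>
lemma principal_part_unbounded:
  assumes "(\<lambda>t. poly P (s / t + r) * (- s / t ^ 2)) \<midarrow>0\<rightarrow> c"
  shows "P = 0"
proof -
  have "(\<lambda>t. (poly P (s / t + r) * (- s / t ^ 2)) * (- (t ^ 2) / s)) \<midarrow>0\<rightarrow> c * (- (0 ^ 2) / s)"
    using s_nonzero by (intro tendsto_intros assms) auto
  then have "(\<lambda>t. poly P (s / t + r)) \<midarrow>0\<rightarrow> c * (- (0 ^ 2) / s)"
    by (rule Lim_transform_eventually) (auto simp: eventually_at_filter s_nonzero)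
  then have lim: "(\<lambda>t. poly P (s / t + r)) \<midarrow>0\<rightarrow> 0" by simp
  show ?thesis
  proof (cases "degree P = 0")
    case True
    then obtain c where "P = [:c:]" by (auto elim: degree_eq_zeroE)
    with lim show ?thesis by (simp add: LIM_const_eq)
  next
    case False
    then have "filterlim (\<lambda>t. poly P (s / t + r)) at_infinity (at 0)"
      by (intro filterlim_compose[OF filterlim_poly_at_infinity filterlim_pole]) simp
    with lim show ?thesis
      by (metis at_neq_bot not_tendsto_and_filterlim_at_infinity)
  qed
qed

lemma form_regular_imp_zero:
  assumes "regular_at 1 p (form P)"
  shows "P = 0"
proof -
  from assms obtain g where g: "g analytic_on {0}" "\<forall>\<^sub>F t in at 0. local_coeff 1 p (form P) t = g t"
    by (auto simp: regular_at_def)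
  have "\<forall>\<^sub>F t in at 0. g t = poly P (s / t + r) * (- s / t ^ 2)"
    using g(2) eventually_neq_at_within[of 0] by eventually_elim (simp add: local_form)
  moreover have "g \<midarrow>0\<rightarrow> g 0" using analytic_at_imp_isCont[OF g(1)] by (simp add: isCont_def)
  ultimately show ?thesis
    by (intro principal_part_unbounded) (rule Lim_transform_eventually)
qed

lemma form_mem: "form P \<in> K_space p"
proof (rule regular_outsideI)
  show "form P analytic_on {b}" if "Affine b \<noteq> p" for b using that by (rule analytic_form)
  show "regular_at 1 Infinity (form P)" if "p \<noteq> Infinity"
  proof -
    from that obtain a where a: "p = Affine a" by (cases p) auto
    show ?thesis
    proof (rule regular_atI)
      show "(\<lambda>t. poly P (s * t / (1 - a * t) + r) * (s / (1 - a * t) ^ 2)) analytic_on {0}"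
        by (intro analytic_intros analytic_poly_comp) auto
      show "\<forall>\<^sub>F t in at 0. form P (chart Infinity t) * chart_jacobian Infinity t powi 1
          = poly P (s * t / (1 - a * t) + r) * (s / (1 - a * t) ^ 2)"
        using eventually_nonzero_at eventually_denominator[of a]
      proof eventually_elim
        case (elim t)
        then have "1 / t - a = (1 - a * t) / t" by (simp add: field_simps)
        with elim show ?case
          unfolding form_def v_def dv_def by (simp add: a chart_def chart_jacobian_def power_divide)
      qed
    qed
  qed
  have "(\<lambda>t. poly P (s / t + r) * (- s / t ^ 2)) meromorphic_on {0}"
    by (intro meromorphic_intros meromorphic_poly_comp)
  moreover have "\<forall>\<^sub>F t in at 0. local_coeff 1 p (form P) t = poly P (s / t + r) * (- s / t ^ 2)"
    using eventually_nonzero_at by eventually_elim (rule local_form)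
  ultimately show "local_coeff 1 p (form P) meromorphic_on {0}"
    using meromorphic_on_cong[of "{0}" "local_coeff 1 p (form P)" _ "{0}"] by simp
  show "form P a = 0 \<and> (form P \<midarrow>a\<rightarrow> 0 \<or> (\<forall>c. \<not> form P \<midarrow>a\<rightarrow> c))" if a: "p = Affine a" for a
  proof (cases "\<exists>c. form P \<midarrow>a\<rightarrow> c")
    case True
    then obtain c where "form P \<midarrow>a\<rightarrow> c" ..
    then have "(\<lambda>t. form P (a + t)) \<midarrow>0\<rightarrow> c" by (rule LIM_offset_zero)
    then have "(\<lambda>t. poly P (s / t + r) * (- s / t ^ 2)) \<midarrow>0\<rightarrow> c"
    proof (rule Lim_transform_eventually)
      have "form P (a + t) = poly P (s / t + r) * (- s / t ^ 2)" for t
        unfolding form_def v_def dv_def by (simp add: a)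
      then show "\<forall>\<^sub>F t in at 0. form P (a + t) = poly P (s / t + r) * (- s / t ^ 2)" by simp
    qed
    then have "P = 0" by (rule principal_part_unbounded)
    then show ?thesis by (simp add: form_def[abs_def])
  next
    case False
    moreover have "form P a = 0" unfolding form_def dv_def by (simp add: a)
    ultimately show ?thesis by blast
  qed
qed

text \<open>
  For \<open>p\<close> at infinity the coefficient is entire of polynomial growth. For an affine \<open>p = a\<close> the
  substitution \<open>x = 1 / (z - a)\<close> moves the pole to infinity; regularity at \<open>z = \<infinity>\<close> becomes analyticity
  at \<open>x = 0\<close>.
\<close>
lemma K_space_subset_form: "K_space p \<subseteq> range form"
proof
  fix f assume f: "f \<in> K_space p"
  obtain n h where h: "h analytic_on {0}" "\<forall>\<^sub>F t in at 0. local_coeff 1 p f t * t ^ n = h t"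
    using meromorphic_at_0_factor[OF regular_outsideD(2)[OF f]] by blast
  show "f \<in> range form"
  proof (cases p)
    case Infinity
    have "f holomorphic_on UNIV"
      using regular_outsideD(4)[OF f] Infinity by (intro entire_if_analytic) auto
    moreover have "(\<lambda>t. - h t * t ^ 2) analytic_on {0}"
      using h(1) by (intro analytic_intros)
    moreover have "\<forall>\<^sub>F t in at 0. f (1 / t) * t ^ n = - h t * t ^ 2"
      using h(2) eventually_nonzero_at
    proof eventually_elim
      case (elim t)
      then have "h t = - (f (1 / t) * t ^ n) / t ^ 2" by (simp add: Infinity)
      with elim(2) show ?case by simp
    qed
    ultimately obtain Q where Q: "f = poly Q" by (rule entire_is_poly)
    have "f = form (smult (1 / s) (pcompose Q [:- r / s, 1 / s:]))"
      unfolding fun_eq_iff form_def v_def dv_def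
      using s_nonzero by (simp add: Infinity Q poly_pcompose field_simps)
    then show ?thesis by blast
  next
    case (Affine a)
    from regular_outsideD(3)[OF f, of Infinity] Affine obtain g where
      g: "g analytic_on {0}" "\<forall>\<^sub>F t in at 0. f (1 / t) * (- 1 / t ^ 2) = g t"
      by (auto simp: regular_at_def)
    \<comment> \<open>Coefficient of the form in the coordinate x; its value at 0 comes from the chart at infinity.\<close>
    define G where "G x = (if x = 0 then g 0 else f (a + 1 / x) * (- 1 / x ^ 2))" for x
    have "G analytic_on {x}" for x
    proof (cases "x = 0")
      case True
      have ne: "\<forall>\<^sub>F x in nhds 0. 1 + a * x \<noteq> 0"
      proof -
        have "isCont (\<lambda>x. 1 + a * x) 0" by (intro continuous_intros)
        then have "((\<lambda>x. 1 + a * x) \<longlongrightarrow> 1 + a * 0) (nhds 0)"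
          by (rule isCont_imp_tendsto_nhds)
        then show ?thesis by (rule tendsto_imp_eventually_ne) simp
      qed
      have "isCont (\<lambda>x. x / (1 + a * x)) 0" by (intro continuous_intros) auto
      from isCont_imp_tendsto_nhds[OF this]
      have lim: "((\<lambda>x. x / (1 + a * x)) \<longlongrightarrow> 0) (nhds 0)" by simp
      have "\<forall>\<^sub>F t in nhds 0. t \<noteq> 0 \<longrightarrow> f (1 / t) * (- 1 / t ^ 2) = g t"
        using g(2) by (simp add: eventually_at_filter)
      from eventually_compose_filterlim[OF this lim] ne
      have "\<forall>\<^sub>F x in nhds 0. G x = g (x / (1 + a * x)) / (1 + a * x) ^ 2"
      proof eventually_elim
        case (elim x)
        show ?case
        proof (cases "x = 0")
          case False
          with elim have "f (1 / (x / (1 + a * x))) * (- 1 / (x / (1 + a * x)) ^ 2) = g (x / (1 + a * x))"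
            by simp
          moreover have "1 / (x / (1 + a * x)) = a + 1 / x" using False elim by (simp add: field_simps)
          ultimately show ?thesis using False elim by (auto simp: G_def field_simps)
        qed (simp add: G_def)
      qed
      moreover have "(\<lambda>x. g (x / (1 + a * x)) / (1 + a * x) ^ 2) analytic_on {0}"
      proof (intro analytic_on_divide)
        have "(g \<circ> (\<lambda>x. x / (1 + a * x))) analytic_on {0}"
          by (rule analytic_on_compose) (use g(1) in \<open>auto intro!: analytic_intros\<close>)
        then show "(\<lambda>x. g (x / (1 + a * x))) analytic_on {0}" by (simp add: o_def)
      qed (auto intro!: analytic_intros)
      ultimately have "G analytic_on {0}" by (rule analytic_at_cong[THEN iffD2, OF _ refl])
      with True show ?thesis by simp
    next
      case False
      have ev: "\<forall>\<^sub>F y in nhds x. G y = f (a + 1 / y) * (- 1 / y ^ 2)"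
        using t1_space_nhds[OF False] by eventually_elim (simp add: G_def)
      have "(f \<circ> (\<lambda>y. a + 1 / y)) analytic_on {x}"
      proof (rule analytic_on_compose)
        show "(\<lambda>y. a + 1 / y) analytic_on {x}" using False by (intro analytic_intros) auto
        have "f analytic_on {a + 1 / x}" using False Affine by (intro regular_outsideD(4)[OF f]) auto
        then show "f analytic_on (\<lambda>y. a + 1 / y) ` {x}" by simp
      qed
      then have "(\<lambda>y. f (a + 1 / y) * (- 1 / y ^ 2)) analytic_on {x}"
        using False by (intro analytic_intros) (auto simp: o_def)
      with ev show ?thesis by (rule analytic_at_cong[THEN iffD2, OF _ refl])
    qed
    then have "G holomorphic_on UNIV" by (rule entire_if_analytic)
    moreover have "(\<lambda>t. - h t * t ^ 2) analytic_on {0}"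
      using h(1) by (intro analytic_intros)
    moreover have "\<forall>\<^sub>F t in at 0. G (1 / t) * t ^ n = - h t * t ^ 2"
      using h(2) eventually_nonzero_at
    proof eventually_elim
      case (elim t)
      then have "h t = f (a + t) * t ^ n" by (simp add: Affine)
      with elim(2) show ?case by (simp add: G_def power_one_over)
    qed
    ultimately obtain Q where Q: "G = poly Q" by (rule entire_is_poly)
    let ?P = "smult (1 / s) (pcompose Q [:- r / s, 1 / s:])"
    have off: "f z = form ?P z" if "z \<noteq> a" for z
    proof -
      have "f z = - G (1 / (z - a)) * (1 / (z - a)) ^ 2" using that by (simp add: G_def field_simps)
      also have "\<dots> = form ?P z"
      proof -
        have "poly [:- r / s, 1 / s:] (s / (z - a) + r) = 1 / (z - a)"
          using that s_nonzero by (simp add: field_simps)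
        then show ?thesis
          unfolding form_def v_def dv_def
          using s_nonzero by (simp add: Q Affine poly_pcompose power_divide del: poly_pCons)
      qed
      finally show ?thesis .
    qed
    have "f a = remove_sings f a"
      using regular_outsideD(1)[OF f] by (simp add: nicely_meromorphic_eq_remove_sings)
    also have "\<dots> = remove_sings (form ?P) a"
      by (rule remove_sings_cong) (auto simp: eventually_at_filter off)
    also have "\<dots> = form ?P a"
      using regular_outsideD(1)[OF form_mem] by (simp add: nicely_meromorphic_eq_remove_sings)
    finally have "f a = form ?P a" .
    with off have "f z = form ?P z" for z by (cases "z = a") auto
    then have "f = form ?P" by (rule ext)
    then show ?thesis by blast
  qed
qed

lemma K_space_eq: "K_space p = range form"
  using K_space_subset_form form_mem by blast

lemma form_add: "form (P + Q) = (\<lambda>z. form P z + form Q z)"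
  and form_smult: "form (smult c P) = (\<lambda>z. c * form P z)"
  and form_zero: "form 0 = (\<lambda>z. 0)"
  by (auto simp: form_def fun_eq_iff algebra_simps)

sublocale function_space "K_space p"
  by unfold_locales (auto simp: K_space_eq intro: form_zero[symmetric] form_add[symmetric] form_smult[symmetric])

end

lemma regular_at_zero: "regular_at k q (\<lambda>z. 0)"
  by (rule regular_atI[of "\<lambda>_. 0"]) auto

lemma regular_at_sum:
  "(\<And>i. i \<in> I \<Longrightarrow> regular_at k q (f i)) \<Longrightarrow> regular_at k q (\<lambda>z. \<Sum>i\<in>I. f i z)"
  by (induction I rule: infinite_finite_induct) (simp_all add: regular_at_add regular_at_zero)

context pole_coordinate
begin

text \<open>
  The basis \<open>d(v\<^sup>k)\<close>, \<open>k \<ge> 1\<close>, of \<open>K_space p\<close>. Including \<open>e 0 = 0\<close> absorbs boundary cases.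
\<close>
definition e :: "nat \<Rightarrow> complex \<Rightarrow> complex" where
  "e k z = of_nat k * v z ^ (k - 1) * dv z"

lemma e_eq_form: "e k = form (monom (of_nat k) (k - 1))"
  by (simp add: fun_eq_iff e_def form_def poly_monom)

lemma e_mem: "e k \<in> K_space p"
  by (simp add: e_eq_form form_mem)

lemma e_0: "e 0 = (\<lambda>_. 0)"
  by (simp add: e_def fun_eq_iff)

lemma form_eq_sum_e: "form P = (\<lambda>z. \<Sum>i\<le>degree P. (coeff P i / of_nat (Suc i)) * e (Suc i) z)"
  by (simp add: fun_eq_iff form_def e_def poly_altdef sum_distrib_right mult.assoc del: of_nat_Suc)

lemma eventually_near_generic: "\<forall>\<^sub>F z in near p. Affine z \<noteq> p \<and> v z \<noteq> 0"
proof -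
  have "(\<lambda>t. s + r * t) \<midarrow>0\<rightarrow> s + r * 0" by (intro tendsto_intros)
  then have "\<forall>\<^sub>F t in at 0. s + r * t \<noteq> 0"
    by (rule tendsto_imp_eventually_ne) (simp add: s_nonzero)
  with eventually_nonzero_at have "\<forall>\<^sub>F t in at 0. Affine (chart p t) \<noteq> p \<and> v (chart p t) \<noteq> 0"
  proof eventually_elim
    case (elim t)
    then have "s / t + r \<noteq> 0" by (simp add: field_simps)
    with elim show ?case by (simp add: v_chart) (simp add: chart_def split: proj_line.splits)
  qed
  then show ?thesis by (simp add: eventually_near)
qed

section \<open>Residues in the coordinate v\<close>

text \<open>
  Residue at \<open>p\<close> of the form \<open>f(v) dv\<close>, computed in the chart \<open>t\<close> where \<open>v = s / t + r\<close>.
\<close>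
definition v_residue :: "(complex \<Rightarrow> complex) \<Rightarrow> complex" where
  "v_residue f = residue (\<lambda>t. f (s / t + r) * (- s / t ^ 2)) 0"

lemma residue_at_eq_v_residue:
  assumes "\<forall>\<^sub>F z in near p. \<omega> z = f (v z) * dv z"
  shows "residue_at p \<omega> = v_residue f"
  unfolding residue_at_def v_residue_def
proof (rule residue_cong)
  show "\<forall>\<^sub>F t in at 0. local_coeff 1 p \<omega> t = f (s / t + r) * (- s / t ^ 2)"
    using assms[unfolded eventually_near] eventually_nonzero_at
    by eventually_elim (simp add: local_coeff_eq v_chart mult.assoc dv_chart)
qed simp

text \<open>
  The part of the chart on which \<open>v\<close> has no zero, so that all integer powers of \<open>v\<close> are holomorphic
  on it except at \<open>t = 0\<close>.
\<close>
definition chart_domain :: "complex set" where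
  "chart_domain = {t. s + r * t \<noteq> 0}"

lemma chart_domain: "open chart_domain" "0 \<in> chart_domain"
  unfolding chart_domain_def using s_nonzero
  by (auto intro!: open_Collect_neq continuous_intros)

lemma chart_domain_v: "t \<in> chart_domain - {0} \<Longrightarrow> t \<noteq> 0 \<and> s / t + r \<noteq> 0"
  by (auto simp: chart_domain_def field_simps)

lemma holomorphic_powi_chart:
  "(\<lambda>t. (s / t + r) powi i * (- s / t ^ 2)) holomorphic_on chart_domain - {0}"
  using chart_domain_v by (intro holomorphic_intros) auto

text \<open>
  \<open>v\<^sup>i dv\<close> is exact unless \<open>i = - 1\<close>, and \<open>dv / v\<close> has residue \<open>- 1\<close> at the simple pole of \<open>v\<close>.
\<close>
lemma v_residue_powi: "v_residue (\<lambda>x. x powi i) = (if i = - 1 then - 1 else 0)"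
proof (cases "i = - 1")
  case True
  have "v_residue (\<lambda>x. x powi i) = residue (\<lambda>t. (- s / (s + r * t)) / (t - 0)) 0"
    unfolding v_residue_def
  proof (rule residue_cong)
    show "\<forall>\<^sub>F t in at 0. (s / t + r) powi i * (- s / t ^ 2) = (- s / (s + r * t)) / (t - 0)"
      using eventually_nonzero_at
    proof eventually_elim
      case (elim t)
      have "s / t + r = (s + r * t) / t" using elim by (simp add: field_simps)
      with True elim show ?case by (simp add: power_int_minus power2_eq_square)
    qed
  qed simp
  also have "\<dots> = - s / (s + r * 0)"
    using chart_domain by (intro residue_simple[of chart_domain])
      (auto simp: chart_domain_def intro!: holomorphic_intros)
  finally show ?thesis using True s_nonzero by simp
next
  case False
  let ?f = "\<lambda>t. (s / t + r) powi i * (- s / t ^ 2)"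
  obtain \<epsilon> where \<epsilon>: "\<epsilon> > 0" "cball 0 \<epsilon> \<subseteq> chart_domain"
    using chart_domain open_contains_cball_eq by metis
  have "(?f has_contour_integral 2 * pi * \<i> * residue ?f 0) (circlepath 0 \<epsilon>)"
    by (rule base_residue[OF chart_domain \<epsilon>(1) holomorphic_powi_chart \<epsilon>(2)])
  moreover have "(?f has_contour_integral 0) (circlepath 0 \<epsilon>)"
  proof -
    let ?F = "\<lambda>t. (s / t + r) powi (i + 1) / of_int (i + 1)"
    have "(?F has_field_derivative ?f t) (at t within chart_domain - {0})"
      if "t \<in> chart_domain - {0}" for t
    proof -
      have "of_int (i + 1) \<noteq> (0 :: complex)"
        unfolding of_int_eq_0_iff using False by simp
      moreover have "((\<lambda>t. s / t + r) has_field_derivative - s / t ^ 2) (at t within chart_domain - {0})"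
        using chart_domain_v[OF that] by (auto intro!: derivative_eq_intros simp: power2_eq_square)
      note DERIV_cdivide[OF DERIV_power_int[OF this disjI2[OF conjunct2[OF chart_domain_v[OF that]]], of "i + 1"],
        of "of_int (i + 1)"]
      ultimately show ?thesis by (simp add: mult.assoc del: of_int_add)
    qed
    then have "(?f has_contour_integral ?F (pathfinish (circlepath 0 \<epsilon>)) - ?F (pathstart (circlepath 0 \<epsilon>))) (circlepath 0 \<epsilon>)"
      by (rule contour_integral_primitive) (use \<epsilon> in \<open>auto simp: path_image_circlepath\<close>)
    then show ?thesis by simp
  qed
  ultimately have "2 * pi * \<i> * residue ?f 0 = 0" by (rule has_contour_integral_unique)
  with False show ?thesis by (simp add: v_residue_def)
qed

lemma v_residue_powi_poly:
  "v_residue (\<lambda>x. x powi m * poly P x) = (if m < 0 then - coeff P (nat (- 1 - m)) else 0)"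
proof -
  let ?g = "\<lambda>i t. (s / t + r) powi i * (- s / t ^ 2)"
  have hol: "(\<lambda>t. \<Sum>i\<in>I. coeff P i * ?g (m + int i) t) holomorphic_on chart_domain - {0}" for I
    by (intro holomorphic_on_sum holomorphic_on_mult holomorphic_powi_chart) auto
  have sum: "residue (\<lambda>t. \<Sum>i\<in>I. coeff P i * ?g (m + int i) t) 0
      = (\<Sum>i\<in>I. coeff P i * v_residue (\<lambda>x. x powi (m + int i)))" if "finite I" for I
    using that
  proof (induction I)
    case (insert i I)
    have "(\<lambda>t. coeff P i * ?g (m + int i) t) holomorphic_on chart_domain - {0}"
      by (intro holomorphic_on_mult holomorphic_powi_chart) auto
    from insert residue_add[OF chart_domain this hol[of I]]
      residue_lmul[OF chart_domain holomorphic_powi_chart, of "coeff P i" "m + int i"]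
    show ?case by (simp add: v_residue_def)
  qed (simp add: residue_const)
  have "v_residue (\<lambda>x. x powi m * poly P x) = residue (\<lambda>t. \<Sum>i\<le>degree P. coeff P i * ?g (m + int i) t) 0"
    unfolding v_residue_def
  proof (rule residue_cong)
    have "\<forall>\<^sub>F t in at 0. t \<in> chart_domain - {0}"
      using chart_domain by (auto simp: eventually_at_topological)
    then show "\<forall>\<^sub>F t in at 0. (s / t + r) powi m * poly P (s / t + r) * (- s / t ^ 2) =
        (\<Sum>i\<le>degree P. coeff P i * ?g (m + int i) t)"
    proof eventually_elim
      case (elim t)
      from chart_domain_v[OF elim] show ?case
        by (simp add: poly_altdef power_int_add sum_distrib_left sum_distrib_right mult_ac
            del: minus_divide_left)
    qed
  qed simp
  also have "\<dots> = (\<Sum>i\<le>degree P. if i = nat (- 1 - m) \<and> m < 0 then - coeff P i else 0)"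
    unfolding sum[OF finite_atMost] v_residue_powi by (intro sum.cong) auto
  also have "\<dots> = (if m < 0 then - coeff P (nat (- 1 - m)) else 0)"
    by (auto simp: coeff_eq_0)
  finally show ?thesis .
qed

text \<open>
  \<open>Res\<^sub>p (u\<^sup>j \<alpha>)\<close> for \<open>u = 1 / v\<close>. Up to the factor \<open>- j\<close> this is the \<open>j\<close>-th coordinate of \<open>\<alpha>\<close> in the
  basis \<open>e\<close>.
\<close>
definition moment :: "nat \<Rightarrow> (complex \<Rightarrow> complex) \<Rightarrow> complex" where
  "moment j \<alpha> = residue_at p (\<lambda>z. v z powi (- int j) * \<alpha> z)"

lemma moment_form: "moment j (form P) = (if j = 0 then 0 else - coeff P (j - 1))"
proof -
  have "moment j (form P) = v_residue (\<lambda>x. x powi (- int j) * poly P x)"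
    unfolding moment_def by (rule residue_at_eq_v_residue) (simp add: form_def mult.assoc)
  also have "\<dots> = (if j = 0 then 0 else - coeff P (j - 1))"
    by (simp add: v_residue_powi_poly nat_diff_distrib' flip: nat_minus_as_int)
  finally show ?thesis .
qed

lemma K_spaceE:
  assumes "\<alpha> \<in> K_space p"
  obtains P where "\<alpha> = form P"
  using assms by (auto simp: K_space_eq)

lemma functional_moment: "functional (moment j)"
  unfolding functional_def
  by (auto elim!: K_spaceE simp: moment_form simp flip: form_add form_smult)

lemma moment_0: "\<alpha> \<in> K_space p \<Longrightarrow> moment 0 \<alpha> = 0"
  by (auto elim!: K_spaceE simp: moment_form)

lemma moment_e: "moment j (e k) = (if j = k then - of_nat k else 0)"
  by (auto simp: e_eq_form moment_form)

lemma moment_eq_zero_imp_zero: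
  assumes "\<alpha> \<in> K_space p" "\<And>j. moment j \<alpha> = 0"
  shows "\<alpha> = (\<lambda>_. 0)"
proof -
  from assms(1) obtain P where P: "\<alpha> = form P" by (rule K_spaceE)
  have "coeff P i = 0" for i using assms(2)[of "Suc i"] by (simp add: P moment_form)
  then have "P = 0" by (simp add: poly_eq_iff)
  with P show ?thesis by (simp add: form_zero)
qed

text \<open>
  \<open>\<xi>\<close> agrees near \<open>p\<close> with the field \<open>v\<^sup>1\<^sup>-\<^sup>n d/dv = - u\<^sup>n\<^sup>+\<^sup>1 d/du\<close>.
\<close>
definition field_germ :: "int \<Rightarrow> (complex \<Rightarrow> complex) \<Rightarrow> bool" where
  "field_germ n \<xi> \<longleftrightarrow> (\<forall>\<^sub>F z in near p. \<xi> z = v z powi (1 - n) / dv z)"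

text \<open>
  In the coordinate \<open>v\<close> the integrand is \<open>v\<^sup>1\<^sup>-\<^sup>n P(v) Q(v) dv\<close>, and the coefficient of the product
  \<open>P Q\<close> is a convolution. This diagonalises the pairing in terms of moments.
\<close>
lemma residue_pairing:
  assumes \<xi>: "field_germ n \<xi>" and "\<alpha> \<in> K_space p" "\<beta> \<in> K_space p"
  shows "residue_at p (\<lambda>z. (\<xi> z * \<alpha> z) * \<beta> z) = - (\<Sum>i\<in>{1..<nat n}. moment i \<alpha> * moment (nat n - i) \<beta>)"
proof -
  obtain P Q where PQ: "\<alpha> = form P" "\<beta> = form Q" using assms(2,3) by (metis K_spaceE)
  have "\<forall>\<^sub>F z in near p. (\<xi> z * \<alpha> z) * \<beta> z = (\<lambda>x. x powi (1 - n) * poly (P * Q) x) (v z) * dv z"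
    using \<xi>[unfolded field_germ_def] eventually_near_generic
    by eventually_elim (simp add: PQ form_def dv_nonzero)
  from residue_at_eq_v_residue[OF this] v_residue_powi_poly[of "1 - n" "P * Q"]
  have eq: "residue_at p (\<lambda>z. (\<xi> z * \<alpha> z) * \<beta> z) = (if 1 < n then - coeff (P * Q) (nat (n - 2)) else 0)"
    by simp
  show ?thesis
  proof (cases "1 < n")
    case True
    then obtain N where N: "n = int N + 2" by (metis add.commute zle_iff_zadd zless_imp_add1_zle one_add_one add.assoc)
    have "(\<Sum>i\<in>{1..<N + 2}. moment i \<alpha> * moment (N + 2 - i) \<beta>) = (\<Sum>i\<le>N. coeff P i * coeff Q (N - i))"
      by (rule sum.reindex_bij_witness[of _ Suc "\<lambda>i. i - 1"]) (auto simp: PQ moment_form Suc_diff_le)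
    moreover have "nat n = N + 2" using N by simp
    ultimately show ?thesis using True N by (simp only: eq) (simp add: coeff_mult)
  qed (simp add: eq)
qed

section \<open>The projected Lie derivative\<close>

lemma regular_negative_power:
  assumes "m \<ge> 2"
  shows "regular_at 1 p (\<lambda>z. c * (v z powi (- int m) * dv z))"
proof (rule regular_at_scale, rule regular_atI)
  show "(\<lambda>t. - s * t ^ (m - 2) / (s + r * t) ^ m) analytic_on {0}"
    using s_nonzero by (intro analytic_intros) auto
  have "\<forall>\<^sub>F t in at 0. t \<in> chart_domain - {0}"
    using chart_domain by (auto simp: eventually_at_topological)
  then show "\<forall>\<^sub>F t in at 0. v (chart p t) powi (- int m) * dv (chart p t) * chart_jacobian p t powi 1
      = - s * t ^ (m - 2) / (s + r * t) ^ m"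
  proof eventually_elim
    case (elim t)
    then have t: "t \<noteq> 0" "s + r * t \<noteq> 0" by (auto simp: chart_domain_def)
    have v: "v (chart p t) = (s + r * t) / t" using t by (simp add: v_chart field_simps)
    have "t ^ m = t ^ (m - 2) * t ^ 2" by (metis assms le_add_diff_inverse2 power_add)
    with t have "(t / (s + r * t)) ^ m * (- s / t ^ 2) = - s * t ^ (m - 2) / (s + r * t) ^ m"
      by (simp add: power_divide)
    then show ?case
      using t by (simp add: v mult.assoc dv_chart power_int_minus power_divide mult.commute[of "t\<^sup>2"])
  qed
qed

text \<open>
  The Lie derivative of \<open>\<alpha>\<close> is the differential of the contraction of \<open>\<alpha>\<close> with the field, here of
  \<open>v\<^sup>1\<^sup>-\<^sup>n P(v)\<close>.
\<close>
lemma lie_deriv_form: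
  assumes \<xi>: "field_germ n \<xi>"
  shows "\<forall>\<^sub>F z in near p. lie_deriv \<xi> (form P) z
      = (\<Sum>i\<le>degree P. coeff P i * (of_int (1 - n + int i) * v z powi (int i - n) * dv z))"
  using eventually_near_nhds[OF \<xi>[unfolded field_germ_def]]
    eventually_near_nhds[OF eventually_near_generic] 
proof eventually_elim
  case (elim z)
  from eventually_nhds_x_imp_x[OF elim(2)] have z: "Affine z \<noteq> p" "v z \<noteq> 0" by auto
  let ?\<eta> = "\<lambda>y. v y powi (1 - n) / dv y"
  have "?\<eta> analytic_on {z}"
    using z dv_nonzero by (intro analytic_on_divide analytic_on_power_int analytic_v analytic_dv) auto
  then have \<eta>: "?\<eta> field_differentiable at z" by (rule analytic_on_imp_differentiable_at) simp
  have P: "form P field_differentiable at z"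
    using analytic_form[OF z(1)] by (rule analytic_on_imp_differentiable_at) simp
  have "deriv \<xi> z = deriv ?\<eta> z" using elim(1) by (rule deriv_cong_ev) simp
  moreover have "\<xi> z = ?\<eta> z" using eventually_nhds_x_imp_x[OF elim(1)] .
  ultimately have "lie_deriv \<xi> (form P) z = deriv (\<lambda>y. ?\<eta> y * form P y) z"
    by (simp only: lie_deriv_def deriv_mult[OF \<eta> P])
  also have "\<dots> = deriv (\<lambda>y. \<Sum>i\<le>degree P. coeff P i * v y powi (1 - n + int i)) z"
  proof (rule deriv_cong_ev)
    show "\<forall>\<^sub>F y in nhds z. ?\<eta> y * form P y = (\<Sum>i\<le>degree P. coeff P i * v y powi (1 - n + int i))"
      using elim(2) by eventually_elim
        (simp add: form_def dv_nonzero poly_altdef power_int_add sum_distrib_left mult_ac)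
  qed simp
  also have "\<dots> = (\<Sum>i\<le>degree P. coeff P i * (of_int (1 - n + int i) * v z powi (int i - n) * dv z))"
    using z has_field_derivative_v[OF z(1)]
    by (intro DERIV_imp_deriv) (auto intro!: derivative_eq_intros simp: algebra_simps)
  finally show ?case .
qed

lemma principal_part_unique:
  assumes "\<kappa> \<in> K_space p" "\<kappa>' \<in> K_space p"
    and "regular_at 1 p (\<eta> - \<kappa>)" "regular_at 1 p (\<eta> - \<kappa>')"
  shows "\<kappa> = \<kappa>'"
proof -
  from assms(1,2) obtain Q Q' where Q: "\<kappa> = form Q" "\<kappa>' = form Q'" by (metis K_spaceE)
  have "form (Q + smult (- 1) Q') = (\<eta> - \<kappa>') - (\<eta> - \<kappa>)"
    by (simp add: fun_eq_iff form_def Q algebra_simps)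
  then have "regular_at 1 p (form (Q + smult (- 1) Q'))"
    using regular_at_diff[OF assms(4,3)] by simp
  then have "Q + smult (- 1) Q' = 0" by (rule form_regular_imp_zero)
  then show ?thesis by (simp add: Q)
qed

text \<open>
  For \<open>P(v) dv = e k\<close> this says that the projected Lie derivative is \<open>k e (k - n)\<close>, or 0 for \<open>k \<le> n\<close>.
  The omitted terms \<open>v\<^sup>-\<^sup>m dv\<close> are regular at \<open>p\<close> for \<open>m \<ge> 2\<close>; the term with \<open>m = 1\<close>, which would not be
  of the second kind, comes with the coefficient 0.
\<close>
lemma second_kind_proj_form:
  assumes \<xi>: "field_germ n \<xi>"
  shows "second_kind_proj p (lie_deriv \<xi> (form P))
       = (\<lambda>z. \<Sum>i\<le>degree P. coeff P i * e (nat (int i + 1 - n)) z)" (is "_ = ?\<kappa>")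
  unfolding second_kind_proj_def
proof (rule the_equality)
  have summand: "regular_at 1 p (\<lambda>z. coeff P i * (of_int (1 - n + int i) * v z powi (int i - n) * dv z)
      + (- 1) * (coeff P i * e (nat (int i + 1 - n)) z))" for i
  proof (cases "n \<le> int i")
    case True
    then obtain k where k: "int i = n + int k" using zle_iff_zadd by blast
    have "nat (int i + 1 - n) = Suc k" "of_int (1 - n + int i) = (of_nat (Suc k) :: complex)" "int i - n = int k"
      by (simp_all add: k)
    then have "coeff P i * (of_int (1 - n + int i) * v z powi (int i - n) * dv z)
      + (- 1) * (coeff P i * e (nat (int i + 1 - n)) z) = 0" for z
      by (simp only: e_def) simp
    then show ?thesis by (simp only: regular_at_zero)
  next
    case False
    then have e: "e (nat (int i + 1 - n)) = (\<lambda>_. 0)" by (simp add: e_0)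
    show ?thesis
    proof (cases "n = int i + 1")
      case True
      then show ?thesis by (simp add: e_0 regular_at_zero)
    next
      case False
      define m where "m = nat (n - int i)"
      have m: "int i - n = - int m" "m \<ge> 2"
        using False \<open>\<not> n \<le> int i\<close> by (simp_all add: m_def)
      from regular_negative_power[OF m(2), of "coeff P i * of_int (1 - n + int i)"] show ?thesis
        by (simp add: e m(1) mult.assoc)
    qed
  qed
  have "\<forall>\<^sub>F z in near p. (lie_deriv \<xi> (form P) - ?\<kappa>) z = (\<Sum>i\<le>degree P.
      coeff P i * (of_int (1 - n + int i) * v z powi (int i - n) * dv z)
      + (- 1) * (coeff P i * e (nat (int i + 1 - n)) z))"
    using lie_deriv_form[OF \<xi>, of P]
    by eventually_elim (simp add: sum_subtractf)
  then have "regular_at 1 p (lie_deriv \<xi> (form P) - ?\<kappa>)"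
    by (rule regular_at_cong[OF regular_at_sum[OF summand]])
  then show \<kappa>: "?\<kappa> \<in> K_space p \<and> regular_at 1 p (lie_deriv \<xi> (form P) - ?\<kappa>)"
    by (simp add: sum_mem e_mem)
  show "\<kappa>' = ?\<kappa>" if "\<kappa>' \<in> K_space p \<and> regular_at 1 p (lie_deriv \<xi> (form P) - \<kappa>')" for \<kappa>'
    using that \<kappa> by (intro principal_part_unique) auto
qed

end

section \<open>The creating bidifferential\<close>

lemma weighted_power_sum:
  fixes x y :: complex
  shows "(x - y) ^ 2 * (\<Sum>a\<le>N. of_nat a * x ^ (a - 1) * y ^ (N - a))
       = of_nat N * x ^ (N + 1) - of_nat (N + 1) * x ^ N * y + y ^ (N + 1)"
proof (induction N)
  case (Suc N)
  have "(\<Sum>a\<le>Suc N. of_nat a * x ^ (a - 1) * y ^ (Suc N - a))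
      = y * (\<Sum>a\<le>N. of_nat a * x ^ (a - 1) * y ^ (N - a)) + of_nat (Suc N) * x ^ N"
  proof -
    have "(\<Sum>a\<le>N. of_nat a * x ^ (a - 1) * y ^ (Suc N - a))
        = (\<Sum>a\<le>N. y * (of_nat a * x ^ (a - 1) * y ^ (N - a)))"
      by (rule sum.cong) (simp_all add: Suc_diff_le)
    then show ?thesis by (simp add: sum_distrib_left)
  qed
  then have "(x - y) ^ 2 * (\<Sum>a\<le>Suc N. of_nat a * x ^ (a - 1) * y ^ (Suc N - a))
      = y * (of_nat N * x ^ (N + 1) - of_nat (N + 1) * x ^ N * y + y ^ (N + 1))
        + (x - y) ^ 2 * of_nat (Suc N) * x ^ N"
    unfolding Suc.IH[symmetric] by (simp add: algebra_simps)
  then show ?case by (simp add: power2_eq_square algebra_simps)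
qed simp

text \<open>
  The numerator of the kernel of \<open>omega\<close> for the field \<open>x\<^sup>N\<^sup>+\<^sup>1 d/dx\<close> is divisible by the cube of the
  difference, and the quotient is the sum of the coefficients of \<open>- d(x\<^sup>a) d(y\<^sup>N\<^sup>-\<^sup>a)\<close>. Induction on \<open>N\<close> produces
  the sums of \<open>weighted_power_sum\<close> as the difference of consecutive quotients.
\<close>
lemma bidifferential_power_sum:
  fixes x y :: complex
  shows "2 * (x ^ (N + 1) - y ^ (N + 1)) - of_nat (N + 1) * (x ^ N + y ^ N) * (x - y)
       = - ((x - y) ^ 3 * (\<Sum>a\<le>N. of_nat a * of_nat (N - a) * x ^ (a - 1) * y ^ (N - a - 1)))"
proof (induction N)
  case (Suc N)
  let ?S = "\<lambda>N. \<Sum>a\<le>N. of_nat a * of_nat (N - a) * x ^ (a - 1) * y ^ (N - a - 1)"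
  let ?T = "\<Sum>a\<le>N. of_nat a * x ^ (a - 1) * y ^ (N - a)"
  have "of_nat a * of_nat (Suc N - a) * x ^ (a - 1) * y ^ (Suc N - a - 1)
      = y * (of_nat a * of_nat (N - a) * x ^ (a - 1) * y ^ (N - a - 1)) + of_nat a * x ^ (a - 1) * y ^ (N - a)"
    if "a \<le> N" for a
    using that by (cases "N - a") (simp_all add: Suc_diff_le algebra_simps)
  then have "?S (Suc N) = y * ?S N + ?T"
    by (simp add: sum_distrib_left sum.distrib)
  then have "(x - y) ^ 3 * ?S (Suc N) = y * ((x - y) ^ 3 * ?S N) + (x - y) * ((x - y) ^ 2 * ?T)"
    by (simp add: power3_eq_cube power2_eq_square algebra_simps)
  also have "(x - y) ^ 3 * ?S N = - (2 * (x ^ (N + 1) - y ^ (N + 1)) - of_nat (N + 1) * (x ^ N + y ^ N) * (x - y))"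
    by (simp only: Suc.IH minus_minus)
  finally show ?case
    unfolding weighted_power_sum by (simp add: algebra_simps)
qed simp

lemma sym_prod_pair: "sym_prod [\<alpha>, \<beta>] [z1, z2] = (\<alpha> z1 * \<beta> z2 + \<alpha> z2 * \<beta> z1) / 2"
proof -
  have 1: "(degree_one \<beta> \<otimes>\<^sub>s vacuum) [z] = \<beta> z" for z
    by (subst degree_one_sym_mult[OF symmetric_vacuum]) (simp add: vacuum_def remove_nth_def)
  show ?thesis
    by (simp add: degree_one_sym_mult[OF symmetric_sym_mult] 1 remove_nth_def lessThan_nat_numeral
        numeral_2_eq_2)
qed

lemma sym_prod_length: "sym_prod \<alpha>s zs = 0" if "length zs \<noteq> length \<alpha>s"
  using that
proof (induction \<alpha>s arbitrary: zs)
  case (Cons \<alpha> \<alpha>s)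
  show ?case
  proof (cases zs)
    case (Cons w ws)
    with Cons.prems have "sym_prod \<alpha>s (remove_nth i zs) = 0" if "i < length zs" for i
      using that by (intro Cons.IH) (auto simp: length_remove_nth)
    then show ?thesis by (simp add: degree_one_sym_mult[OF symmetric_sym_prod])
  qed (simp add: degree_one_sym_mult[OF symmetric_sym_prod])
qed (simp add: vacuum_def)

definition omega_kernel :: "(complex \<Rightarrow> complex) \<Rightarrow> complex \<Rightarrow> complex \<Rightarrow> complex" where
  "omega_kernel \<xi> z1 z2 =
     (2 * (\<xi> z1 - \<xi> z2) - (deriv \<xi> z1 + deriv \<xi> z2) * (z1 - z2)) / (2 * (z1 - z2)) * (1 / (z1 - z2) ^ 2)"

lemma omega_kernelI:
  assumes "2 * (\<xi> z1 - \<xi> z2) - (deriv \<xi> z1 + deriv \<xi> z2) * (z1 - z2) = c * (z1 - z2) ^ 3" "z1 \<noteq> z2"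
  shows "omega_kernel \<xi> z1 z2 = c / 2"
proof -
  define d where "d = z1 - z2"
  have "d \<noteq> 0" using assms(2) by (simp add: d_def)
  then have "c * d ^ 3 / (2 * d) * (1 / d ^ 2) = c / 2"
    by (simp add: power2_eq_square power3_eq_cube)
  then show ?thesis unfolding omega_kernel_def assms(1) d_def .
qed

text \<open>
  The kernel annihilates globally regular fields, so it depends on a field only through its principal
  part.
\<close>
lemma omega_kernel_quadratic:
  assumes "degree Q \<le> 2" "deriv \<xi> z1 = deriv \<zeta> z1 + poly (pderiv Q) z1" "deriv \<xi> z2 = deriv \<zeta> z2 + poly (pderiv Q) z2"
    and "\<xi> z1 = \<zeta> z1 + poly Q z1" "\<xi> z2 = \<zeta> z2 + poly Q z2"
  shows "omega_kernel \<xi> z1 z2 = omega_kernel \<zeta> z1 z2"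
proof -
  obtain a b c where Q: "Q = [:a, b, c:]"
  proof
    show "Q = [:coeff Q 0, coeff Q 1, coeff Q 2:]"
      using assms(1) by (intro poly_eqI) (auto simp: coeff_pCons numeral_2_eq_2 coeff_eq_0 split: nat.split)
  qed
  have "2 * (\<xi> z1 - \<xi> z2) - (deriv \<xi> z1 + deriv \<xi> z2) * (z1 - z2)
      = 2 * (\<zeta> z1 - \<zeta> z2) - (deriv \<zeta> z1 + deriv \<zeta> z2) * (z1 - z2)"
    unfolding assms Q by (simp add: pderiv_pCons algebra_simps)
  then show ?thesis by (simp add: omega_kernel_def)
qed

context pole_coordinate
begin

lemma eventually_off_p: "Affine z \<noteq> p \<Longrightarrow> \<forall>\<^sub>F y in nhds z. Affine y \<noteq> p"
  by (cases p) (auto intro: t1_space_nhds)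

text \<open>
  Coefficient of the field \<open>v\<^sup>N\<^sup>+\<^sup>1 d/dv\<close>.
\<close>
definition zeta :: "nat \<Rightarrow> complex \<Rightarrow> complex" where
  "zeta N z = v z ^ (N + 1) / dv z"

lemma deriv_zeta:
  assumes "Affine z \<noteq> p"
  shows "deriv (zeta N) z = of_nat (N + 1) * v z ^ N
      + v z ^ (N + 1) * (case p of Affine a \<Rightarrow> - (2 * (z - a) / s) | Infinity \<Rightarrow> 0)"
proof -
  define g where "g y = (case p of Affine a \<Rightarrow> - ((y - a) ^ 2) / s | Infinity \<Rightarrow> 1 / s)" for y
  define g' where "g' = (case p of Affine a \<Rightarrow> - (2 * (z - a) / s) | Infinity \<Rightarrow> 0)"
  have g: "1 / dv y = g y" for y
    unfolding g_def dv_def by (simp split: proj_line.split)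
  have "(g has_field_derivative g') (at z)"
    unfolding g_def[abs_def] g'_def using s_nonzero
    by (cases p) (auto intro!: derivative_eq_intros simp: field_simps)
  then have "((\<lambda>y. v y ^ (N + 1) * g y) has_field_derivative
      v z ^ (N + 1) * g' + of_nat (N + 1) * v z ^ N * dv z * g z) (at z)"
    using DERIV_mult[OF DERIV_power[OF has_field_derivative_v[OF assms], of "N + 1"]]
    by (fastforce simp: mult_ac add.commute simp del: power_Suc)
  moreover have "(\<lambda>y. v y ^ (N + 1) * g y) = zeta N"
    by (simp add: fun_eq_iff zeta_def flip: g)
  ultimately have "deriv (zeta N) z = v z ^ (N + 1) * g' + of_nat (N + 1) * v z ^ N * dv z * g z"
    by (metis DERIV_imp_deriv)
  moreover have "dv z * g z = 1" using dv_nonzero[OF assms] by (simp flip: g)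
  ultimately show ?thesis
    by (simp add: g'_def mult.assoc)
qed

text \<open>
  The kernel is invariant under Moebius changes of coordinate, which reduces the claim to
  \<open>bidifferential_power_sum\<close>. The invariance is verified for the two shapes of \<open>v\<close>.
\<close>
lemma omega_kernel_zeta:
  assumes "z1 \<noteq> z2" "Affine z1 \<noteq> p" "Affine z2 \<noteq> p"
  shows "omega_kernel (zeta N) z1 z2 = - (1 / 2) * (\<Sum>a\<le>N. e a z1 * e (N - a) z2)"
proof -
  define x y where xy: "x = v z1" "y = v z2"
  define S where "S = (\<Sum>a\<le>N. of_nat a * of_nat (N - a) * x ^ (a - 1) * y ^ (N - a - 1))"
  define A B where AB: "A = x ^ (N + 1)" "B = y ^ (N + 1)"
  define C where "C = of_nat (N + 1) * (x ^ N + y ^ N)"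
  have key: "2 * (A - B) - C * (x - y) = - ((x - y) ^ 3 * S)"
    unfolding AB C_def S_def using bidifferential_power_sum by simp
  have sum: "(\<Sum>a\<le>N. e a z1 * e (N - a) z2) = S * (dv z1 * dv z2)"
    by (simp add: S_def e_def xy sum_distrib_left sum_distrib_right mult_ac)
  show ?thesis
  proof (cases p)
    case Infinity
    have dv: "dv z = s" for z unfolding dv_def by (simp add: Infinity)
    have xyz: "x - y = s * (z1 - z2)" unfolding xy v_def by (simp add: Infinity algebra_simps)
    have "2 * (zeta N z1 - zeta N z2) - (deriv (zeta N) z1 + deriv (zeta N) z2) * (z1 - z2)
        = (2 * (A - B) - C * (x - y)) / s"
    proof -
      have zz: "zeta N z1 = A / s" "zeta N z2 = B / s"
        unfolding zeta_def AB xy dv by simp_all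
      have dd: "deriv (zeta N) z1 + deriv (zeta N) z2 = C"
        unfolding deriv_zeta[OF assms(2)] deriv_zeta[OF assms(3)] C_def xy
        by (simp add: Infinity distrib_left)
      show ?thesis unfolding zz dd using s_nonzero by (simp add: xyz field_simps)
    qed
    also have "\<dots> = - (s ^ 2 * S) * (z1 - z2) ^ 3"
      by (subst key) (use s_nonzero in \<open>simp add: xyz power_mult_distrib power3_eq_cube power2_eq_square\<close>)
    finally show ?thesis
      by (subst omega_kernelI[OF _ assms(1)]) (simp_all add: sum dv power2_eq_square)
  next
    case (Affine a)
    define p1 p2 where p12: "p1 = z1 - a" "p2 = z2 - a"
    have nz: "p1 \<noteq> 0" "p2 \<noteq> 0" "p1 - p2 \<noteq> 0" using assms Affine by (auto simp: p12)
    have dv: "dv z1 = - s / p1 ^ 2" "dv z2 = - s / p2 ^ 2" unfolding dv_def p12 by (simp_all add: Affine)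
    have xyz: "x - y = - (s * (p1 - p2) / (p1 * p2))"
      unfolding xy v_def using nz by (simp add: Affine field_simps flip: p12)
    then have diff: "p1 - p2 = - ((x - y) * p1 * p2 / s)"
      using nz s_nonzero by simp
    have z: "z1 - z2 = p1 - p2" by (simp add: p12)
    have "2 * (zeta N z1 - zeta N z2) - (deriv (zeta N) z1 + deriv (zeta N) z2) * (z1 - z2)
        = 2 * (- A * p1 ^ 2 / s + B * p2 ^ 2 / s) - (C - 2 * (p1 * A + p2 * B) / s) * (p1 - p2)"
    proof -
      have zz: "zeta N z1 = - A * p1 ^ 2 / s" "zeta N z2 = - B * p2 ^ 2 / s"
        unfolding zeta_def AB xy dv by simp_all
      have dd: "deriv (zeta N) z1 + deriv (zeta N) z2 = C - 2 * (p1 * A + p2 * B) / s"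
        unfolding deriv_zeta[OF assms(2)] deriv_zeta[OF assms(3)] C_def AB xy p12
        using s_nonzero by (simp add: Affine field_simps)
      show ?thesis unfolding zz dd z by simp
    qed
    also have "\<dots> = - (2 * p1 * p2 / s) * (A - B) - C * (p1 - p2)"
      using s_nonzero by (simp add: field_simps power2_eq_square)
    also have "\<dots> = - (p1 * p2 / s) * (2 * (A - B) - C * (x - y))"
      by (subst diff) (simp add: algebra_simps add_divide_distrib diff_divide_distrib)
    also have "\<dots> = (p1 * p2 / s) * (x - y) ^ 3 * S"
      by (subst key) simp
    also have "\<dots> = - (s ^ 2 / (p1 * p2) ^ 2 * S) * (z1 - z2) ^ 3"
      unfolding xyz z using s_nonzero nz(1,2)
      by (simp add: power_divide power_mult_distrib power2_eq_square power3_eq_cube mult_ac)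
    finally show ?thesis
      by (subst omega_kernelI[OF _ assms(1)]) (simp_all add: sum dv power_mult_distrib power2_eq_square mult_ac)
  qed
qed

lemma zeta_mem:
  assumes "N \<ge> 2"
  shows "zeta N \<in> regular_outside (- 1) p"
proof (rule regular_outsideI)
  show "zeta N analytic_on {b}" if "Affine b \<noteq> p" for b
    unfolding zeta_def[abs_def] using that dv_nonzero
    by (intro analytic_on_divide analytic_on_power analytic_v analytic_dv) auto
  show "regular_at (- 1) Infinity (zeta N)" if "p \<noteq> Infinity"
  proof -
    from that obtain a where a: "p = Affine a" by (cases p) auto
    show ?thesis
    proof (rule regular_atI)
      show "(\<lambda>t. (s * t / (1 - a * t) + r) ^ (N + 1) * (1 - a * t) ^ 2 / s) analytic_on {0}"
        using s_nonzero by (intro analytic_intros) auto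
      show "\<forall>\<^sub>F t in at 0. zeta N (chart Infinity t) * chart_jacobian Infinity t powi (- 1)
          = (s * t / (1 - a * t) + r) ^ (N + 1) * (1 - a * t) ^ 2 / s"
        using eventually_nonzero_at eventually_denominator[of a]
      proof eventually_elim
        case (elim t)
        then have "1 / t - a = (1 - a * t) / t" by (simp add: field_simps)
        then have "v (1 / t) = s * t / (1 - a * t) + r" "dv (1 / t) = - s * t ^ 2 / (1 - a * t) ^ 2"
          unfolding v_def dv_def by (simp_all add: a power_divide)
        with elim show ?case
          by (simp add: zeta_def chart_def chart_jacobian_def power_int_minus del: power_Suc)
      qed
    qed
  qed
  have local: "local_coeff (- 1) p (zeta N) t = (s / t + r) ^ (N + 1) / (- s / t ^ 2)" if "t \<noteq> 0" for t
  proof -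
    have "local_coeff (- 1) p (zeta N) t = (s / t + r) ^ (N + 1) / (dv (chart p t) * chart_jacobian p t)"
      using that by (simp add: local_coeff_eq zeta_def v_chart power_int_minus divide_inverse del: power_Suc)
    then show ?thesis by (simp only: dv_chart[OF that])
  qed
  have "(\<lambda>t. (s / t + r) ^ (N + 1) / (- s / t ^ 2)) meromorphic_on {0}"
    by (intro meromorphic_intros)
  moreover have "\<forall>\<^sub>F t in at 0. local_coeff (- 1) p (zeta N) t = (s / t + r) ^ (N + 1) / (- s / t ^ 2)"
    using eventually_nonzero_at by eventually_elim (rule local)
  ultimately show "local_coeff (- 1) p (zeta N) meromorphic_on {0}"
    using meromorphic_on_cong[of "{0}" "local_coeff (- 1) p (zeta N)" _ "{0}"] by simp
  show "zeta N a = 0 \<and> (zeta N \<midarrow>a\<rightarrow> 0 \<or> (\<forall>c. \<not> zeta N \<midarrow>a\<rightarrow> c))" if a: "p = Affine a" for a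
  proof
    show "zeta N a = 0" unfolding zeta_def dv_def by (simp add: a)
    have False if "zeta N \<midarrow>a\<rightarrow> c" for c
    proof -
      have "(\<lambda>t. zeta N (a + t)) \<midarrow>0\<rightarrow> c" using that by (rule LIM_offset_zero)
      then have "(\<lambda>t. zeta N (a + t) * t ^ (N - 1)) \<midarrow>0\<rightarrow> c * 0 ^ (N - 1)" by (intro tendsto_intros)
      then have "(\<lambda>t. - ((s + r * t) ^ (N + 1)) / s) \<midarrow>0\<rightarrow> c * 0 ^ (N - 1)"
      proof (rule Lim_transform_eventually)
        show "\<forall>\<^sub>F t in at 0. zeta N (a + t) * t ^ (N - 1) = - ((s + r * t) ^ (N + 1)) / s"
          using eventually_nonzero_at
        proof eventually_elim
          case (elim t)
          have "t ^ (N + 1) = t ^ (N - 1) * t ^ 2" using assms by (simp flip: power_add del: power_Suc)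
          moreover have "s / t + r = (s + r * t) / t" using elim by (simp add: field_simps)
          ultimately show ?case
            unfolding zeta_def v_def dv_def using elim s_nonzero
            by (simp add: a power_divide del: power_Suc)
        qed
      qed
      moreover have "(\<lambda>t. - ((s + r * t) ^ (N + 1)) / s) \<midarrow>0\<rightarrow> - ((s + r * 0) ^ (N + 1)) / s"
        using s_nonzero by (intro tendsto_intros)
      ultimately have "c * 0 ^ (N - 1) = - ((s + r * 0) ^ (N + 1)) / s" by (rule LIM_unique)
      with assms s_nonzero show False by (simp add: power_0_left)
    qed
    then show "zeta N \<midarrow>a\<rightarrow> 0 \<or> (\<forall>c. \<not> zeta N \<midarrow>a\<rightarrow> c)" by blast
  qed
qed

text \<open>
  The bidifferential created by \<open>- u\<^sup>n\<^sup>+\<^sup>1 d/du\<close>. For \<open>n \<ge> - 1\<close> every summand contains the factor \<open>e 0\<close>,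
  so it vanishes, as it should for a field regular at \<open>p\<close>.
\<close>
definition omega_mode :: "int \<Rightarrow> multidiff" where
  "omega_mode n = cscale (- 1 / 2) (\<Sum>a\<le>nat (- n). sym_prod [e a, e (nat (- n) - a)])"

lemma sym_prod_pair_mem_sym_power:
  "\<alpha> \<in> K_space p \<Longrightarrow> \<beta> \<in> K_space p \<Longrightarrow> sym_prod [\<alpha>, \<beta>] \<in> sym_power 2 (K_space p)"
  unfolding sym_power_def by (intro multidiff.span_base image_eqI[OF refl]) simp

lemma omega_mode_mem_sym_power: "omega_mode n \<in> sym_power 2 (K_space p)"
  unfolding omega_mode_def sym_power_def
  by (intro multidiff.span_scale multidiff.span_sum)
    (simp add: sym_prod_pair_mem_sym_power[unfolded sym_power_def] e_mem del: sym_prod_Cons)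

lemma sym_power_subset: "sym_power k (K_space p) \<subseteq> sym_alg (K_space p)"
  unfolding sym_power_def sym_alg_def by (intro multidiff.span_mono) auto

lemma sum_fun_apply: "(\<Sum>i\<in>I. F i) zs = (\<Sum>i\<in>I. F i zs :: complex)"
  by (induction I rule: infinite_finite_induct) (simp_all add: plus_fun_apply zero_fun_apply)

lemma omega_mode_value:
  "omega_mode n [z1, z2] = - (1 / 2) * (\<Sum>a\<le>nat (- n). e a z1 * e (nat (- n) - a) z2)"
proof -
  let ?N = "nat (- n)"
  have "(\<Sum>a\<le>?N. e a z2 * e (?N - a) z1) = (\<Sum>a\<le>?N. e a z1 * e (?N - a) z2)"
    by (rule sum.reindex_bij_witness[of _ "\<lambda>a. ?N - a" "\<lambda>a. ?N - a"]) auto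
  then show ?thesis
    by (simp add: omega_mode_def cscale_def sum_fun_apply sym_prod_pair sum.distrib
        del: sym_prod_Cons flip: sum_divide_distrib)
qed

text \<open>
  A form \<open>P(v) dv\<close> with infinitely many zeros is 0, since \<open>P\<close> has finitely many roots.
\<close>
lemma K_space_eq_zero:
  assumes "\<alpha> \<in> K_space p" "finite S" "\<And>z. z \<notin> S \<Longrightarrow> Affine z \<noteq> p \<Longrightarrow> \<alpha> z = 0"
  shows "\<alpha> z = 0"
proof -
  from assms(1) obtain P where P: "\<alpha> = form P" by (rule K_spaceE)
  have "P = 0"
  proof (rule ccontr)
    assume "P \<noteq> 0"
    then have "finite {x. poly P x = 0}" by (rule poly_roots_finite)
    moreover have "finite (insert r (v ` S))" using assms(2) by simp
    ultimately obtain x where x: "x \<notin> {x. poly P x = 0} \<union> insert r (v ` S)"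
      by (metis ex_new_if_finite finite_Un infinite_UNIV_char_0)
    define z where "z = chart p (s / (x - r))"
    have t: "s / (x - r) \<noteq> 0" using x s_nonzero by auto
    have "v z = x" unfolding z_def v_chart[OF t] using x s_nonzero by simp
    moreover have "Affine z \<noteq> p" using t by (auto simp: z_def chart_def split: proj_line.splits)
    ultimately have "\<alpha> z = 0" using assms(3)[of z] x by blast
    with \<open>v z = x\<close> x dv_nonzero[OF \<open>Affine z \<noteq> p\<close>] show False by (simp add: P form_def)
  qed
  then show ?thesis by (simp add: P form_def)
qed

lemma sym_power_length:
  assumes "w \<in> sym_power k (K_space p)" "length zs \<noteq> k"
  shows "w zs = 0"
  using assms(1) unfolding sym_power_def
  by (induction rule: multidiff.span_induct_alt)
    (use assms(2) in \<open>auto simp: plus_fun_apply zero_fun_apply cscale_def sym_prod_length\<close>)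

text \<open>
  The kernel formula fixes \<open>omega\<close> off the diagonal and outside \<open>p\<close> only. The values on the excluded
  set follow by fixing one point and using that the rest is a form in \<open>K_space p\<close>.
\<close>
lemma sym_power_2_eqI:
  assumes "w \<in> sym_power 2 (K_space p)" "w' \<in> sym_power 2 (K_space p)"
    and eq: "\<And>z1 z2. z1 \<noteq> z2 \<Longrightarrow> Affine z1 \<noteq> p \<Longrightarrow> Affine z2 \<noteq> p \<Longrightarrow> w [z1, z2] = w' [z1, z2]"
  shows "w = w'"
proof -
  \<comment> \<open>Written with a scalar because the closure properties of the algebra are stated for scalars.\<close>
  define d where "d = w + cscale (- 1) w'"
  have d: "d \<in> W_space p"
    unfolding d_def using assms(1,2) sym_power_subset by (intro sym_alg_add sym_alg_cscale) auto
  have d_val: "d zs = w zs - w' zs" for zs by (simp add: d_def cscale_def plus_fun_apply)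
  have d1: "d [z, y] = 0" if "Affine y \<noteq> p" for z y
    using slice_mem[OF d] by (rule K_space_eq_zero[of _ "{y}"]) (use that eq in \<open>auto simp: d_val\<close>)
  have d2: "d [z, y] = 0" for z y
  proof (cases "Affine y = p")
    case True
    have "d [z, y] = 0" if "Affine z \<noteq> p" for z
      using d1[OF that, of y] symmetricD[OF symmetric_sym_alg[OF d], of "[z, y]" "[y, z]"]
      by (simp add: add_mset_commute)
    then show ?thesis
      using K_space_eq_zero[OF slice_mem[OF d], of "{}" "[y]" z] by blast
  qed (rule d1)
  have "w zs = w' zs" for zs
  proof (cases "length zs = 2")
    case True
    then obtain z y where "zs = [z, y]" by (auto simp: length_Suc_conv numeral_2_eq_2)
    with d2[of z y] show ?thesis by (simp add: d_val)
  next
    case False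
    then show ?thesis using sym_power_length assms(1,2) by metis
  qed
  then show ?thesis by (rule ext)
qed

lemma omega_eqI:
  assumes "w \<in> sym_power 2 (K_space p)"
    and "\<And>z1 z2. z1 \<noteq> z2 \<Longrightarrow> Affine z1 \<noteq> p \<Longrightarrow> Affine z2 \<noteq> p \<Longrightarrow> omega_kernel \<xi> z1 z2 = w [z1, z2]"
  shows "omega p \<xi> = w"
  unfolding omega_def omega_kernel_def[symmetric]
proof (rule the_equality)
  show "w' = w" if "w' \<in> sym_power 2 (K_space p) \<and>
      (\<forall>z1 z2. z1 \<noteq> z2 \<longrightarrow> Affine z1 \<noteq> p \<longrightarrow> Affine z2 \<noteq> p \<longrightarrow> w' [z1, z2] = omega_kernel \<xi> z1 z2)" for w'
    using that assms by (intro sym_power_2_eqI) auto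
qed (use assms in auto)

text \<open>
  A field regular outside \<open>p\<close> with the same principal part as \<open>- u\<^sup>n\<^sup>+\<^sup>1 d/du\<close>. For \<open>n \<ge> - 1\<close>
  that field is regular at \<open>p\<close>, and the zero field serves.
\<close>
definition polar_field :: "int \<Rightarrow> complex \<Rightarrow> complex" where
  "polar_field n = (if n \<le> - 2 then zeta (nat (- n)) else (\<lambda>_. 0))"

lemma polar_field_mem: "polar_field n \<in> regular_outside (- 1) p"
proof (cases "n \<le> - 2")
  case False
  have "(\<lambda>_. 0) \<in> regular_outside (- 1) p"
    by (rule regular_outsideI)
      (auto intro: regular_at_zero regular_at_imp_meromorphic)
  with False show ?thesis by (simp add: polar_field_def)
qed (simp add: polar_field_def zeta_mem)

lemma omega_kernel_polar_field:
  assumes "z1 \<noteq> z2" "Affine z1 \<noteq> p" "Affine z2 \<noteq> p"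
  shows "omega_kernel (polar_field n) z1 z2 = omega_mode n [z1, z2]"
proof (cases "n \<le> - 2")
  case True
  then show ?thesis by (simp add: polar_field_def omega_kernel_zeta[OF assms] omega_mode_value)
next
  case False
  then have "nat (- n) = 0 \<or> nat (- n) = 1" by auto
  then have "omega_mode n [z1, z2] = 0" by (auto simp: omega_mode_value e_def)
  with False show ?thesis by (simp add: polar_field_def omega_kernel_def)
qed

lemma polar_field_principal:
  assumes \<xi>: "field_germ n \<xi>"
  shows "regular_at (- 1) p (\<xi> - polar_field n)"
proof (cases "n \<le> - 2")
  case True
  have "\<forall>\<^sub>F z in near p. (\<xi> - polar_field n) z = 0"
    using \<xi>[unfolded field_germ_def]
  proof eventually_elim
    case (elim z)
    have "1 - n = int (nat (- n) + 1)" using True by simp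
    with elim True show ?case by (simp only: polar_field_def zeta_def if_True fun_diff_def power_int_of_nat) simp
  qed
  then show ?thesis by (rule regular_at_cong[OF regular_at_zero])
next
  case False
  define m where "m = nat (n + 1)"
  have m: "n + 1 = int m" using False by (simp add: m_def)
  have "regular_at (- 1) p \<xi>"
  proof (rule regular_atI)
    show "(\<lambda>t. - (t ^ m) * (s + r * t) powi (1 - n) / s) analytic_on {0}"
      using s_nonzero by (intro analytic_intros) auto
    have "\<forall>\<^sub>F t in at 0. t \<in> chart_domain - {0}"
      using chart_domain by (auto simp: eventually_at_topological)
    then show "\<forall>\<^sub>F t in at 0. \<xi> (chart p t) * chart_jacobian p t powi (- 1) = - (t ^ m) * (s + r * t) powi (1 - n) / s"
      using \<xi>[unfolded field_germ_def eventually_near]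
    proof eventually_elim
      case (elim t)
      then have t: "t \<noteq> 0" "s + r * t \<noteq> 0" by (auto simp: chart_domain_def)
      have v: "v (chart p t) = (s + r * t) / t" using t by (simp add: v_chart field_simps)
      have "\<xi> (chart p t) * chart_jacobian p t powi (- 1)
          = v (chart p t) powi (1 - n) / (dv (chart p t) * chart_jacobian p t)"
        using elim(2) by (simp add: power_int_minus divide_inverse)
      also have "\<dots> = (s + r * t) powi (1 - n) * (t ^ 2 / t powi (1 - n)) / (- s)"
        unfolding dv_chart[OF t(1)] v by (simp add: power_int_divide_distrib)
      also have "t ^ 2 / t powi (1 - n) = t powi (2 - (1 - n))"
        by (subst power_int_diff) (use t(1) in simp_all)
      also have "2 - (1 - n) = int m" using m by simp
      finally show ?case by (simp add: mult.commute)
    qed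
  qed
  with False show ?thesis by (simp add: polar_field_def fun_diff_def)
qed

text \<open>
  Any admissible choice of a field regular outside \<open>p\<close> differs from \<open>polar_field\<close> by a globally regular
  field, which is quadratic and does not contribute to the kernel.
\<close>
lemma X_plus_vacuum_eq:
  assumes \<xi>: "field_germ n \<xi>"
  shows "X_plus_vacuum p \<xi> = omega_mode n"
proof -
  have omega: "omega p \<zeta> = omega_mode n"
    if \<zeta>: "\<zeta> \<in> regular_outside (- 1) p" and reg: "regular_at (- 1) p (\<xi> - \<zeta>)" for \<zeta>
  proof -
    define d where "d = \<zeta> - polar_field n"
    have "regular_at (- 1) q d" for q
    proof (cases "q = p")
      case True
      have "d = (\<xi> - polar_field n) - (\<xi> - \<zeta>)" by (simp add: d_def)
      with True regular_at_diff[OF polar_field_principal[OF \<xi>] reg] show ?thesis by simp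
    next
      case False
      then show ?thesis
        unfolding d_def by (intro regular_at_diff regular_outsideD(3)[OF \<zeta>] regular_outsideD(3)[OF polar_field_mem])
    qed
    moreover have "d meromorphic_on UNIV"
      using regular_outsideD(1)[OF \<zeta>] regular_outsideD(1)[OF polar_field_mem[of n]]
      unfolding d_def fun_diff_def nicely_meromorphic_on_def by (intro meromorphic_intros) auto
    ultimately obtain Q where Q: "degree Q \<le> 2" "\<And>z. d analytic_on {z} \<Longrightarrow> d z = poly Q z"
      by (metis globally_regular_field)
    have an: "\<zeta> analytic_on {z}" "polar_field n analytic_on {z}" if "Affine z \<noteq> p" for z
      using regular_outsideD(4)[OF \<zeta> that] regular_outsideD(4)[OF polar_field_mem that] by auto
    have val: "\<zeta> z = polar_field n z + poly Q z" if "Affine z \<noteq> p" for z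
    proof -
      have "d analytic_on {z}" unfolding d_def fun_diff_def by (intro analytic_on_diff an that)
      from Q(2)[OF this] show ?thesis by (simp add: d_def algebra_simps)
    qed
    have der: "deriv \<zeta> z = deriv (polar_field n) z + poly (pderiv Q) z" if "Affine z \<noteq> p" for z
    proof -
      have "polar_field n field_differentiable at z"
        using an(2)[OF that] by (rule analytic_on_imp_differentiable_at) simp
      from DERIV_add[OF field_differentiable_derivI[OF this] poly_DERIV[of Q]]
      have "deriv (\<lambda>y. polar_field n y + poly Q y) z = deriv (polar_field n) z + poly (pderiv Q) z"
        by (rule DERIV_imp_deriv)
      moreover have "deriv \<zeta> z = deriv (\<lambda>y. polar_field n y + poly Q y) z"
        using eventually_off_p[OF that] by (intro deriv_cong_ev) (auto elim!: eventually_mono intro: val)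
      ultimately show ?thesis by simp
    qed
    show ?thesis
    proof (rule omega_eqI[OF omega_mode_mem_sym_power])
      fix z1 z2 assume z: "z1 \<noteq> z2" "Affine z1 \<noteq> p" "Affine z2 \<noteq> p"
      have "omega_kernel \<zeta> z1 z2 = omega_kernel (polar_field n) z1 z2"
        by (rule omega_kernel_quadratic[OF Q(1)]) (simp_all add: val der z)
      then show "omega_kernel \<zeta> z1 z2 = omega_mode n [z1, z2]"
        by (simp add: omega_kernel_polar_field[OF z])
    qed
  qed
  show ?thesis
    unfolding X_plus_vacuum_def
  proof (rule the_equality)
    show "\<exists>\<zeta>\<in>regular_outside (- 1) p. regular_at (- 1) p (\<xi> - \<zeta>) \<and> omega_mode n = omega p \<zeta>"
      using polar_field_mem polar_field_principal[OF \<xi>] omega by (metis (no_types))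
    show "w = omega_mode n" if "\<exists>\<zeta>\<in>regular_outside (- 1) p. regular_at (- 1) p (\<xi> - \<zeta>) \<and> w = omega p \<zeta>" for w
      using that omega by blast
  qed
qed

lemma X_plus_eq:
  assumes "field_germ n \<xi>" "F \<in> W_space p"
  shows "X_plus p \<xi> F = cscale (- 1 / 2) (\<Sum>a\<le>nat (- n). degree_one (e a) \<otimes>\<^sub>s (degree_one (e (nat (- n) - a)) \<otimes>\<^sub>s F))"
proof -
  have sum: "(\<Sum>a\<in>A. G a) \<otimes>\<^sub>s F = (\<Sum>a\<in>A. G a \<otimes>\<^sub>s F)" for A :: "nat set" and G
    by (induction A rule: infinite_finite_induct) (simp_all add: sym_mult_add_left)
  show ?thesis
    by (simp only: X_plus_def X_plus_vacuum_eq[OF assms(1)] omega_mode_def sym_mult_cscale_left sum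
        sym_mult_sym_prod[OF assms(2)])
qed

end

section \<open>The contraction part of the operators\<close>

text \<open>
  Signs are kept inside scalars, where the rules for \<open>cscale\<close> can combine them.
\<close>
declare multidiff.scale_minus_left [simp del]

lemma nths_minus_singleton: "nths xs (- {j}) = remove_nth j xs"
proof (induction xs arbitrary: j)
  case (Cons x xs)
  show ?case
  proof (cases j)
    case 0
    then have "{i. Suc i \<in> - {j}} = UNIV" by auto
    with 0 show ?thesis by (simp add: nths_Cons nths_all)
  next
    case (Suc i)
    then have "{i. Suc i \<in> - {j}} = - {i}" by auto
    with Suc Cons.IH show ?thesis by (simp add: nths_Cons)
  qed
qed (simp add: remove_nth_def)

lemma nths_Cons_minus_pair:
  "nths (x # xs) (- {0, Suc j}) = remove_nth j xs"
  "nths (x # xs) (- {Suc i, Suc j}) = x # nths xs (- {i, j})"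
proof -
  have "{k. Suc k \<in> - {0, Suc j}} = - {j}" by auto
  then show "nths (x # xs) (- {0, Suc j}) = remove_nth j xs"
    by (simp add: nths_Cons nths_minus_singleton)
  have "{k. Suc k \<in> - {Suc i, Suc j}} = - {i, j}" by auto
  then show "nths (x # xs) (- {Suc i, Suc j}) = x # nths xs (- {i, j})"
    by (simp add: nths_Cons)
qed

lemma add_self: "F + F = cscale 2 F"
  by (simp add: fun_eq_iff cscale_def plus_fun_apply)

lemma sym_mult_sum_right: "F \<otimes>\<^sub>s (\<Sum>i\<in>I. G i) = (\<Sum>i\<in>I. F \<otimes>\<^sub>s G i)"
  by (induction I rule: infinite_finite_induct) (simp_all add: sym_mult_add_right)

lemma cscale_sum: "cscale c (\<Sum>i\<in>I. G i) = (\<Sum>i\<in>I. cscale c (G i))"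
  by (induction I rule: infinite_finite_induct) (simp_all add: cscale_add_right)

lemma cscale_sum_left: "cscale (\<Sum>i\<in>I. c i) F = (\<Sum>i\<in>I. cscale (c i) F)"
  by (induction I rule: infinite_finite_induct) (simp_all add: cscale_add_left)

lemma degree_one_sum_sym_mult:
  "degree_one (\<lambda>z. \<Sum>i\<in>I. c i * \<alpha> i z) \<otimes>\<^sub>s F = (\<Sum>i\<in>I. cscale (c i) (degree_one (\<alpha> i) \<otimes>\<^sub>s F))"
  by (induction I rule: infinite_finite_induct)
    (simp_all add: degree_one_add degree_one_scale degree_one_zero sym_mult_add_left sym_mult_cscale_left)

context function_space
begin

lemma contract_sum:
  assumes "functional \<nu>" "\<And>i. i \<in> I \<Longrightarrow> G i \<in> sym_alg V"
  shows "contract \<nu> (\<Sum>i\<in>I. G i) = (\<Sum>i\<in>I. contract \<nu> (G i))"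
  using assms(2)
  by (induction I rule: infinite_finite_induct)
    (simp_all add: contract_add contract_zero sym_alg_sum assms(1))

lemma contract_sym_prod:
  assumes "functional \<nu>" "\<alpha>s \<in> lists V"
  shows "contract \<nu> (sym_prod \<alpha>s) = (\<Sum>j<length \<alpha>s. cscale (\<nu> (\<alpha>s ! j)) (sym_prod (remove_nth j \<alpha>s)))"
  using assms(2)
proof (induction \<alpha>s)
  case (Cons \<alpha> \<alpha>s)
  then show ?case
    by (simp add: contract_degree_one[OF assms(1)] sym_prod_mem sum.lessThan_Suc_shift sym_mult_sum_right
        sym_mult_cscale_right del: sum.lessThan_Suc)
qed (simp add: contract_vacuum[OF assms(1)])

end

context pole_coordinate
begin

text \<open>
  \<open>X_minus\<close> written with contractions by moments. In this form it is linear by construction, so the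
  prescription by values on products is consistent.
\<close>
definition minus_op :: "int \<Rightarrow> multidiff \<Rightarrow> multidiff" where
  "minus_op n F = cscale (- (1 / 2)) (\<Sum>i\<in>{1..<nat n}. contract (moment i) (contract (moment (nat n - i)) F))"

lemmas contract_moment_simps =
  contract_vacuum[OF functional_moment] contract_zero[OF functional_moment] contract_add[OF functional_moment]
  contract_cscale[OF functional_moment] contract_degree_one[OF functional_moment] contract_mem[OF functional_moment]

lemma minus_op_add: "F \<in> W_space p \<Longrightarrow> G \<in> W_space p \<Longrightarrow> minus_op n (F + G) = minus_op n F + minus_op n G"
  by (simp add: minus_op_def contract_moment_simps sum.distrib cscale_add_right)

lemma minus_op_cscale: "F \<in> W_space p \<Longrightarrow> minus_op n (cscale c F) = cscale c (minus_op n F)"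
  by (simp add: minus_op_def contract_moment_simps mult.commute flip: cscale_sum)

lemma minus_op_vacuum: "minus_op n vacuum = 0"
  by (simp add: minus_op_def contract_moment_simps)

lemma minus_op_mem: "F \<in> W_space p \<Longrightarrow> minus_op n F \<in> W_space p"
  unfolding minus_op_def by (intro sym_alg_cscale sym_alg_sum contract_moment_simps)

text \<open>
  A product of two commuting derivations obeys the second-order Leibniz rule; the two cross terms
  become equal after summation, since \<open>i\<close> and \<open>n - i\<close> run through the same values.
\<close>
lemma minus_op_degree_one:
  assumes "\<alpha> \<in> K_space p" "F \<in> W_space p"
  shows "minus_op n (degree_one \<alpha> \<otimes>\<^sub>s F) = degree_one \<alpha> \<otimes>\<^sub>s minus_op n F
       + (\<Sum>i\<in>{1..<nat n}. cscale (- moment i \<alpha>) (contract (moment (nat n - i)) F))"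
proof -
  let ?N = "nat n"
  let ?c = "\<lambda>i. cscale (moment i \<alpha>) (contract (moment (?N - i)) F)"
  have "(\<Sum>i\<in>{1..<?N}. contract (moment i) (contract (moment (?N - i)) (degree_one \<alpha> \<otimes>\<^sub>s F)))
      = (\<Sum>i\<in>{1..<?N}. ?c (?N - i)) + (\<Sum>i\<in>{1..<?N}. ?c i)
        + (\<Sum>i\<in>{1..<?N}. degree_one \<alpha> \<otimes>\<^sub>s contract (moment i) (contract (moment (?N - i)) F))"
    unfolding sum.distrib[symmetric]
    by (intro sum.cong refl)
      (simp add: assms contract_moment_simps degree_one_mem sym_alg_cscale add.assoc)
  also have "(\<Sum>i\<in>{1..<?N}. ?c (?N - i)) = (\<Sum>i\<in>{1..<?N}. ?c i)"
    by (rule sum.reindex_bij_witness[of _ "\<lambda>i. ?N - i" "\<lambda>i. ?N - i"]) auto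
  finally have "(\<Sum>i\<in>{1..<?N}. contract (moment i) (contract (moment (?N - i)) (degree_one \<alpha> \<otimes>\<^sub>s F)))
      = cscale 2 (\<Sum>i\<in>{1..<?N}. ?c i)
        + degree_one \<alpha> \<otimes>\<^sub>s (\<Sum>i\<in>{1..<?N}. contract (moment i) (contract (moment (?N - i)) F))"
    by (simp only: sym_mult_sum_right add_self)
  then have "minus_op n (degree_one \<alpha> \<otimes>\<^sub>s F)
      = cscale (- 1) (\<Sum>i\<in>{1..<?N}. ?c i) + degree_one \<alpha> \<otimes>\<^sub>s minus_op n F"
    by (simp only: minus_op_def cscale_add_right cscale_simps sym_mult_cscale_right) simp
  also have "cscale (- 1) (\<Sum>i\<in>{1..<?N}. ?c i) = (\<Sum>i\<in>{1..<?N}. cscale (- moment i \<alpha>) (contract (moment (?N - i)) F))"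
    unfolding cscale_sum by (intro sum.cong refl) (simp only: cscale_simps mult_minus1)
  finally show ?thesis by (simp only: add.commute)
qed

text \<open>
  Splitting off the first factor of a product, the pairs that contain it give the sum over \<open>i\<close> in
  \<open>minus_op_degree_one\<close> because of \<open>residue_pairing\<close>, and the other pairs give the induction hypothesis.
\<close>
lemma X_minus_eq:
  assumes \<xi>: "field_germ n \<xi>" and "F \<in> W_space p"
  shows "X_minus p \<xi> F = minus_op n F"
  unfolding X_minus_def
proof (rule linear_ext_eq[OF _ _ assms(2)])
  show "linear_on_sym_alg (K_space p) (minus_op n)"
    by (intro linear_on_sym_algI minus_op_add minus_op_cscale)
  let ?res = "\<lambda>\<alpha> \<beta>. residue_at p (\<lambda>z. (\<xi> z * \<alpha> z) * \<beta> z)"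
  let ?\<phi> = "\<lambda>\<alpha>s. \<Sum>j<length \<alpha>s. \<Sum>i<j. cscale (?res (\<alpha>s ! i) (\<alpha>s ! j)) (sym_prod (nths \<alpha>s (- {i, j})))"
  show "minus_op n (sym_prod \<alpha>s) = ?\<phi> \<alpha>s" if "\<alpha>s \<in> lists (K_space p)" for \<alpha>s
    using that
  proof (induction \<alpha>s)
    case Nil
    then show ?case by (simp add: minus_op_vacuum)
  next
    case (Cons \<alpha> \<alpha>s)
    then have \<alpha>: "\<alpha> \<in> K_space p" and \<alpha>s: "\<alpha>s \<in> lists (K_space p)" by auto
    have nth: "\<alpha>s ! j \<in> K_space p" if "j < length \<alpha>s" for j using \<alpha>s that by (auto simp: in_lists_conv_set)
    have "(\<Sum>i\<in>{1..<nat n}. cscale (- moment i \<alpha>) (contract (moment (nat n - i)) (sym_prod \<alpha>s)))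
        = (\<Sum>i\<in>{1..<nat n}. \<Sum>j<length \<alpha>s.
            cscale (- (moment i \<alpha> * moment (nat n - i) (\<alpha>s ! j))) (sym_prod (remove_nth j \<alpha>s)))"
      by (simp only: contract_sym_prod[OF functional_moment \<alpha>s] cscale_sum cscale_simps mult_minus_left)
    also have "\<dots> = (\<Sum>j<length \<alpha>s. cscale (?res \<alpha> (\<alpha>s ! j)) (sym_prod (remove_nth j \<alpha>s)))"
      by (subst sum.swap) (intro sum.cong refl,
        simp only: residue_pairing[OF \<xi> \<alpha> nth] lessThan_iff cscale_sum_left sum_negf[symmetric])
    finally have pairs: "(\<Sum>i\<in>{1..<nat n}. cscale (- moment i \<alpha>) (contract (moment (nat n - i)) (sym_prod \<alpha>s)))
        = (\<Sum>j<length \<alpha>s. cscale (?res \<alpha> (\<alpha>s ! j)) (sym_prod (remove_nth j \<alpha>s)))" .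
    have "?\<phi> (\<alpha> # \<alpha>s) = (\<Sum>j<length \<alpha>s. cscale (?res \<alpha> (\<alpha>s ! j)) (sym_prod (remove_nth j \<alpha>s))
        + (\<Sum>i<j. degree_one \<alpha> \<otimes>\<^sub>s cscale (?res (\<alpha>s ! i) (\<alpha>s ! j)) (sym_prod (nths \<alpha>s (- {i, j})))))"
      by (simp add: sum.lessThan_Suc_shift nths_Cons_minus_pair sym_mult_cscale_right del: sum.lessThan_Suc)
    also have "\<dots> = (\<Sum>j<length \<alpha>s. cscale (?res \<alpha> (\<alpha>s ! j)) (sym_prod (remove_nth j \<alpha>s))) + degree_one \<alpha> \<otimes>\<^sub>s ?\<phi> \<alpha>s"
      by (simp add: sum.distrib sym_mult_sum_right)
    finally show ?case
      by (simp only: sym_prod_Cons minus_op_degree_one[OF \<alpha> sym_prod_mem[OF \<alpha>s]] pairs Cons.IH add.commute)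
  qed
qed

section \<open>The Lie derivative part of the operators\<close>

text \<open>
  The derivation \<open>\<Sum>\<^sub>k (D (e k)) \<partial>/\<partial>(e k)\<close> extending \<open>D (e k) = k e (k - n)\<close>; contraction with the \<open>k\<close>-th
  moment is \<open>- k \<partial>/\<partial>(e k)\<close>. Infinitely many \<open>k\<close> occur, but only finitely many act on a given element.
\<close>
definition zero_op :: "int \<Rightarrow> multidiff \<Rightarrow> multidiff" where
  "zero_op n F = (\<Sum>k | contract (moment k) F \<noteq> 0.
     cscale (- 1) (degree_one (e (nat (int k - n))) \<otimes>\<^sub>s contract (moment k) F))"

lemma finite_moment: "\<alpha> \<in> K_space p \<Longrightarrow> finite {k. moment k \<alpha> \<noteq> 0}"
proof (erule K_spaceE)
  fix P assume "\<alpha> = form P"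
  then have "{k. moment k \<alpha> \<noteq> 0} \<subseteq> {..Suc (degree P)}"
    by (auto simp: moment_form dest: le_degree split: if_splits)
  then show ?thesis by (rule finite_subset) simp
qed

lemma finite_contract: "F \<in> W_space p \<Longrightarrow> finite {k. contract (moment k) F \<noteq> 0}"
proof (induction rule: sym_alg_induct)
  case (mult \<alpha> F)
  have "{k. contract (moment k) (degree_one \<alpha> \<otimes>\<^sub>s F) \<noteq> 0} \<subseteq> {k. moment k \<alpha> \<noteq> 0} \<union> {k. contract (moment k) F \<noteq> 0}"
    using mult by (auto simp: contract_moment_simps)
  then show ?case by (rule finite_subset) (use mult finite_moment in simp)
next
  case (add F G)
  have "{k. contract (moment k) (F + G) \<noteq> 0} \<subseteq> {k. contract (moment k) F \<noteq> 0} \<union> {k. contract (moment k) G \<noteq> 0}"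
    using add by (auto simp: contract_moment_simps)
  then show ?case by (rule finite_subset) (use add in simp)
next
  case (cscale c F)
  have "{k. contract (moment k) (cscale c F) \<noteq> 0} \<subseteq> {k. contract (moment k) F \<noteq> 0}"
    using cscale by (auto simp: contract_moment_simps)
  then show ?case by (rule finite_subset) (use cscale in simp)
qed (simp add: contract_moment_simps)

lemma zero_op_eq_sum:
  assumes "finite A" "{k. contract (moment k) F \<noteq> 0} \<subseteq> A"
  shows "zero_op n F = (\<Sum>k\<in>A. cscale (- 1) (degree_one (e (nat (int k - n))) \<otimes>\<^sub>s contract (moment k) F))"
  unfolding zero_op_def by (rule sum.mono_neutral_left) (use assms in auto)

lemma zero_op_add:
  assumes "F \<in> W_space p" "G \<in> W_space p"
  shows "zero_op n (F + G) = zero_op n F + zero_op n G"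
proof -
  let ?A = "{k. contract (moment k) F \<noteq> 0} \<union> {k. contract (moment k) G \<noteq> 0}"
  have fin: "finite ?A" using assms finite_contract by simp
  have "{k. contract (moment k) (F + G) \<noteq> 0} \<subseteq> ?A" using assms by (auto simp: contract_moment_simps)
  with fin show ?thesis
    by (simp add: zero_op_eq_sum[of ?A] assms contract_moment_simps sym_mult_add_right cscale_add_right sum.distrib)
qed

lemma zero_op_cscale:
  assumes "F \<in> W_space p"
  shows "zero_op n (cscale c F) = cscale c (zero_op n F)"
proof -
  let ?A = "{k. contract (moment k) F \<noteq> 0}"
  have fin: "finite ?A" using assms finite_contract by simp
  have "{k. contract (moment k) (cscale c F) \<noteq> 0} \<subseteq> ?A" using assms by (auto simp: contract_moment_simps)
  with fin show ?thesis
    by (simp add: zero_op_eq_sum[of ?A] assms contract_moment_simps sym_mult_cscale_right cscale_sum)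
qed

lemma zero_op_vacuum: "zero_op n vacuum = 0"
  by (simp add: zero_op_def contract_moment_simps)

lemma zero_op_mem: "F \<in> W_space p \<Longrightarrow> zero_op n F \<in> W_space p"
  by (subst zero_op_eq_sum[OF finite_contract order_refl])
    (auto intro!: sym_alg_sum sym_alg_cscale degree_one_mem e_mem contract_moment_simps)

lemma zero_op_degree_one:
  assumes "\<alpha> \<in> K_space p" "F \<in> W_space p" "finite A" "{k. moment k \<alpha> \<noteq> 0} \<subseteq> A"
  shows "zero_op n (degree_one \<alpha> \<otimes>\<^sub>s F) = degree_one \<alpha> \<otimes>\<^sub>s zero_op n F
       + (\<Sum>k\<in>A. cscale (- moment k \<alpha>) (degree_one (e (nat (int k - n))) \<otimes>\<^sub>s F))"
proof -
  let ?B = "A \<union> {k. contract (moment k) F \<noteq> 0}"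
  let ?E = "\<lambda>k. degree_one (e (nat (int k - n)))"
  have fin: "finite ?B" using assms finite_contract by simp
  have "{k. contract (moment k) (degree_one \<alpha> \<otimes>\<^sub>s F) \<noteq> 0} \<subseteq> ?B"
    using assms by (auto simp: contract_moment_simps)
  with fin have "zero_op n (degree_one \<alpha> \<otimes>\<^sub>s F)
      = (\<Sum>k\<in>?B. cscale (- moment k \<alpha>) (?E k \<otimes>\<^sub>s F) + degree_one \<alpha> \<otimes>\<^sub>s cscale (- 1) (?E k \<otimes>\<^sub>s contract (moment k) F))"
    by (subst zero_op_eq_sum[of ?B])
      (auto simp: assms contract_moment_simps sym_mult_add_right cscale_add_right sym_mult_cscale_right
        sym_mult_left_commute[of "?E _"] intro!: sum.cong)
  also have "\<dots> = (\<Sum>k\<in>?B. cscale (- moment k \<alpha>) (?E k \<otimes>\<^sub>s F)) + degree_one \<alpha> \<otimes>\<^sub>s zero_op n F"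
    using fin by (simp add: zero_op_eq_sum[of ?B F] sum.distrib sym_mult_sum_right)
  also have "(\<Sum>k\<in>?B. cscale (- moment k \<alpha>) (?E k \<otimes>\<^sub>s F)) = (\<Sum>k\<in>A. cscale (- moment k \<alpha>) (?E k \<otimes>\<^sub>s F))"
    using fin assms(4) by (intro sum.mono_neutral_right) auto
  finally show ?thesis by (simp only: add.commute)
qed

lemma X_zero_eq:
  assumes \<xi>: "field_germ n \<xi>" and "F \<in> W_space p"
  shows "X_zero p \<xi> F = zero_op n F"
  unfolding X_zero_def
proof (rule linear_ext_eq[OF _ _ assms(2)])
  show "linear_on_sym_alg (K_space p) (zero_op n)"
    by (intro linear_on_sym_algI zero_op_add zero_op_cscale)
  let ?D = "\<lambda>\<alpha>. second_kind_proj p (lie_deriv \<xi> \<alpha>)"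
  show "zero_op n (sym_prod \<alpha>s) = (\<Sum>i<length \<alpha>s. sym_prod (\<alpha>s[i := ?D (\<alpha>s ! i)]))"
    if "\<alpha>s \<in> lists (K_space p)" for \<alpha>s
    using that
  proof (induction \<alpha>s)
    case Nil
    then show ?case by (simp add: zero_op_vacuum)
  next
    case (Cons \<alpha> \<alpha>s)
    then have \<alpha>: "\<alpha> \<in> K_space p" and \<alpha>s: "\<alpha>s \<in> lists (K_space p)" by auto
    from \<alpha> obtain P where P: "\<alpha> = form P" by (rule K_spaceE)
    have A: "{k. moment k \<alpha> \<noteq> 0} \<subseteq> Suc ` {..degree P}"
    proof
      fix k assume "k \<in> {k. moment k \<alpha> \<noteq> 0}"
      then have "k = Suc (k - 1)" "k - 1 \<le> degree P"
        by (auto simp: P moment_form intro: le_degree split: if_splits)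
      then show "k \<in> Suc ` {..degree P}" by blast
    qed
    have "degree_one (?D \<alpha>) \<otimes>\<^sub>s sym_prod \<alpha>s
        = (\<Sum>i\<le>degree P. cscale (coeff P i) (degree_one (e (nat (int i + 1 - n))) \<otimes>\<^sub>s sym_prod \<alpha>s))"
      by (simp only: P second_kind_proj_form[OF \<xi>] degree_one_sum_sym_mult)
    also have "\<dots> = (\<Sum>k\<in>Suc ` {..degree P}. cscale (- moment k \<alpha>) (degree_one (e (nat (int k - n))) \<otimes>\<^sub>s sym_prod \<alpha>s))"
      by (simp add: sum.reindex P moment_form add.commute)
    finally show ?case
      by (simp add: zero_op_degree_one[OF \<alpha> sym_prod_mem[OF \<alpha>s] _ A] Cons.IH
          sum.lessThan_Suc_shift sym_mult_sum_right del: sum.lessThan_Suc)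
  qed
qed

end

section \<open>Heisenberg and Virasoro relations\<close>

lemma sym_mult_Nil: "(F \<otimes>\<^sub>s G) [] = F [] * G []"
  by (simp add: sym_mult_def)

lemma degree_one_sym_mult_Nil: "(degree_one \<alpha> \<otimes>\<^sub>s F) [] = 0"
  by (simp add: sym_mult_Nil degree_one_def)

lemma sum_products: "(\<Sum>a\<le>N. of_nat a * of_nat (N - a)) = (of_nat N ^ 3 - of_nat N) / (6 :: complex)"
proof -
  have lin: "(\<Sum>a\<le>N. of_nat a) = of_nat N * (of_nat N + 1) / (2 :: complex)" for N
    by (induction N) (simp_all add: field_simps)
  show ?thesis
  proof (induction N)
    case (Suc N)
    have "(\<Sum>a\<le>N. of_nat a * of_nat (Suc N - a)) = (\<Sum>a\<le>N. of_nat a * of_nat (N - a) + of_nat a :: complex)"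
      by (rule sum.cong) (simp_all add: Suc_diff_le algebra_simps)
    also have "\<dots> = (of_nat N ^ 3 - of_nat N) / 6 + of_nat N * (of_nat N + 1) / 2"
      unfolding sum.distrib Suc lin ..
    also have "\<dots> = (of_nat (Suc N) ^ 3 - of_nat (Suc N)) / 6"
      by (simp add: power3_eq_cube field_simps)
    finally show ?case by simp
  qed simp
qed

context pole_coordinate
begin

text \<open>
  Oscillators: multiplication by \<open>e (- j)\<close> for \<open>j < 0\<close>, and for \<open>j \<ge> 0\<close> contraction with the residue of
  \<open>u\<^sup>j \<alpha>\<close>. With this normalisation the relations for all signs of the indices take one form.
\<close>
definition mode :: "int \<Rightarrow> multidiff \<Rightarrow> multidiff" where
  "mode j F = (if j < 0 then degree_one (e (nat (- j))) \<otimes>\<^sub>s F else contract (moment (nat j)) F)"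

lemma mode_mem: "F \<in> W_space p \<Longrightarrow> mode j F \<in> W_space p"
  by (simp add: mode_def degree_one_mem e_mem contract_moment_simps)

lemma mode_add: "F \<in> W_space p \<Longrightarrow> G \<in> W_space p \<Longrightarrow> mode j (F + G) = mode j F + mode j G"
  by (simp add: mode_def sym_mult_add_right contract_moment_simps)

lemma mode_cscale: "F \<in> W_space p \<Longrightarrow> mode j (cscale c F) = cscale c (mode j F)"
  by (simp add: mode_def sym_mult_cscale_right contract_moment_simps)

lemma mode_0: "F \<in> W_space p \<Longrightarrow> mode 0 F = 0"
proof (induction rule: sym_alg_induct)
  case (mult \<alpha> F)
  then show ?case by (simp add: mode_def contract_moment_simps moment_0)
qed (simp_all add: mode_add mode_cscale, simp add: mode_def contract_moment_simps)

lemma mode_vacuum: "0 \<le> j \<Longrightarrow> mode j vacuum = 0"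
  by (simp add: mode_def contract_moment_simps)

lemma degree_one_e_0: "degree_one (e 0) = 0"
  by (simp add: e_0 degree_one_zero)

lemma heisenberg_relation:
  assumes "F \<in> W_space p"
  shows "mode i (mode j F) = mode j (mode i F) + cscale (if i + j = 0 then - of_int i else 0) F"
proof -
  have mixed: "contract (moment (nat k)) (degree_one (e (nat (- j))) \<otimes>\<^sub>s F)
      = degree_one (e (nat (- j))) \<otimes>\<^sub>s contract (moment (nat k)) F + cscale (if k + j = 0 then - of_int k else 0) F"
    if "k \<ge> 0" "j < 0" for k j :: int
  proof (cases "k + j = 0")
    case True
    then have "k = - j" by simp
    with that assms show ?thesis by (simp add: contract_moment_simps e_mem moment_e add.commute)
  next
    case False
    then have "nat k \<noteq> nat (- j)" using that by simp
    with False assms show ?thesis by (simp add: contract_moment_simps e_mem moment_e)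
  qed
  show ?thesis
  proof (cases "i < 0"; cases "j < 0")
    assume "i < 0" "j < 0"
    then show ?thesis by (simp add: mode_def sym_mult_left_commute[of "degree_one (e (nat (- i)))"])
  next
    assume "\<not> i < 0" "\<not> j < 0"
    then show ?thesis
      using contract_commute[OF functional_moment functional_moment assms] by (auto simp: mode_def)
  next
    assume "\<not> i < 0" "j < 0"
    then show ?thesis using mixed[of i j] by (simp add: mode_def)
  next
    assume "i < 0" "\<not> j < 0"
    moreover have "cscale (if j + i = 0 then - of_int j else 0) F + cscale (if i + j = 0 then - of_int i else 0) F = 0"
      by (auto simp: eq_neg_iff_add_eq_0[symmetric] simp flip: cscale_add_left)
    ultimately show ?thesis using mixed[of j i] by (simp add: mode_def add.assoc)
  qed
qed

text \<open>
  The forms \<open>e k\<close> span \<open>K_space p\<close>, so the vacuum and the creating oscillators generate the algebra.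
\<close>
lemma mode_induct [consumes 1, case_names vacuum create add cscale]:
  assumes "F \<in> W_space p"
    and vac: "P vacuum"
    and create: "\<And>k F. 0 < k \<Longrightarrow> F \<in> W_space p \<Longrightarrow> P F \<Longrightarrow> P (mode (- int k) F)"
    and add: "\<And>F G. F \<in> W_space p \<Longrightarrow> G \<in> W_space p \<Longrightarrow> P F \<Longrightarrow> P G \<Longrightarrow> P (F + G)"
    and scale: "\<And>c F. F \<in> W_space p \<Longrightarrow> P F \<Longrightarrow> P (cscale c F)"
  shows "P F"
  using assms(1)
proof (induction rule: sym_alg_induct)
  case (mult \<alpha> F)
  have zero: "P 0" using scale[OF vacuum_mem vac, of 0] by simp
  have sum: "P (\<Sum>i\<in>I. G i)" if "\<And>i. i \<in> I \<Longrightarrow> G i \<in> W_space p \<and> P (G i)" for I :: "nat set" and G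
    using that by (induction I rule: infinite_finite_induct) (auto simp: zero intro!: add sym_alg_sum)
  from mult(1) obtain Q where Q: "\<alpha> = form Q" by (rule K_spaceE)
  have "P (cscale c (degree_one (e (Suc i)) \<otimes>\<^sub>s F))" for c i
  proof -
    have "mode (- int (Suc i)) F = degree_one (e (Suc i)) \<otimes>\<^sub>s F" by (simp add: mode_def del: of_nat_Suc)
    with create[of "Suc i" F] mult show ?thesis by (intro scale) (simp_all add: degree_one_mem e_mem)
  qed
  then show ?case
    unfolding Q form_eq_sum_e degree_one_sum_sym_mult
    by (intro sum conjI sym_alg_cscale degree_one_mem e_mem mult)
qed (auto intro: assms)

context
  fixes \<xi> :: "int \<Rightarrow> complex \<Rightarrow> complex" and L :: "int \<Rightarrow> multidiff \<Rightarrow> multidiff"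
  assumes \<xi>: "field_germ n (\<xi> n)"
    and L_def: "L n F = L_op p (\<xi> n) F"
begin

lemma L_eq: "F \<in> W_space p \<Longrightarrow> L n F = minus_op n F + zero_op n F + omega_mode n \<otimes>\<^sub>s F"
  by (simp add: L_def L_op_def X_minus_eq[OF \<xi>] X_zero_eq[OF \<xi>] X_plus_def X_plus_vacuum_eq[OF \<xi>])

lemma omega_mode_sym_mult:
  assumes "F \<in> W_space p"
  shows "omega_mode n \<otimes>\<^sub>s F
       = cscale (- (1 / 2)) (\<Sum>a\<le>nat (- n). degree_one (e a) \<otimes>\<^sub>s (degree_one (e (nat (- n) - a)) \<otimes>\<^sub>s F))"
  using X_plus_eq[OF \<xi>[of n] assms] by (simp add: X_plus_def X_plus_vacuum_eq[OF \<xi>])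

lemma L_add: "F \<in> W_space p \<Longrightarrow> G \<in> W_space p \<Longrightarrow> L n (F + G) = L n F + L n G"
  by (simp add: L_eq sym_alg_add minus_op_add zero_op_add sym_mult_add_right)

lemma L_cscale: "F \<in> W_space p \<Longrightarrow> L n (cscale c F) = cscale c (L n F)"
  by (simp add: L_eq sym_alg_cscale minus_op_cscale zero_op_cscale sym_mult_cscale_right cscale_add_right)

lemma L_zero: "L n 0 = 0"
  using L_cscale[OF vacuum_mem, of n 0] by simp

lemma L_mem: "F \<in> W_space p \<Longrightarrow> L n F \<in> W_space p"
  by (auto simp: L_eq omega_mode_sym_mult minus_op_mem zero_op_mem e_mem
      intro!: sym_alg_add sym_alg_cscale sym_alg_sum degree_one_mem)

lemma L_vacuum: "L n vacuum = omega_mode n \<otimes>\<^sub>s vacuum"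
  by (simp add: L_eq vacuum_mem minus_op_vacuum zero_op_vacuum)

text \<open>
  Moving \<open>L n\<close> past a multiplication by \<open>e k\<close> contracts \<open>e k\<close> with the remaining factors (for \<open>k < n\<close>) or
  replaces it by \<open>k e (k - n)\<close> (for \<open>k > n\<close>). Both are \<open>k\<close> times the oscillator of index \<open>n - k\<close>.
\<close>
lemma L_create:
  assumes F: "F \<in> W_space p" and k: "0 < k"
  shows "L n (mode (- int k) F) = mode (- int k) (L n F) + cscale (of_nat k) (mode (n - int k) F)"
proof -
  let ?E = "degree_one (e k)"
  have m: "mode (- int k) G = ?E \<otimes>\<^sub>s G" for G using k by (simp add: mode_def)
  have "(\<Sum>i\<in>{1..<nat n}. cscale (- moment i (e k)) (contract (moment (nat n - i)) F))
      = (\<Sum>i\<in>{1..<nat n}. if i = k then cscale (of_nat k) (contract (moment (nat n - k)) F) else 0)"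
    by (intro sum.cong refl) (simp add: moment_e)
  also have "\<dots> = (if int k < n then cscale (of_nat k) (contract (moment (nat n - k)) F) else 0)"
    using k by auto
  finally have minus: "minus_op n (?E \<otimes>\<^sub>s F) = ?E \<otimes>\<^sub>s minus_op n F
      + (if int k < n then cscale (of_nat k) (contract (moment (nat n - k)) F) else 0)"
    by (simp add: minus_op_degree_one[OF e_mem F])
  have zero: "zero_op n (?E \<otimes>\<^sub>s F) = ?E \<otimes>\<^sub>s zero_op n F + cscale (of_nat k) (degree_one (e (nat (int k - n))) \<otimes>\<^sub>s F)"
  proof -
    have "{i. moment i (e k) \<noteq> 0} \<subseteq> {k}" by (auto simp: moment_e)
    from zero_op_degree_one[OF e_mem F _ this, of n] show ?thesis by (simp add: moment_e)
  qed
  have "(if int k < n then cscale (of_nat k) (contract (moment (nat n - k)) F) else 0)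
      + cscale (of_nat k) (degree_one (e (nat (int k - n))) \<otimes>\<^sub>s F) = cscale (of_nat k) (mode (n - int k) F)"
  proof (cases "int k = n")
    case True
    then show ?thesis using mode_0[OF F] by (auto simp: degree_one_e_0)
  next
    case False
    then show ?thesis
      by (cases "int k < n") (auto simp: mode_def degree_one_e_0 nat_diff_distrib)
  qed
  then show ?thesis
    unfolding m by (simp add: L_eq F degree_one_mem e_mem minus zero sym_mult_add_right
      sym_mult_left_commute[of "omega_mode n"] add_ac) 
qed

text \<open>
  The oscillators transform like functions under the vector fields. For creating oscillators this is
  \<open>L_create\<close>. For annihilating ones it is propagated from the vacuum: the commutators of both sides with
  a creating oscillator agree by the Heisenberg relations. On the vacuum it is a statement about the
  bidifferential \<open>omega_mode n\<close>, whose contraction is a single form.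
\<close>
lemma L_mode:
  assumes "F \<in> W_space p"
  shows "L n (mode j F) = mode j (L n F) + cscale (- of_int j) (mode (n + j) F)"
proof (cases "j < 0")
  case True
  then show ?thesis using L_create[OF assms, of "nat (- j)" n] by simp
next
  case False
  then obtain i where j: "j = int i" by (metis nonneg_int_cases not_less)
  show ?thesis
    using assms
  proof (induction rule: mode_induct)
    case vacuum
    let ?N = "nat (- n)"
    have pair: "contract (moment i) (degree_one (e a) \<otimes>\<^sub>s (degree_one (e b) \<otimes>\<^sub>s vacuum))
        = cscale (moment i (e a)) (degree_one (e b) \<otimes>\<^sub>s vacuum) + cscale (moment i (e b)) (degree_one (e a) \<otimes>\<^sub>s vacuum)" for a b
      by (simp add: contract_moment_simps degree_one_mem e_mem vacuum_mem sym_mult_cscale_right)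
    have "(\<Sum>a\<le>?N. cscale (moment i (e (?N - a))) (degree_one (e a) \<otimes>\<^sub>s vacuum))
        = (\<Sum>a\<le>?N. cscale (moment i (e a)) (degree_one (e (?N - a)) \<otimes>\<^sub>s vacuum))"
      by (rule sum.reindex_bij_witness[of _ "\<lambda>a. ?N - a" "\<lambda>a. ?N - a"]) auto
    then have "contract (moment i) (L n vacuum)
        = cscale (- 1) (\<Sum>a\<le>?N. cscale (moment i (e a)) (degree_one (e (?N - a)) \<otimes>\<^sub>s vacuum))"
      by (simp add: L_vacuum omega_mode_sym_mult vacuum_mem contract_cscale[OF functional_moment]
          contract_sum[OF functional_moment] sym_alg_sum degree_one_mem e_mem pair sum.distrib add_self)
    also have "\<dots> = (\<Sum>a\<le>?N. if a = i then cscale (of_nat i) (degree_one (e (?N - i)) \<otimes>\<^sub>s vacuum) else 0)"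
      unfolding cscale_sum by (intro sum.cong refl) (simp add: moment_e)
    also have "\<dots> = (if i \<le> ?N then cscale (of_nat i) (degree_one (e (?N - i)) \<otimes>\<^sub>s vacuum) else 0)"
      by simp
    also have "\<dots> = cscale (of_int j) (mode (n + j) vacuum)"
    proof (cases "n + j < 0")
      case True
      then have "i \<le> ?N" "nat (- (n + j)) = ?N - i" using j by auto
      with True j show ?thesis by (simp add: mode_def)
    next
      case False
      then have "i > ?N \<or> ?N - i = 0" using j by auto
      with False show ?thesis by (auto simp: mode_vacuum degree_one_e_0)
    qed
    finally have "mode j (L n vacuum) = cscale (of_int j) (mode (n + j) vacuum)"
      by (simp add: mode_def j)
    then show ?case
      using False by (simp add: mode_vacuum L_zero flip: cscale_add_left)
  next
    case (create k F)
    \<comment> \<open>Both commutators are brought to the normal form with creating oscillators on the left.\<close>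
    let ?\<delta> = "\<lambda>i j. if i + j = 0 then - of_int i else (0 :: complex)"
    note mem = create(2) mode_mem L_mem sym_alg_add sym_alg_cscale
    have "L n (mode j (mode (- int k) F))
        = L n (mode (- int k) (mode j F)) + cscale (?\<delta> j (- int k)) (L n F)"
      by (subst heisenberg_relation[OF create(2)]) (simp add: L_add L_cscale mem)
    also have "L n (mode (- int k) (mode j F))
        = mode (- int k) (mode j (L n F)) + cscale (- of_int j) (mode (- int k) (mode (n + j) F))
          + cscale (of_nat k) (mode (n - int k) (mode j F))"
      by (simp add: L_create[OF mode_mem[OF create(2)] create(1)] create(3) mode_add mode_cscale mem)
    finally have left: "L n (mode j (mode (- int k) F))
        = mode (- int k) (mode j (L n F)) + cscale (- of_int j) (mode (- int k) (mode (n + j) F))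
          + cscale (of_nat k) (mode (n - int k) (mode j F)) + cscale (?\<delta> j (- int k)) (L n F)" .
    have "mode j (L n (mode (- int k) F))
        = mode j (mode (- int k) (L n F)) + cscale (of_nat k) (mode j (mode (n - int k) F))"
      by (simp add: L_create[OF create(2,1)] mode_add mode_cscale mem)
    also have "\<dots> = mode (- int k) (mode j (L n F)) + cscale (?\<delta> j (- int k)) (L n F)
        + cscale (of_nat k) (mode (n - int k) (mode j F) + cscale (?\<delta> j (n - int k)) F)"
      by (simp only: heisenberg_relation[OF L_mem[OF create(2)], of j] heisenberg_relation[OF create(2), of j])
    finally have right: "mode j (L n (mode (- int k) F))
        = mode (- int k) (mode j (L n F)) + cscale (?\<delta> j (- int k)) (L n F)
        + cscale (of_nat k) (mode (n - int k) (mode j F) + cscale (?\<delta> j (n - int k)) F)" .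
    have last: "mode (n + j) (mode (- int k) F) = mode (- int k) (mode (n + j) F) + cscale (?\<delta> (n + j) (- int k)) F"
      by (rule heisenberg_relation[OF create(2)])
    have rearrange: "A + cscale x B + cscale y C + D = A + D + cscale y (C + cscale c F) + cscale x (B + cscale d F)"
      if "y * c + x * d = 0" for A B C D and x y c d :: complex
    proof
      fix zs
      have "y * (c * F zs) + x * (d * F zs) = (y * c + x * d) * F zs" by (simp add: algebra_simps)
      with that show "(A + cscale x B + cscale y C + D) zs
          = (A + D + cscale y (C + cscale c F) + cscale x (B + cscale d F)) zs"
        by (simp add: cscale_def plus_fun_apply algebra_simps)
    qed
    \<comment> \<open>The two scalar terms occur for the same index, namely for n + j = k, and cancel.\<close>
    have "of_nat k * ?\<delta> j (n - int k) + (- of_int j) * ?\<delta> (n + j) (- int k) = 0"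
    proof (cases "n + j = int k")
      case True
      then have "of_int (n + j) = (of_nat k :: complex)" by simp
      with True show ?thesis by simp
    qed simp
    then show ?case
      unfolding left right last by (rule rearrange)
  next
    case (add F G)
    then show ?case
      by (simp add: L_add mode_add mode_mem L_mem cscale_add_right add_ac)
  next
    case (cscale c F)
    then show ?case
      by (simp add: L_cscale mode_cscale mode_mem L_mem cscale_add_right mult.commute)
  qed
qed

text \<open>
  The amount by which the relation without central term fails.
\<close>
definition defect :: "int \<Rightarrow> int \<Rightarrow> multidiff \<Rightarrow> multidiff" where
  "defect l m F = L l (L m F) + cscale (- 1) (L m (L l F)) + cscale (- of_int (l - m)) (L (l + m) F)"

lemma defect_mem: "F \<in> W_space p \<Longrightarrow> defect l m F \<in> W_space p"
  unfolding defect_def by (intro sym_alg_add sym_alg_cscale L_mem)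

lemma defect_add: "F \<in> W_space p \<Longrightarrow> G \<in> W_space p \<Longrightarrow> defect l m (F + G) = defect l m F + defect l m G"
  by (simp add: defect_def L_add L_mem cscale_add_right add_ac)

lemma defect_cscale: "F \<in> W_space p \<Longrightarrow> defect l m (cscale c F) = cscale c (defect l m F)"
  by (simp add: defect_def L_cscale L_mem cscale_add_right mult.commute)

text \<open>
  Jacobi identity: both commutators act on the oscillators by \<open>L_mode\<close>, and there the vector field
  relation holds without central term.
\<close>
lemma defect_mode:
  assumes "F \<in> W_space p"
  shows "defect l m (mode j F) = mode j (defect l m F)"
proof -
  have LL: "L a (L b (mode j F)) = mode j (L a (L b F)) + cscale (- of_int j) (mode (a + j) (L b F))
      + cscale (- of_int j) (mode (b + j) (L a F))
      + cscale (of_int j * of_int (b + j)) (mode (a + b + j) F)" for a b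
    using assms by (simp add: L_mode L_add L_cscale L_mem mode_mem sym_alg_cscale cscale_add_right
        add.assoc add.left_commute[of b a]) (simp add: algebra_simps)
  have "defect l m (mode j F) = mode j (L l (L m F)) + cscale (- 1) (mode j (L m (L l F)))
      + cscale (- of_int (l - m)) (mode j (L (l + m) F))"
    unfolding defect_def LL
    unfolding L_mode[OF assms] add.commute[of m l]
    by (simp add: fun_eq_iff cscale_def plus_fun_apply algebra_simps)
  also have "\<dots> = mode j (defect l m F)"
    by (simp add: defect_def mode_add mode_cscale L_mem sym_alg_cscale sym_alg_add assms)
  finally show ?thesis .
qed

text \<open>
  An element whose contractions all vanish has vanishing moments in its first variable, hence
  vanishes in every positive degree.
\<close>
lemma annihilated_imp_scalar:
  assumes "G \<in> W_space p" "\<And>j. mode (int j) G = 0"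
  shows "G = cscale (G []) vacuum"
proof
  fix zs
  show "G zs = cscale (G []) vacuum zs"
  proof (cases zs)
    case (Cons w ws)
    have "moment j (\<lambda>w. G (w # ws)) = 0" for j
    proof -
      have "contract (moment j) G ws = 0" using assms(2)[of j] by (simp add: mode_def zero_fun_apply)
      then show ?thesis by (simp add: contract_def del: of_nat_Suc)
    qed
    from moment_eq_zero_imp_zero[OF slice_mem[OF assms(1)] this] have "G (w # ws) = 0" by metis
    then show ?thesis by (simp add: Cons cscale_def vacuum_def)
  qed (simp add: cscale_def vacuum_def)
qed

lemma L_vacuum_Nil: "L n vacuum [] = 0"
  by (simp add: L_vacuum omega_mode_sym_mult vacuum_mem cscale_def sum_fun_apply degree_one_sym_mult_Nil)

text \<open>
  The degree zero part of \<open>L l (L m 1)\<close> is the full contraction of \<open>omega_mode m\<close>: both factors of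
  \<open>e a \<otimes> e b\<close> are consumed only if \<open>l = a + b = - m\<close>. The source of the central charge is the sum
  \<open>\<Sum> a (N - a) = (N\<^sup>3 - N) / 6\<close>.
\<close>
lemma L_L_vacuum_Nil:
  "L l (L m vacuum) [] = (if l = int (nat (- m)) then (of_int l ^ 3 - of_int l) / 12 else 0)"
proof -
  let ?N = "nat (- m)"
  have pair: "L l (degree_one (e a) \<otimes>\<^sub>s (degree_one (e b) \<otimes>\<^sub>s vacuum)) []
      = (if l = int (a + b) then - (of_nat a * of_nat b) else 0)" for a b
  proof (cases "a = 0")
    case True
    then show ?thesis by (simp add: degree_one_e_0 L_zero zero_fun_apply)
  next
    case False
    have mem: "degree_one (e b) \<otimes>\<^sub>s vacuum \<in> W_space p" by (intro degree_one_mem e_mem vacuum_mem)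
    have "L l (degree_one (e a) \<otimes>\<^sub>s (degree_one (e b) \<otimes>\<^sub>s vacuum)) []
        = of_nat a * mode (l - int a) (degree_one (e b) \<otimes>\<^sub>s vacuum) []"
      using L_create[OF mem, of a l] False
      by (simp add: mode_def[of "- int a"] plus_fun_apply cscale_def degree_one_sym_mult_Nil)
    also have "mode (l - int a) (degree_one (e b) \<otimes>\<^sub>s vacuum) [] = (if l = int (a + b) then - of_nat b else 0)"
    proof (cases "l - int a < 0")
      case True
      then show ?thesis by (auto simp: mode_def degree_one_sym_mult_Nil)
    next
      case nonneg: False
      then have "mode (l - int a) (degree_one (e b) \<otimes>\<^sub>s vacuum) = cscale (moment (nat (l - int a)) (e b)) vacuum"
        by (simp add: mode_def contract_moment_simps e_mem vacuum_mem)
      then have "mode (l - int a) (degree_one (e b) \<otimes>\<^sub>s vacuum) [] = moment (nat (l - int a)) (e b)"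
        by (simp only:) (simp add: cscale_def vacuum_def)
      with nonneg show ?thesis by (auto simp: moment_e)
    qed
    finally show ?thesis by simp
  qed
  have mem: "degree_one (e a) \<otimes>\<^sub>s (degree_one (e b) \<otimes>\<^sub>s vacuum) \<in> W_space p" for a b
    by (intro degree_one_mem e_mem vacuum_mem)
  have L_sum: "L l (\<Sum>a\<in>A. G a) = (\<Sum>a\<in>A. L l (G a))" if "\<And>a. G a \<in> W_space p" for A :: "nat set" and G
    using that by (induction A rule: infinite_finite_induct) (simp_all add: L_zero L_add sym_alg_sum)
  have "L l (L m vacuum) = cscale (- (1 / 2))
      (\<Sum>a\<le>?N. L l (degree_one (e a) \<otimes>\<^sub>s (degree_one (e (?N - a)) \<otimes>\<^sub>s vacuum)))"
    by (simp only: L_vacuum[of m] omega_mode_sym_mult[OF vacuum_mem] L_cscale[OF sym_alg_sum[OF mem]] L_sum[OF mem])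
  then have "L l (L m vacuum) [] = - (1 / 2) * (\<Sum>a\<le>?N. if l = int ?N then - (of_nat a * of_nat (?N - a)) else 0)"
    by (simp only: cscale_def sum_fun_apply pair) simp
  also have "\<dots> = (if l = int ?N then (1 / 2) * (\<Sum>a\<le>?N. of_nat a * of_nat (?N - a)) else 0)"
    by (simp add: sum_negf)
  also have "\<dots> = (if l = int ?N then (of_int l ^ 3 - of_int l) / 12 else 0)"
  proof (cases "l = int ?N")
    case True
    then have N: "of_nat ?N = (of_int l :: complex)" by (metis of_int_of_nat_eq)
    show ?thesis unfolding sum_products N by simp
  qed simp
  finally show ?thesis .
qed

text \<open>
  The defect commutes with the annihilating oscillators, which kill the vacuum; so it maps the vacuum
  to a multiple of itself, and only the degree zero part has to be computed.
\<close>
lemma defect_vacuum: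
  "defect l m vacuum = cscale (of_int (l ^ 3 - l) / 12 * (if l + m = 0 then 1 else 0)) vacuum"
proof -
  have "mode (int j) (defect l m vacuum) = 0" for j
  proof -
    have "defect l m 0 = 0" using defect_cscale[OF vacuum_mem, of l m 0] by simp
    then show ?thesis by (simp add: mode_vacuum flip: defect_mode[OF vacuum_mem])
  qed
  then have "defect l m vacuum = cscale (defect l m vacuum []) vacuum"
    by (rule annihilated_imp_scalar[OF defect_mem[OF vacuum_mem]])
  moreover have "defect l m vacuum [] = of_int (l ^ 3 - l) / 12 * (if l + m = 0 then 1 else 0)"
  proof -
    have *: "defect l m vacuum [] = L l (L m vacuum) [] - L m (L l vacuum) []"
      by (simp add: defect_def plus_fun_apply cscale_def L_vacuum_Nil)
    show ?thesis
    proof (cases "l + m = 0")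
      case True
      then have m: "m = - l" by simp
      show ?thesis
        unfolding * by (cases "l < 0"; cases "l = 0") (simp_all add: L_L_vacuum_Nil m diff_divide_distrib)
    next
      case False
      have "L a (L b vacuum) [] = 0" if "a + b \<noteq> 0" for a b
      proof (cases "a = int (nat (- b))")
        case True
        \<comment> \<open>The truncation of \<open>nat\<close> leaves only this index, for which the value is 0.\<close>
        with that have "a = 0" by (cases "b \<le> 0") auto
        then show ?thesis by (simp add: L_L_vacuum_Nil)
      next
        case False
        then show ?thesis by (simp add: L_L_vacuum_Nil)
      qed
      from this[of l m] this[of m l] False have "L l (L m vacuum) [] = 0" "L m (L l vacuum) [] = 0"
        by (simp_all add: add.commute)
      with False show ?thesis by (simp add: *)
    qed
  qed
  ultimately show ?thesis by simp
qed

text \<open>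
  An operator that commutes with the creating oscillators is determined by its value on the vacuum.
\<close>
lemma defect_eq:
  assumes "F \<in> W_space p"
  shows "defect l m F = cscale (of_int (l ^ 3 - l) / 12 * (if l + m = 0 then 1 else 0)) F"
  using assms
proof (induction rule: mode_induct)
  case (create k F)
  then show ?case by (simp add: defect_mode mode_cscale)
qed (simp_all only: defect_vacuum defect_add defect_cscale cscale_add_right cscale_simps mult.commute)

theorem virasoro_relation:
  assumes "F \<in> W_space p"
  shows "L l (L m F) - L m (L l F) =
      cscale (of_int (l - m)) (L (l + m) F)
      + cscale (of_int (l ^ 3 - l) / 12 * (if l + m = 0 then 1 else 0)) F"
  unfolding defect_eq[OF assms, symmetric] defect_def
  by (simp add: fun_eq_iff plus_fun_apply cscale_def algebra_simps)

end

end

section \<open>Coordinates on the projective line\<close>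

lemma simple_pole_factor:
  assumes "f meromorphic_on {0}" "is_pole f 0" "zorder f 0 = - 1"
  obtains g where "g analytic_on {0}" "\<forall>\<^sub>F t in at 0. f t * t = g t"
proof -
  have "isolated_singularity_at f 0" "not_essential f 0"
    using assms(1) by (simp_all add: meromorphic_at_iff)
  moreover have "\<forall>\<^sub>F t in at 0. f t \<noteq> 0"
    using assms(2) unfolding is_pole_def by (rule filterlim_at_infinity_imp_eventually_ne)
  then have "\<exists>\<^sub>F t in at 0. f t \<noteq> 0"
    by (intro eventually_frequently) auto
  ultimately obtain \<rho> where \<rho>: "\<rho> > 0" "zor_poly f 0 holomorphic_on cball 0 \<rho>"
    "\<forall>w\<in>cball 0 \<rho> - {0}. f w = zor_poly f 0 w * w powi (- 1)"
    using zorder_exist[of f 0] assms(3) by auto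
  show thesis
  proof (rule that)
    show "zor_poly f 0 analytic_on {0}"
      using \<rho>(1,2) by (auto simp: analytic_at_ball intro!: exI[of _ \<rho>] elim!: holomorphic_on_subset)
    have "\<forall>\<^sub>F t in at 0. t \<in> cball 0 \<rho> - {0}"
      using \<rho>(1) by (auto simp: eventually_at dist_commute intro!: exI[of _ \<rho>])
    then show "\<forall>\<^sub>F t in at 0. f t * t = zor_poly f 0 t"
      by eventually_elim (use \<rho>(3) in \<open>auto simp: power_int_minus\<close>)
  qed
qed

text \<open>
  The chart condition says that \<open>f\<close> has at most a simple pole at infinity. Treating \<open>f\<close> as the
  coefficient of a vector field makes it regular there, which gives access to
  \<open>remove_sings_near_Infinity\<close>.
\<close>
lemma meromorphic_linear_growth:
  assumes mero: "f meromorphic_on UNIV" and reg: "\<And>z. regular_at 0 (Affine z) f"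
    and g: "g analytic_on {0}" "\<forall>\<^sub>F t in at 0. f (1 / t) * t = g t"
  obtains a b where "\<And>q. \<forall>\<^sub>F z in near q. f z = a * z + b"
proof -
  have inf: "regular_at (- 1) Infinity f"
  proof (rule regular_atI)
    show "(\<lambda>t. - t * g t) analytic_on {0}" using g(1) by (intro analytic_intros)
    show "\<forall>\<^sub>F t in at 0. f (chart Infinity t) * chart_jacobian Infinity t powi (- 1) = - t * g t"
      using g(2) by eventually_elim (auto simp: chart_def chart_jacobian_def power_int_minus power2_eq_square)
  qed
  have "remove_sings f holomorphic_on UNIV"
    by (intro entire_if_analytic remove_sings_regular[OF mero reg])
  moreover have "\<forall>\<^sub>F t in at 0. remove_sings f (1 / t) * t ^ 1 = g t"
    using g(2) remove_sings_near_Infinity[OF inf] by eventually_elim simp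
  ultimately obtain Q where Q: "degree Q \<le> 1" "remove_sings f = poly Q"
    using g(1) by (metis entire_is_poly)
  have "Q = [:coeff Q 0, coeff Q 1:]"
    using Q(1) by (intro poly_eqI) (auto simp: coeff_pCons coeff_eq_0 split: nat.split)
  then have lin: "poly Q z = coeff Q 1 * z + coeff Q 0" for z
    by (metis add.commute mult.commute mult_zero_right add_0_right poly_0 poly_pCons)
  have "\<forall>\<^sub>F z in near q. f z = coeff Q 1 * z + coeff Q 0" for q
  proof (cases q)
    case (Affine a)
    have "isolated_singularity_at f a"
      using meromorphic_on_subset[OF mero subset_UNIV, of "{a}"] by (simp add: meromorphic_at_iff)
    from eventually_remove_sings_eq_at[OF this] show ?thesis
      by (simp add: near_def Affine Q(2) lin eq_commute)
  next
    case Infinity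
    show ?thesis
      using remove_sings_near_Infinity[OF inf]
      by (simp add: eventually_near Infinity chart_def Q(2) lin eq_commute)
  qed
  then show thesis by (rule that)
qed

lemma eventually_near_neq: "\<forall>\<^sub>F z in near q. z \<noteq> w"
proof (cases q)
  case (Affine a)
  have "\<forall>\<^sub>F z in at a. z \<noteq> w"
    by (cases "a = w") (simp_all add: eventually_neq_at_within eventually_at_filter t1_space_nhds eventually_mono[OF t1_space_nhds])
  then show ?thesis by (simp add: near_def Affine)
next
  case Infinity
  show ?thesis
    by (auto simp: near_def Infinity eventually_at_infinity intro!: exI[of _ "norm w + 1"])
qed

text \<open>
  A coordinate may have wrong values at isolated points, so agreement is claimed on punctured
  neighbourhoods. If its pole is at an affine point \<open>w\<close>, multiplication by \<open>z - w\<close> moves it to infinity.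
\<close>
lemma coordinate_eq_moebius:
  assumes "coordinate u"
  obtains a b c d :: complex where "a * d - b * c \<noteq> 0"
    "\<forall>q. \<forall>\<^sub>F z in near q. c * z + d \<noteq> 0 \<and> u z = (a * z + b) / (c * z + d)"
proof -
  from assms obtain q0 where sec: "meromorphic_section 0 u"
    and pole: "is_pole (local_coeff 0 q0 u) 0" "zorder (local_coeff 0 q0 u) 0 = - 1"
    and reg: "\<And>q. q \<noteq> q0 \<Longrightarrow> regular_at 0 q u"
    by (auto simp: coordinate_def)
  have mero: "u meromorphic_on UNIV" using sec by (rule meromorphic_section_imp_meromorphic)
  have "local_coeff 0 q0 u meromorphic_on {0}" using sec by (simp add: meromorphic_section_def)
  from simple_pole_factor[OF this pole] obtain g where
    g: "g analytic_on {0}" "\<forall>\<^sub>F t in at 0. u (chart q0 t) * t = g t"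
    by (auto simp: local_coeff_eq)
  have not_const: False if "\<forall>\<^sub>F z in near q0. u z = c" for c
  proof -
    have "\<forall>\<^sub>F t in at 0. c = local_coeff 0 q0 u t"
      using that by (simp add: eventually_near local_coeff_eq eq_commute)
    then have "local_coeff 0 q0 u \<midarrow>0\<rightarrow> c" by (rule Lim_transform_eventually[OF tendsto_const])
    with tendsto_imp_not_pole pole(1) show False by blast
  qed
  show thesis
  proof (cases q0)
    case Infinity
    have "\<forall>\<^sub>F t in at 0. u (1 / t) * t = g t" using g(2) by (simp add: Infinity chart_def)
    with mero reg g(1) obtain a b where ab: "\<And>q. \<forall>\<^sub>F z in near q. u z = a * z + b"
      using meromorphic_linear_growth[of u g] Infinity by blast
    have "a \<noteq> 0" using not_const[of b] ab[of q0] by auto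
    with ab show thesis by (intro that[of a 1 b 0]) auto
  next
    case (Affine w)
    \<comment> \<open>The pole at w is traded for a simple pole at infinity.\<close>
    define f where "f z = (z - w) * u z" for z
    have f_mero: "f meromorphic_on UNIV"
      unfolding f_def[abs_def] by (intro meromorphic_intros mero)
    have f_reg: "regular_at 0 (Affine z) f" for z
    proof (cases "z = w")
      case True
      show ?thesis
      proof (rule regular_atI[OF g(1)])
        show "\<forall>\<^sub>F t in at 0. f (chart (Affine z) t) * chart_jacobian (Affine z) t powi 0 = g t"
          using g(2) by eventually_elim (simp add: f_def chart_def True Affine mult.commute)
      qed
    next
      case False
      with reg[of "Affine z"] Affine obtain h where h: "h analytic_on {0}"
        "\<forall>\<^sub>F t in at 0. u (chart (Affine z) t) * chart_jacobian (Affine z) t powi 0 = h t"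
        by (auto elim: regular_atE)
      show ?thesis
      proof (rule regular_atI)
        show "(\<lambda>t. (z + t - w) * h t) analytic_on {0}" using h(1) by (intro analytic_intros)
        show "\<forall>\<^sub>F t in at 0. f (chart (Affine z) t) * chart_jacobian (Affine z) t powi 0 = (z + t - w) * h t"
          using h(2) by eventually_elim (simp add: f_def chart_def)
      qed
    qed
    from reg[of Infinity] Affine obtain h where h: "h analytic_on {0}"
      "\<forall>\<^sub>F t in at 0. u (chart Infinity t) * chart_jacobian Infinity t powi 0 = h t"
      by (auto elim: regular_atE)
    have h': "(\<lambda>t. (1 - w * t) * h t) analytic_on {0}" using h(1) by (intro analytic_intros)
    have "\<forall>\<^sub>F t in at 0. f (1 / t) * t = (1 - w * t) * h t"
      using h(2) eventually_nonzero_at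
      by eventually_elim (auto simp: f_def chart_def field_simps)
    from meromorphic_linear_growth[OF f_mero f_reg h' this] obtain a b where
      ab: "\<And>q. \<forall>\<^sub>F z in near q. f z = a * z + b" by blast
    have u: "\<forall>\<^sub>F z in near q. 1 * z + - w \<noteq> 0 \<and> u z = (a * z + b) / (1 * z + - w)" for q
      using ab[of q] eventually_near_neq[of w q]
      by eventually_elim (simp add: f_def field_simps)
    have "a * (- w) - b * 1 \<noteq> 0"
    proof
      assume "a * (- w) - b * 1 = 0"
      then have b: "b = - (a * w)" by (simp add: algebra_simps)
      have "\<forall>\<^sub>F z in near q0. u z = a"
        using ab[of q0] eventually_near_neq[of w q0]
      proof eventually_elim
        case (elim z)
        then have "(z - w) * u z = (z - w) * a" by (simp add: f_def b algebra_simps)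
        with elim(2) show ?case by simp
      qed
      then show False by (rule not_const)
    qed
    with u show thesis by (intro that[of a "- w" b 1]) auto
  qed
qed

text \<open>
  The value 0 at \<open>p\<close> fixes the numerator: \<open>a (z - p)\<close> for an affine \<open>p\<close>, a constant for \<open>p\<close> at infinity.
  In both cases the reciprocal has one of the shapes of \<open>pole_coordinate\<close>.
\<close>
lemma moebius_vanishing_germ:
  fixes a b c d :: complex
  assumes det: "a * d - b * c \<noteq> 0"
    and u: "\<forall>\<^sub>F z in near p. c * z + d \<noteq> 0 \<and> u z = (a * z + b) / (c * z + d)"
    and "vanishes_at p u"
  obtains s r where "s \<noteq> 0" "\<forall>\<^sub>F z in near p. pole_coordinate.v p s r z \<noteq> 0 \<and> u z = 1 / pole_coordinate.v p s r z"
proof -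
  have lim: "((\<lambda>t. u (chart p t)) \<longlongrightarrow> 0) (at 0)"
    using assms(3) by (simp add: vanishes_at_def local_coeff_eq[abs_def])
  have u': "\<forall>\<^sub>F t in at 0. c * chart p t + d \<noteq> 0 \<and> u (chart p t) = (a * chart p t + b) / (c * chart p t + d)"
    using u by (simp add: eventually_near)
  show thesis
  proof (cases p)
    case (Affine w)
    have "(\<lambda>t. u (chart p t) * (c * (w + t) + d)) \<midarrow>0\<rightarrow> 0 * (c * (w + 0) + d)"
      by (intro tendsto_intros lim)
    then have "(\<lambda>t. a * (w + t) + b) \<midarrow>0\<rightarrow> 0 * (c * (w + 0) + d)"
      by (rule Lim_transform_eventually) (use u' in \<open>eventually_elim, simp add: chart_def Affine\<close>)
    moreover have "(\<lambda>t. a * (w + t) + b) \<midarrow>0\<rightarrow> a * (w + 0) + b" by (intro tendsto_intros)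
    ultimately have "a * (w + 0) + b = 0 * (c * (w + 0) + d)" using LIM_unique by blast
    then have b: "b = - (a * w)" by (simp add: eq_neg_iff_add_eq_0 add.commute)
    have D: "a * d - b * c = a * (c * w + d)" by (simp add: b algebra_simps)
    with det have a: "a \<noteq> 0" and cw: "c * w + d \<noteq> 0" by auto
    interpret pole_coordinate p "(c * w + d) / a" "c / a" by unfold_locales (use a cw in simp)
    show thesis
    proof (rule that)
      show "(c * w + d) / a \<noteq> 0" by (rule s_nonzero)
      show "\<forall>\<^sub>F z in near p. v z \<noteq> 0 \<and> u z = 1 / v z"
        using u eventually_near_generic
      proof eventually_elim
        case (elim z)
        then have z: "z \<noteq> w" by (auto simp: Affine)
        have "v z = (c * z + d) / (a * (z - w))"
          unfolding v_def using a z by (simp add: Affine field_simps)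
        moreover have "a * z + b = a * (z - w)" by (simp add: b algebra_simps)
        ultimately show ?case using elim by simp
      qed
    qed
  next
    case Infinity
    have "(\<lambda>t. u (chart p t) * (c + d * t)) \<midarrow>0\<rightarrow> 0 * (c + d * 0)"
      by (intro tendsto_intros lim)
    moreover have "\<forall>\<^sub>F t in at 0. u (chart p t) * (c + d * t) = a + b * t"
      using u' eventually_nonzero_at
    proof eventually_elim
      case (elim t)
      then have "c + d * t = (c * (1 / t) + d) * t" "a + b * t = (a * (1 / t) + b) * t"
        by (simp_all add: field_simps)
      with elim show ?case by (simp add: chart_def Infinity)
    qed
    ultimately have "(\<lambda>t. a + b * t) \<midarrow>0\<rightarrow> 0 * (c + d * 0)"
      by (rule Lim_transform_eventually)
    moreover have "(\<lambda>t. a + b * t) \<midarrow>0\<rightarrow> a + b * 0" by (intro tendsto_intros)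
    ultimately have "a + b * 0 = 0 * (c + d * 0)" using LIM_unique by blast
    then have a: "a = 0" by simp
    with det have bc: "b \<noteq> 0" "c \<noteq> 0" by auto
    interpret pole_coordinate p "c / b" "d / b" by unfold_locales (use bc in simp)
    show thesis
    proof (rule that)
      show "c / b \<noteq> 0" by (rule s_nonzero)
      show "\<forall>\<^sub>F z in near p. v z \<noteq> 0 \<and> u z = 1 / v z"
        using u eventually_near_generic
      proof eventually_elim
        case (elim z)
        have "v z = (c * z + d) / b"
          unfolding v_def by (simp add: Infinity add_divide_distrib)
        then show ?case using elim by (simp add: a)
      qed
    qed
  qed
qed

lemma (in pole_coordinate) field_germ_mode_field:
  assumes "\<forall>\<^sub>F z in near p. v z \<noteq> 0 \<and> u z = 1 / v z"
  shows "field_germ n (mode_field u n)"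
  unfolding field_germ_def
  using eventually_near_nhds[OF assms] eventually_near_generic
proof eventually_elim
  case (elim z)
  from eventually_nhds_x_imp_x[OF elim(1)] have u: "u z = 1 / v z" by simp
  have z: "Affine z \<noteq> p" "v z \<noteq> 0" using elim(2) by auto
  have "((\<lambda>y. 1 / v y) has_field_derivative - dv z / v z ^ 2) (at z)"
    using has_field_derivative_v[OF z(1)] z(2) by (auto intro!: derivative_eq_intros simp: power2_eq_square)
  moreover have "deriv u z = deriv (\<lambda>y. 1 / v y) z"
    using elim(1) by (intro deriv_cong_ev) (auto elim: eventually_mono)
  ultimately have "deriv u z = - dv z / v z ^ 2" by (metis DERIV_imp_deriv)
  then have "mode_field u n z = (1 / v z) powi (n + 1) * v z powi 2 / dv z"
    by (simp add: mode_field_def u)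
  also have "(1 / v z) powi (n + 1) * v z powi 2 = v z powi (2 - (n + 1))"
    using z(2) by (subst power_int_diff) (simp_all add: power_int_divide_distrib)
  finally show "mode_field u n z = v z powi (1 - n) / dv z" by simp
qed

theorem proposition5p16:
  fixes p :: proj_line and u :: "complex \<Rightarrow> complex"
    and L :: "int \<Rightarrow> multidiff \<Rightarrow> multidiff" and l m :: int
  assumes "coordinate u" and "vanishes_at p u"
  defines "L \<equiv> \<lambda>n. L_op p (mode_field u n)"
  shows "\<forall>F\<in>W_space p.
    L l (L m F) - L m (L l F) =
      cscale (of_int (l - m)) (L (l + m) F)
      + cscale (of_int (l ^ 3 - l) / 12 * (if l + m = 0 then 1 else 0)) F"
proof
  fix F assume F: "F \<in> W_space p"
  obtain a b c d where abcd: "a * d - b * c \<noteq> 0"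
    "\<forall>q. \<forall>\<^sub>F z in near q. c * z + d \<noteq> 0 \<and> u z = (a * z + b) / (c * z + d)"
    by (rule coordinate_eq_moebius[OF assms(1)])
  from abcd(1) spec[OF abcd(2), of p] assms(2) obtain s r where s: "s \<noteq> 0"
    and u: "\<forall>\<^sub>F z in near p. pole_coordinate.v p s r z \<noteq> 0 \<and> u z = 1 / pole_coordinate.v p s r z"
    by (rule moebius_vanishing_germ)
  interpret pole_coordinate p s r by unfold_locales (rule s)
  have "L n G = L_op p (mode_field u n) G" for n G by (simp add: L_def)
  from virasoro_relation[OF field_germ_mode_field[OF u] this F]
  show "L l (L m F) - L m (L l F) =
      cscale (of_int (l - m)) (L (l + m) F)
      + cscale (of_int (l ^ 3 - l) / 12 * (if l + m = 0 then 1 else 0)) F" .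
qed

end
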